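(* For every bandwidth ratio $b>0$ and side-information quality $\nu\ge 0$, the optimal distortion exponent satisfies $\Delta^*(b,\nu)\le \Delta_{up}(b,\nu)$, where $\Delta_{up}$ is defined as follows. If $\nu/M_*\ge M^*+M_*-1$, then $\Delta_{up}(b,\nu)=\nu+d^*(\nu/b)$. Otherwise, let $l=1$ if $\nu/M_*<M^*-M_*+1$, and if $M^*-M_*+1\le \nu/M_*<M^*+M_*-1$ let $l\in\{2,\dots,M_*\}$ be the integer with $2l-3+M^*-M_*\le \nu/M_*<2l-1+M^*-M_*$. Then $$\Delta_{up}(b,\nu)=\begin{cases}\nu & \text{if } 0\le b<\frac{\nu}{M_*},\\ bM_* & \text{if } \frac{\nu}{M_*}\le b<M^*-M_*+1,\\ \nu+d^*\!\left(\frac{\nu}{b}\right) & \text{if } 1+M^*-M_*\le b<2l-1+M^*-M_*,\\ \nu+d^*\!\left(\frac{\nu}{b}\right) & \text{if } 2l-1+M^*-M_*\le b<\frac{\nu}{M_*-k},\\ \Delta_{\mathrm{MIMO}}(b) & \text{if } \frac{\nu}{M_*-k}\le b<M^*+M_*-1,\\ \nu+d^*\!\left(\frac{\nu}{b}\right) & \text{if } M^*+M_*-1\le b,\end{cases}$$ where $k\in\{l,\dots,M_*-1\}$ is the integer satisfying $2k-1+M^*-M_*\le b<2k+1+M^*-M_*$, and $\Delta_{\mathrm{MIMO}}(b)=\sum_{i=1}^{M_*}\min\{b,\,2i-1+M^*-M_*\}$.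
   Context: All logarithms are base 2. Let $M_t,M_r\ge1$ be integers, $M^*=\max\{M_t,M_r\}$, $M_*=\min\{M_t,M_r\}$. A block $S^m$ of i.i.d. $\mathcal{CN}(0,1)$ source samples must be sent over one block of $n$ uses of the MIMO channel $\mathbf Y_i=\sqrt{\rho/M_t}\,\mathbf H\mathbf x_i+\mathbf N_i$, $i=1,\dots,n$, where $\rho>0$ is the average SNR, $\mathbf H\in\mathbb C^{M_r\times M_t}$ has i.i.d. $\mathcal{CN}(0,1)$ entries and is constant over the block, $\mathbf N_i\sim\mathcal{CN}(0,\mathbf I)$ i.i.d., and the input satisfies $\sum_{i=1}^n\mathrm{Tr}\,\mathbb E[\mathbf X_i^H\mathbf X_i]\le nM_t$. The receiver also observes $T^m=\sqrt{\rho_s}\,\Gamma_c S^m+Z^m$, where $\Gamma_c\sim\mathcal{CN}(0,1)$ is constant over the block and $Z^m$ is i.i.d. unit-variance Gaussian noise; $\Gamma=|\Gamma_c|^2$ (density $e^{-\gamma}$, $\gamma\ge0$). The source, $\mathbf H$, $\Gamma_c$ and all noises are independent. The receiver knows $\mathbf H$ and $\gamma$; the transmitter knows only their distributions. The bandwidth ratio is $b=n/m$. An encoder maps $S^m$ to $\mathbf X^n\in\mathbb C^{M_t\times n}$ and a decoder maps $(\mathbf Y^n,T^m,\mathbf H,\gamma)$ to $\hat S^m$; the distortion is $D=\frac1m\sum_i|S_i-\hat S_i|^2$, and $ED^*(\rho,\rho_s,b)=\lim_{n,m\to\infty}\min\mathbb E[D]$ over encoder/decoder pairs with $n\le mb$.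 The side-information quality is $\nu=\lim_{\rho\to\infty}\log\rho_s/\log\rho$ (i.e. $\rho_s\doteq\rho^\nu$, where $f\doteq g$ means $\lim\log f/\log g=1$). The distortion exponent of an expected distortion $\mathbb E[D]$ is $-\lim_{\rho\to\infty}\log\mathbb E[D]/\log\rho$ (with $\rho_s\doteq\rho^\nu$); the optimal distortion exponent $\Delta^*(b,\nu)$ is the distortion exponent of $ED^*$. For $k=0,\dots,M_*$ let $\Phi_k=(M^*-k)(M_*-k)$ and $\Upsilon_k=M^*+M_*-2k-1$. The diversity-multiplexing tradeoff curve $d^*$ is $d^*(r)=\Phi_k-\Upsilon_k(r-k)$ for $k\le r\le k+1$, $k=0,\dots,M_*-1$, and $d^*(r)=0$ for $r\ge M_*$. *)

theory Defs
  imports "HOL-Probability.Probability"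
begin

definition Mmax :: "nat \<Rightarrow> nat \<Rightarrow> real" where
  "Mmax Mt Mr = real (max Mt Mr)"

definition Mmin :: "nat \<Rightarrow> nat \<Rightarrow> real" where
  "Mmin Mt Mr = real (min Mt Mr)"

definition Phi :: "nat \<Rightarrow> nat \<Rightarrow> nat \<Rightarrow> real" where
  "Phi Mt Mr k = (Mmax Mt Mr - real k) * (Mmin Mt Mr - real k)"

definition Ups :: "nat \<Rightarrow> nat \<Rightarrow> nat \<Rightarrow> real" where
  "Ups Mt Mr k = Mmax Mt Mr + Mmin Mt Mr - 2 * real k - 1"

text \<open>DMT curve: on [k,k+1] (k < M_*) it is Phi_k - Ups_k (r - k); zero for r >= M_*.
  (For 0 <= r < M_* the segment index is k = floor r; the curve is continuous at integers.)\<close>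
definition dstar :: "nat \<Rightarrow> nat \<Rightarrow> real \<Rightarrow> real" where
  "dstar Mt Mr r =
     (if Mmin Mt Mr \<le> r then 0
      else (let k = nat \<lfloor>r\<rfloor> in Phi Mt Mr k - Ups Mt Mr k * (r - real k)))"

definition Delta_MIMO :: "nat \<Rightarrow> nat \<Rightarrow> real \<Rightarrow> real" where
  "Delta_MIMO Mt Mr b =
     (\<Sum>i = 1..min Mt Mr. min b (2 * real i - 1 + Mmax Mt Mr - Mmin Mt Mr))"

definition l_idx :: "nat \<Rightarrow> nat \<Rightarrow> real \<Rightarrow> nat" where
  "l_idx Mt Mr \<nu> =
     (if \<nu> / Mmin Mt Mr < Mmax Mt Mr - Mmin Mt Mr + 1 then 1
      else (THE l::nat. l \<in> {2..min Mt Mr} \<and>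
              2 * real l - 3 + Mmax Mt Mr - Mmin Mt Mr \<le> \<nu> / Mmin Mt Mr \<and>
              \<nu> / Mmin Mt Mr < 2 * real l - 1 + Mmax Mt Mr - Mmin Mt Mr))"

definition k_idx :: "nat \<Rightarrow> nat \<Rightarrow> real \<Rightarrow> real \<Rightarrow> nat" where
  "k_idx Mt Mr \<nu> b =
     (THE k::nat. k \<in> {l_idx Mt Mr \<nu>..min Mt Mr - 1} \<and>
        2 * real k - 1 + Mmax Mt Mr - Mmin Mt Mr \<le> b \<and>
        b < 2 * real k + 1 + Mmax Mt Mr - Mmin Mt Mr)"

definition Delta_up :: "nat \<Rightarrow> nat \<Rightarrow> real \<Rightarrow> real \<Rightarrow> real" where
  "Delta_up Mt Mr b \<nu> =
    (let Ma = Mmax Mt Mr; Mi = Mmin Mt Mr; x = \<nu> / Mi in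
     if Ma + Mi - 1 \<le> x then \<nu> + dstar Mt Mr (\<nu> / b)
     else (let l = real (l_idx Mt Mr \<nu>); k = real (k_idx Mt Mr \<nu> b) in
       if 0 \<le> b \<and> b < x then \<nu>
       else if x \<le> b \<and> b < Ma - Mi + 1 then b * Mi
       else if 1 + Ma - Mi \<le> b \<and> b < 2 * l - 1 + Ma - Mi then \<nu> + dstar Mt Mr (\<nu> / b)
       else if 2 * l - 1 + Ma - Mi \<le> b \<and> b < \<nu> / (Mi - k) then \<nu> + dstar Mt Mr (\<nu> / b)
       else if \<nu> / (Mi - k) \<le> b \<and> b < Ma + Mi - 1 then Delta_MIMO Mt Mr b
       else if Ma + Mi - 1 \<le> b then \<nu> + dstar Mt Mr (\<nu> / b)
       else 0))"

definition CN :: "complex measure" where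
  "CN = density lborel (\<lambda>z. ennreal (exp (- (cmod z)\<^sup>2) / pi))"

definition src_meas :: "nat \<Rightarrow> (nat \<Rightarrow> complex) measure" where
  "src_meas m = PiM {..<m} (\<lambda>_. CN)"

definition mat_meas :: "nat \<Rightarrow> nat \<Rightarrow> (nat \<times> nat \<Rightarrow> complex) measure" where
  "mat_meas a c = PiM ({..<a} \<times> {..<c}) (\<lambda>_. CN)"

text \<open>Joint law of (S^m, H, Gamma_c, N^n, Z^m), all independent.\<close>
definition omega :: "nat \<Rightarrow> nat \<Rightarrow> nat \<Rightarrow> nat \<Rightarrow>
   ((nat \<Rightarrow> complex) \<times> (nat \<times> nat \<Rightarrow> complex) \<times> complex \<times> (nat \<times> nat \<Rightarrow> complex) \<times> (nat \<Rightarrow> complex)) measure" where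
  "omega Mt Mr m n = src_meas m \<Otimes>\<^sub>M (mat_meas Mr Mt \<Otimes>\<^sub>M (CN \<Otimes>\<^sub>M (mat_meas Mr n \<Otimes>\<^sub>M src_meas m)))"

definition chan_out :: "nat \<Rightarrow> nat \<Rightarrow> nat \<Rightarrow> real \<Rightarrow> (nat \<times> nat \<Rightarrow> complex) \<Rightarrow>
    (nat \<times> nat \<Rightarrow> complex) \<Rightarrow> (nat \<times> nat \<Rightarrow> complex) \<Rightarrow> (nat \<times> nat \<Rightarrow> complex)" where
  "chan_out Mt Mr n \<rho> X H N = (\<lambda>(r, i). if r < Mr \<and> i < n then
      complex_of_real (sqrt (\<rho> / real Mt)) * (\<Sum>t<Mt. H (r, t) * X (t, i)) + N (r, i) else 0)"

definition side_out :: "nat \<Rightarrow> real \<Rightarrow> complex \<Rightarrow> (nat \<Rightarrow> complex) \<Rightarrow> (nat \<Rightarrow> complex) \<Rightarrow> (nat \<Rightarrow> complex)" where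
  "side_out m \<rho>s g S Z = (\<lambda>j. if j < m then complex_of_real (sqrt \<rho>s) * g * S j + Z j else 0)"

definition estimate :: "nat \<Rightarrow> nat \<Rightarrow> nat \<Rightarrow> nat \<Rightarrow> real \<Rightarrow> real \<Rightarrow>
    ((nat \<Rightarrow> complex) \<Rightarrow> (nat \<times> nat \<Rightarrow> complex)) \<Rightarrow>
    ((nat \<times> nat \<Rightarrow> complex) \<Rightarrow> (nat \<Rightarrow> complex) \<Rightarrow> (nat \<times> nat \<Rightarrow> complex) \<Rightarrow> real \<Rightarrow> (nat \<Rightarrow> complex)) \<Rightarrow>
    ((nat \<Rightarrow> complex) \<times> (nat \<times> nat \<Rightarrow> complex) \<times> complex \<times> (nat \<times> nat \<Rightarrow> complex) \<times> (nat \<Rightarrow> complex))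
    \<Rightarrow> (nat \<Rightarrow> complex)" where
  "estimate Mt Mr m n \<rho> \<rho>s enc dec \<omega> = (case \<omega> of (S, H, g, N, Z) \<Rightarrow>
      dec (chan_out Mt Mr n \<rho> (enc S) H N) (side_out m \<rho>s g S Z) H ((cmod g)\<^sup>2))"

definition adm_enc :: "nat \<Rightarrow> nat \<Rightarrow> nat \<Rightarrow> ((nat \<Rightarrow> complex) \<Rightarrow> (nat \<times> nat \<Rightarrow> complex)) \<Rightarrow> bool" where
  "adm_enc Mt m n enc \<longleftrightarrow>
     (\<forall>t i. (\<lambda>S. enc S (t, i)) \<in> borel_measurable (src_meas m)) \<and>
     (\<integral>\<^sup>+ S. ennreal (\<Sum>i<n. \<Sum>t<Mt. (cmod (enc S (t, i)))\<^sup>2) \<partial>src_meas m) \<le> ennreal (real n * real Mt)"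

definition adm_dec :: "nat \<Rightarrow> nat \<Rightarrow> nat \<Rightarrow> nat \<Rightarrow> real \<Rightarrow> real \<Rightarrow>
    ((nat \<Rightarrow> complex) \<Rightarrow> (nat \<times> nat \<Rightarrow> complex)) \<Rightarrow>
    ((nat \<times> nat \<Rightarrow> complex) \<Rightarrow> (nat \<Rightarrow> complex) \<Rightarrow> (nat \<times> nat \<Rightarrow> complex) \<Rightarrow> real \<Rightarrow> (nat \<Rightarrow> complex)) \<Rightarrow> bool" where
  "adm_dec Mt Mr m n \<rho> \<rho>s enc dec \<longleftrightarrow>
     (\<forall>j<m. (\<lambda>\<omega>. estimate Mt Mr m n \<rho> \<rho>s enc dec \<omega> j) \<in> borel_measurable (omega Mt Mr m n))"

definition exp_dist :: "nat \<Rightarrow> nat \<Rightarrow> nat \<Rightarrow> nat \<Rightarrow> real \<Rightarrow> real \<Rightarrow>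
    ((nat \<Rightarrow> complex) \<Rightarrow> (nat \<times> nat \<Rightarrow> complex)) \<Rightarrow>
    ((nat \<times> nat \<Rightarrow> complex) \<Rightarrow> (nat \<Rightarrow> complex) \<Rightarrow> (nat \<times> nat \<Rightarrow> complex) \<Rightarrow> real \<Rightarrow> (nat \<Rightarrow> complex)) \<Rightarrow> ennreal" where
  "exp_dist Mt Mr m n \<rho> \<rho>s enc dec =
     (\<integral>\<^sup>+ \<omega>. ennreal ((1 / real m) * (\<Sum>j<m. (cmod (fst \<omega> j - estimate Mt Mr m n \<rho> \<rho>s enc dec \<omega> j))\<^sup>2))
        \<partial>omega Mt Mr m n)"

definition ED_block :: "nat \<Rightarrow> nat \<Rightarrow> real \<Rightarrow> real \<Rightarrow> nat \<Rightarrow> nat \<Rightarrow> ennreal" where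
  "ED_block Mt Mr \<rho> \<rho>s m n =
     (INF p \<in> {(enc, dec). adm_enc Mt m n enc \<and> adm_dec Mt Mr m n \<rho> \<rho>s enc dec}.
        exp_dist Mt Mr m n \<rho> \<rho>s (fst p) (snd p))"

definition ED_len :: "nat \<Rightarrow> nat \<Rightarrow> real \<Rightarrow> real \<Rightarrow> real \<Rightarrow> nat \<Rightarrow> ennreal" where
  "ED_len Mt Mr \<rho> \<rho>s b m = (INF n \<in> {n. real n \<le> b * real m}. ED_block Mt Mr \<rho> \<rho>s m n)"

text \<open>ED^*(rho, rho_s, b): limit (taken as liminf) over the block length.\<close>
definition ED_opt :: "nat \<Rightarrow> nat \<Rightarrow> real \<Rightarrow> real \<Rightarrow> real \<Rightarrow> ennreal" where
  "ED_opt Mt Mr \<rho> \<rho>s b = liminf (\<lambda>m. ED_len Mt Mr \<rho> \<rho>s b m)"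

end

theory Submission
  imports Defs
begin

text \<open>Fix \<open>r = k + f\<close> with \<open>k < M\<^sub>*\<close> and \<open>0 \<le> f \<le> 1\<close>. With probability of order \<open>\<rho>\<close> to the
  power \<open>-d\<^sup>*(r)\<close>, Gaussian elimination of the channel matrix meets only \<open>r\<close> effective pivots, and then
  the received block has density at most \<open>\<rho>\<close> to the power \<open>r n\<close>, times a constant per symbol, relative to a
  law that does not depend on the source.

  For such a channel let \<open>F\<close> be the distortion averaged over the side-information gain. If \<open>F\<close> is
  much smaller than \<open>1/\<rho>\<^sub>s\<close>, choose gains \<open>g\<^sub>0, \<dots>, g\<^sub>L\<close> growing geometrically from \<open>1/\<rho>\<^sub>s\<close> to \<open>1\<close> at
  which the distortion is controlled by \<open>F\<close>. The estimate made at one gain is accurate enough to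
  simulate the side information at the next one, at the cost of a constant factor per symbol. Hence
  all side information can be replaced by variables independent of the source, and a volume bound
  gives that \<open>F\<close> is at least of the order of \<open>\<rho>\<close> to the power \<open>-r b\<close>. So the exponent is at most
  \<open>d\<^sup>*(r) + max \<nu> (b r)\<close> for every \<open>r\<close>, and each branch of \<open>\<Delta>\<^sub>u\<^sub>p\<close> dominates this expression
  for a suitable \<open>r\<close>. The coarse grid of gains loses a factor \<open>1 + 1/L\<close> in \<open>\<nu>\<close>, removed by \<open>L \<rightarrow> \<infinity>\<close>.\<close>

section \<open>Complex Gaussian measures\<close>

text \<open>The transmitter does not know the side-information gain, so one codeword serves all
  gains; this is why a small \<open>F\<close> helps at every scale. A disc of squared radius
  \<open>a \<le> 1\<close> has Gaussian mass of order \<open>a\<close>, so it contains a gain with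
  distortion at most a constant times \<open>F / a\<close>. A later look of signal power p can be
  simulated from that estimate when \<open>p * F / a\<close> is bounded. If consecutive squared
  radii have ratio \<open>\<tau>\<close>, this always means that \<open>F * \<tau> * \<rho>s\<close>
  is bounded, and \<open>\<tau>\<close> is the L-th root of \<open>\<rho>s\<close>: hence the loss
  \<open>1 + 1 / L\<close>. \<open>L\<close> stays fixed while \<rho> grows because the number of
  looks enters the constants.

  Constants to the power \<open>m\<close> cost nothing: the final inequality reads
  \<open>1 / 2 \<le> X ^ m\<close> with \<open>X\<close> a constant times \<open>F\<close> times
  \<rho> to the power r b, which is absurd once \<open>X \<le> 1 / 4\<close>, uniformly in the block
  length. The comparison of laws is pointwise, between densities on typical sets, and typicality
  comes from Markov bounds.

  Elimination takes the place of singular values because its residuals are triangular in the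
  entries: volumes become products of disc areas, and the same triangularity normalises the
  reference law of the received block.\<close>

abbreviation leb :: "'i set \<Rightarrow> ('i \<Rightarrow> complex) measure" where
  "leb I \<equiv> Pi\<^sub>M I (\<lambda>_. lborel)"

abbreviation cnp :: "'i set \<Rightarrow> ('i \<Rightarrow> complex) measure" where
  "cnp I \<equiv> Pi\<^sub>M I (\<lambda>_. CN)"

definition gauss :: "complex \<Rightarrow> real" where
  "gauss z = exp (- (cmod z)\<^sup>2) / pi"

lemma gauss_pos [simp]: "gauss z > 0"
  by (simp add: gauss_def)

lemma gauss_nonneg [simp]: "0 \<le> gauss z"
  using gauss_pos[of z] by linarith

lemma gauss_measurable [measurable]: "gauss \<in> borel_measurable borel"
  unfolding gauss_def by measurable

lemma CN_gauss: "CN = density lborel (\<lambda>z. ennreal (gauss z))"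
  by (simp add: CN_def gauss_def)

lemma sets_CN [measurable_cong]: "sets CN = sets borel"
  by (simp add: CN_def)

lemma space_CN [simp]: "space CN = UNIV"
  by (simp add: CN_def)

lemma nn_integral_CN:
  assumes [measurable]: "f \<in> borel_measurable borel"
  shows "(\<integral>\<^sup>+z. f z \<partial>CN) = (\<integral>\<^sup>+z. ennreal (gauss z) * f z \<partial>lborel)"
  unfolding CN_gauss by (subst nn_integral_density) auto

lemma nn_integral_exp_square:
  assumes "s > 0"
  shows "(\<integral>\<^sup>+(x::real). ennreal (exp (- (x\<^sup>2 / s))) \<partial>lborel) = ennreal (sqrt (pi * s))"
proof -
  have tot: "(\<integral>\<^sup>+(x::real). ennreal (normal_density 0 (sqrt (s/2)) x) \<partial>lborel) = 1"
    using assms prob_space.emeasure_space_1[OF prob_space_normal_density[of "sqrt (s/2)" 0]]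
    by (simp add: emeasure_density)
  have "normal_density 0 (sqrt (s/2)) x = exp (- (x\<^sup>2 / s)) / sqrt (pi * s)" for x
    using assms by (simp add: normal_density_def)
  then have "exp (- (x\<^sup>2 / s)) = normal_density 0 (sqrt (s/2)) x * sqrt (pi * s)" for x
    using assms by (simp add: field_simps)
  then have "(\<integral>\<^sup>+(x::real). ennreal (exp (- (x\<^sup>2 / s))) \<partial>lborel)
      = (\<integral>\<^sup>+(x::real). ennreal (normal_density 0 (sqrt (s/2)) x) * ennreal (sqrt (pi * s)) \<partial>lborel)"
    using assms by (simp add: ennreal_mult')
  also have "\<dots> = (\<integral>\<^sup>+(x::real). ennreal (normal_density 0 (sqrt (s/2)) x) \<partial>lborel) * ennreal (sqrt (pi * s))"
    by (rule nn_integral_multc) measurable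
  finally show ?thesis using tot by simp
qed

lemma nn_integral_exp_cmod_square:
  assumes "s > 0"
  shows "(\<integral>\<^sup>+z. ennreal (exp (- ((cmod z)\<^sup>2 / s))) \<partial>lborel) = ennreal (pi * s)"
proof -
  have "ennreal (exp (- ((cmod z)\<^sup>2 / s))) = (\<Prod>b\<in>Basis. ennreal (exp (- ((z \<bullet> b)\<^sup>2 / s))))" for z :: complex
    by (simp add: Basis_complex_def cmod_power2 exp_add[symmetric] prod_ennreal
        ennreal_mult'[symmetric] add_divide_distrib)
  then have "(\<integral>\<^sup>+z. ennreal (exp (- ((cmod z)\<^sup>2 / s))) \<partial>lborel)
     = (\<integral>\<^sup>+(z::complex). (\<Prod>b\<in>Basis. ennreal (exp (- ((z \<bullet> b)\<^sup>2 / s)))) \<partial>lborel)"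
    by simp
  also have "\<dots> = (\<Prod>b\<in>(Basis::complex set). (\<integral>\<^sup>+x. ennreal (exp (- (x\<^sup>2 / s))) \<partial>lborel))"
    by (rule nn_integral_lborel_prod) auto
  also have "\<dots> = ennreal (sqrt (pi * s)) * ennreal (sqrt (pi * s))"
    using assms by (simp add: Basis_complex_def nn_integral_exp_square)
  also have "\<dots> = ennreal (pi * s)"
    using assms by (simp add: ennreal_mult'[symmetric])
  finally show ?thesis .
qed

lemma nn_integral_gauss: "(\<integral>\<^sup>+z. ennreal (gauss z) \<partial>lborel) = 1"
proof -
  have "(\<integral>\<^sup>+z. ennreal (gauss z) \<partial>lborel) = (\<integral>\<^sup>+z. ennreal (exp (- ((cmod z)\<^sup>2 / 1))) * ennreal (1/pi) \<partial>lborel)"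
    by (intro nn_integral_cong) (simp add: gauss_def ennreal_mult'[symmetric])
  also have "\<dots> = ennreal (pi * 1) * ennreal (1/pi)"
    by (subst nn_integral_multc) (simp_all only: nn_integral_exp_cmod_square zero_less_one, measurable)
  also have "\<dots> = 1"
    by (simp add: ennreal_mult'[symmetric])
  finally show ?thesis .
qed

lemma prob_space_CN: "prob_space CN"
  by (rule prob_spaceI) (simp add: CN_gauss emeasure_density nn_integral_gauss)

interpretation CN: prob_space CN by (rule prob_space_CN)

interpretation CNs: product_sigma_finite "\<lambda>_. CN" by unfold_locales

interpretation lebs: product_sigma_finite "\<lambda>_. lborel :: complex measure" by unfold_locales

text \<open>The exact value is 1. The constant 4 comes from \<open>x \<le> 2 * exp (x / 2)\<close>,
  which leaves a Gaussian integral of twice the variance; constants do not affect exponents.\<close>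

lemma second_moment_CN: "(\<integral>\<^sup>+z. ennreal ((cmod z)\<^sup>2) \<partial>CN) \<le> 4"
proof -
  have "(\<integral>\<^sup>+z. ennreal ((cmod z)\<^sup>2) \<partial>CN) = (\<integral>\<^sup>+z. ennreal (gauss z) * ennreal ((cmod z)\<^sup>2) \<partial>lborel)"
    by (rule nn_integral_CN) measurable
  also have "\<dots> \<le> (\<integral>\<^sup>+z. ennreal (exp (- ((cmod z)\<^sup>2 / 2))) * ennreal (2/pi) \<partial>lborel)"
  proof (intro nn_integral_mono)
    fix z :: complex
    let ?x = "(cmod z)\<^sup>2"
    have "?x / 2 \<le> exp (?x/2)" using exp_ge_add_one_self[of "?x/2"] by linarith
    then have "exp (- ?x) * ?x \<le> exp (- ?x) * (2 * exp (?x/2))"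
      by (intro mult_left_mono) auto
    also have "\<dots> = 2 * exp (- (?x/2))"
      by (simp add: exp_add[symmetric])
    finally have "gauss z * ?x \<le> exp (- (?x/2)) * (2/pi)"
      by (simp add: gauss_def divide_simps mult.commute)
    then show "ennreal (gauss z) * ennreal ?x \<le> ennreal (exp (- (?x/2))) * ennreal (2/pi)"
      by (simp add: ennreal_mult'[symmetric] ennreal_leI)
  qed
  also have "\<dots> = ennreal (pi * 2) * ennreal (2/pi)"
    by (subst nn_integral_multc) (simp_all only: nn_integral_exp_cmod_square zero_less_numeral, measurable)
  also have "\<dots> = 4"
    by (simp add: ennreal_mult'[symmetric])
  finally show ?thesis .
qed

lemma sets_cnp_leb: "sets (cnp I) = sets (leb I)"
  by (rule sets_PiM_cong) (auto simp: sets_CN)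

lemma space_cnp_leb: "space (cnp I) = space (leb I)"
  by (rule sets_eq_imp_space_eq[OF sets_cnp_leb])

lemma measurable_cnp_leb: "measurable (cnp I) N = measurable (leb I) N"
  by (rule measurable_cong_sets[OF sets_cnp_leb refl])

lemma second_moment_cnp:
  assumes "finite I"
  shows "(\<integral>\<^sup>+z. ennreal (\<Sum>i\<in>I. (cmod (z i))\<^sup>2) \<partial>cnp I) \<le> 4 * of_nat (card I)"
proof -
  have "(\<integral>\<^sup>+z. ennreal (\<Sum>i\<in>I. (cmod (z i))\<^sup>2) \<partial>cnp I)
      = (\<integral>\<^sup>+z. (\<Sum>i\<in>I. ennreal ((cmod (z i))\<^sup>2)) \<partial>cnp I)"
    by (simp add: sum_ennreal)
  also have "\<dots> = (\<Sum>i\<in>I. \<integral>\<^sup>+z. ennreal ((cmod (z i))\<^sup>2) \<partial>cnp I)"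
    by (rule nn_integral_sum) measurable
  also have "\<dots> \<le> (\<Sum>i\<in>I. 4)"
  proof (rule sum_mono)
    fix i assume i: "i \<in> I"
    have "(\<integral>\<^sup>+z. ennreal ((cmod (z i))\<^sup>2) \<partial>cnp I)
        = (\<integral>\<^sup>+z. ennreal ((cmod z)\<^sup>2) \<partial>distr (cnp I) CN (\<lambda>z. z i))"
      using i by (subst nn_integral_distr) auto
    also have "distr (cnp I) CN (\<lambda>z. z i) = CN"
      using i by (intro distr_PiM_component prob_space_CN)
    finally show "(\<integral>\<^sup>+z. ennreal ((cmod (z i))\<^sup>2) \<partial>cnp I) \<le> 4"
      using second_moment_CN by simp
  qed
  finally show ?thesis by (simp add: mult.commute)
qed

lemma nn_integral_lborel_translate:
  fixes c :: complex
  assumes [measurable]: "f \<in> borel_measurable borel"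
  shows "(\<integral>\<^sup>+z. f (z + c) \<partial>lborel) = (\<integral>\<^sup>+z. f z \<partial>lborel)"
proof -
  have "(\<integral>\<^sup>+z. f z \<partial>lborel) = (\<integral>\<^sup>+z. f z \<partial>distr lborel borel ((+) c))"
    by (simp add: lborel_distr_plus)
  also have "\<dots> = (\<integral>\<^sup>+z. f (c + z) \<partial>lborel)"
    by (rule nn_integral_distr) auto
  finally show ?thesis by (simp add: add.commute)
qed

section \<open>Densities of signal plus noise, and triangular changes of variables\<close>

definition gdens :: "'i set \<Rightarrow> ('i \<Rightarrow> complex) \<Rightarrow> ('i \<Rightarrow> complex) \<Rightarrow> ennreal" where
  "gdens I c v = (\<Prod>i\<in>I. ennreal (gauss (v i - c i)))"

lemma gdens_eq: "gdens I c v = ennreal (\<Prod>i\<in>I. gauss (v i - c i))"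
  by (simp add: gdens_def prod_ennreal)

lemma gdens_measurable [measurable (raw)]:
  assumes [measurable]: "\<And>i. i \<in> I \<Longrightarrow> (\<lambda>x. c x i) \<in> borel_measurable M"
    "\<And>i. i \<in> I \<Longrightarrow> (\<lambda>x. v x i) \<in> borel_measurable M"
  shows "(\<lambda>x. gdens I (c x) (v x)) \<in> borel_measurable M"
  unfolding gdens_def by measurable

text \<open>Turns an average over noise added to a mean \<open>c\<close> into one against a density
  in the observation itself. In this form the laws of an observation under different means can be
  compared pointwise.\<close>

lemma nn_integral_cnp_shift:
  assumes "finite I" and "f \<in> borel_measurable (leb I)"
  shows "(\<integral>\<^sup>+z. f (\<lambda>i\<in>I. c i + z i) \<partial>cnp I) = (\<integral>\<^sup>+v. gdens I c v * f v \<partial>leb I)"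
  using assms
proof (induction I arbitrary: f)
  case empty
  have "(\<lambda>i\<in>{}. c i + z i) = (\<lambda>_. undefined)" for z by auto
  then show ?case by (simp add: PiM_empty nn_integral_count_space_finite gdens_def)
next
  case (insert i I)
  note [measurable] = insert.prems
  have fupd [measurable]: "(\<lambda>(x, y). f (x(i := y))) \<in> borel_measurable (leb I \<Otimes>\<^sub>M borel)"
  proof -
    have "(\<lambda>p. f ((\<lambda>(f, y). f(i := y)) p)) \<in> borel_measurable (leb I \<Otimes>\<^sub>M lborel)"
      by (intro measurable_compose[OF measurable_add_dim insert.prems])
    then show ?thesis by (simp add: case_prod_unfold cong: measurable_cong_sets)
  qed
  have m1: "(\<lambda>z. f (\<lambda>j\<in>insert i I. c j + z j)) \<in> borel_measurable (cnp (insert i I))"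
    unfolding measurable_cnp_leb by (rule measurable_compose[OF _ insert.prems]) measurable
  have "(\<integral>\<^sup>+z. f (\<lambda>j\<in>insert i I. c j + z j) \<partial>cnp (insert i I))
      = (\<integral>\<^sup>+x. \<integral>\<^sup>+y. f (\<lambda>j\<in>insert i I. c j + (x(i := y)) j) \<partial>CN \<partial>cnp I)"
    by (rule CNs.product_nn_integral_insert[OF insert.hyps m1])
  also have "\<dots> = (\<integral>\<^sup>+x. \<integral>\<^sup>+y. f ((\<lambda>j\<in>I. c j + x j)(i := y + c i)) \<partial>CN \<partial>cnp I)"
    using insert.hyps
    by (intro nn_integral_cong arg_cong[where f=f]) (auto simp: fun_eq_iff restrict_def)
  also have "\<dots> = (\<integral>\<^sup>+x. (\<integral>\<^sup>+y. ennreal (gauss (y - c i)) * f ((\<lambda>j\<in>I. c j + x j)(i := y)) \<partial>lborel) \<partial>cnp I)"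
  proof (rule nn_integral_cong)
    fix x assume "x \<in> space (cnp I)"
    have sp: "(\<lambda>j\<in>I. c j + x j) \<in> space (leb I)" by (simp add: space_PiM)
    have g: "(\<lambda>y. f ((\<lambda>j\<in>I. c j + x j)(i := y))) \<in> borel_measurable borel"
      using measurable_Pair2[OF fupd sp] by simp
    show "(\<integral>\<^sup>+y. f ((\<lambda>j\<in>I. c j + x j)(i := y + c i)) \<partial>CN)
       = (\<integral>\<^sup>+y. ennreal (gauss (y - c i)) * f ((\<lambda>j\<in>I. c j + x j)(i := y)) \<partial>lborel)"
    proof -
      have "(\<integral>\<^sup>+y. f ((\<lambda>j\<in>I. c j + x j)(i := y + c i)) \<partial>CN)
          = (\<integral>\<^sup>+y. ennreal (gauss (y + c i - c i)) * f ((\<lambda>j\<in>I. c j + x j)(i := y + c i)) \<partial>lborel)"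
      proof (subst nn_integral_CN)
        have [measurable]: "(\<lambda>y. y + c i) \<in> borel \<rightarrow>\<^sub>M borel" by simp
        show "(\<lambda>y. f ((\<lambda>j\<in>I. c j + x j)(i := y + c i))) \<in> borel_measurable borel"
          by (rule measurable_compose[OF \<open>(\<lambda>y. y + c i) \<in> borel \<rightarrow>\<^sub>M borel\<close> g])
      qed simp
      also have "\<dots> = (\<integral>\<^sup>+y. ennreal (gauss (y - c i)) * f ((\<lambda>j\<in>I. c j + x j)(i := y)) \<partial>lborel)"
        by (rule nn_integral_lborel_translate) (use g in measurable)
      finally show ?thesis .
    qed
  qed
  also have "\<dots> = (\<integral>\<^sup>+w. gdens I c w * (\<integral>\<^sup>+y. ennreal (gauss (y - c i)) * f (w(i := y)) \<partial>lborel) \<partial>leb I)"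
    by (rule insert.IH) measurable
  also have "\<dots> = (\<integral>\<^sup>+w. \<integral>\<^sup>+y. gdens (insert i I) c (w(i := y)) * f (w(i := y)) \<partial>lborel \<partial>leb I)"
  proof (rule nn_integral_cong)
    fix w assume w: "w \<in> space (leb I)"
    have [measurable]: "(\<lambda>y. f (w(i := y))) \<in> borel_measurable borel"
      using measurable_Pair2[OF fupd w] by simp
    have "gdens (insert i I) c (w(i := y)) = gdens I c w * ennreal (gauss (y - c i))" for y
    proof -
      have "(\<Prod>j\<in>I. ennreal (gauss ((w(i := y)) j - c j))) = (\<Prod>j\<in>I. ennreal (gauss (w j - c j)))"
        using insert.hyps by (intro prod.cong) auto
      then show ?thesis using insert.hyps by (simp add: gdens_def mult.commute)
    qed
    then show "gdens I c w * (\<integral>\<^sup>+y. ennreal (gauss (y - c i)) * f (w(i := y)) \<partial>lborel)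
       = (\<integral>\<^sup>+y. gdens (insert i I) c (w(i := y)) * f (w(i := y)) \<partial>lborel)"
      by (simp add: nn_integral_cmult[symmetric] mult.assoc)
  qed
  also have "\<dots> = (\<integral>\<^sup>+v. gdens (insert i I) c v * f v \<partial>leb (insert i I))"
    by (rule lebs.product_nn_integral_insert[OF insert.hyps, symmetric]) measurable
  finally show ?case .
qed

lemma nn_integral_gdens:
  assumes "finite I"
  shows "(\<integral>\<^sup>+v. gdens I c v \<partial>leb I) = 1"
proof -
  interpret P: prob_space "cnp I" by (rule prob_space_PiM) (rule prob_space_CN)
  show ?thesis
    using nn_integral_cnp_shift[OF assms, of "\<lambda>_. 1" c] by (simp add: P.emeasure_space_1)
qed

text \<open>A unipotent triangular change of variables preserves Lebesgue measure; the rank function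
  \<open>rk\<close> supplies the order in which the coordinates are integrated out.\<close>

lemma nn_integral_triangular:
  fixes rk :: "'i \<Rightarrow> nat"
  assumes "finite I"
    and "\<And>i. i \<in> I \<Longrightarrow> f i \<in> borel_measurable borel"
    and "\<And>i. i \<in> I \<Longrightarrow> \<mu> i \<in> borel_measurable (leb I)"
    and "\<And>i x y. i \<in> I \<Longrightarrow> (\<And>j. j \<in> I \<Longrightarrow> rk j < rk i \<Longrightarrow> x j = y j) \<Longrightarrow> \<mu> i x = \<mu> i y"
  shows "(\<integral>\<^sup>+x. (\<Prod>i\<in>I. f i (x i - \<mu> i x)) \<partial>leb I) = (\<Prod>i\<in>I. \<integral>\<^sup>+z. f i z \<partial>lborel)"
  using assms
proof (induction I rule: finite_ranking_induct[where f=rk])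
  case empty
  show ?case by (simp add: PiM_empty nn_integral_count_space_finite)
next
  case (insert i S)
  show ?case
  proof (cases "i \<in> S")
    case True
    then have ins: "insert i S = S" by (rule insert_absorb)
    show ?thesis unfolding ins by (rule insert.IH) (fact insert.prems[unfolded ins])+
  next
    case False
    \<comment> \<open>The inserted index has maximal rank, so no shift, not even its own, sees
      coordinate \<open>i\<close>. Integrating that coordinate first is therefore a pure
      translation.\<close>
    have upd: "\<mu> j (x(i := y)) = \<mu> j x" if "j \<in> insert i S" for j x y
    proof (rule insert.prems(3)[OF that])
      fix l assume l: "l \<in> insert i S" "rk l < rk j"
      then have "l \<noteq> i" using insert.hyps(2)[of j] that by auto
      then show "(x(i := y)) l = x l" by simp
    qed
    have mS: "\<mu> j \<in> borel_measurable (leb S)" if "j \<in> insert i S" for j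
    proof -
      have "(\<lambda>x. \<mu> j (x(i := 0))) \<in> borel_measurable (leb S)"
        by (rule measurable_compose[OF _ insert.prems(2)[OF that]])
           (rule measurable_fun_upd[where J=S]; simp)
      then show ?thesis by (simp only: upd[OF that])
    qed
    have mf: "(\<lambda>x. \<Prod>j\<in>U. f j (x j - \<mu> j x)) \<in> borel_measurable (leb T)"
      if "U \<subseteq> T" "T \<subseteq> insert i S" "\<And>j. j \<in> U \<Longrightarrow> \<mu> j \<in> borel_measurable (leb T)" for T U
    proof (rule borel_measurable_prod_ennreal)
      fix j assume j: "j \<in> U"
      have "(\<lambda>x. x j) \<in> borel_measurable (leb T)"
        using measurable_component_singleton[of j T "\<lambda>_. lborel :: complex measure"] subsetD[OF that(1) j]
        by simp
      then have "(\<lambda>x. x j - \<mu> j x) \<in> borel_measurable (leb T)"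
        by (rule borel_measurable_diff[OF _ that(3)[OF j]])
      then show "(\<lambda>x. f j (x j - \<mu> j x)) \<in> borel_measurable (leb T)"
        by (rule measurable_compose) (rule insert.prems(1), use j that(1,2) in auto)
    qed
    have fi: "(\<lambda>y. f i (y - c)) \<in> borel_measurable lborel" for c
    proof -
      have "(\<lambda>y. y - c) \<in> borel_measurable lborel" by simp
      then show ?thesis by (rule measurable_compose) (rule insert.prems(1), simp)
    qed
    have "(\<integral>\<^sup>+x. (\<Prod>j\<in>insert i S. f j (x j - \<mu> j x)) \<partial>leb (insert i S))
      = (\<integral>\<^sup>+x. \<integral>\<^sup>+y. (\<Prod>j\<in>insert i S. f j ((x(i := y)) j - \<mu> j (x(i := y)))) \<partial>lborel \<partial>leb S)"
      by (rule lebs.product_nn_integral_insert[OF insert.hyps(1) False])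
        (rule mf; use insert.prems(2) in auto)
    also have "\<dots> = (\<integral>\<^sup>+x. (\<Prod>j\<in>S. f j (x j - \<mu> j x)) * (\<integral>\<^sup>+z. f i z \<partial>lborel) \<partial>leb S)"
    proof (rule nn_integral_cong)
      fix x assume "x \<in> space (leb S)"
      have "(\<Prod>j\<in>insert i S. f j ((x(i := y)) j - \<mu> j (x(i := y))))
          = (\<Prod>j\<in>S. f j (x j - \<mu> j x)) * f i (y - \<mu> i x)" for y
      proof -
        have "(\<Prod>j\<in>S. f j ((x(i := y)) j - \<mu> j (x(i := y)))) = (\<Prod>j\<in>S. f j (x j - \<mu> j x))"
        proof (rule prod.cong[OF refl])
        fix j assume j: "j \<in> S"
        then have "j \<noteq> i" using False by auto
        then show "f j ((x(i := y)) j - \<mu> j (x(i := y))) = f j (x j - \<mu> j x)"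
          using upd[of j x y] j by simp
      qed
        moreover have "\<mu> i (x(i := y)) = \<mu> i x" by (rule upd) simp
      ultimately show ?thesis using insert.hyps(1) False by (simp add: mult.commute)
      qed
      then have "(\<integral>\<^sup>+y. (\<Prod>j\<in>insert i S. f j ((x(i := y)) j - \<mu> j (x(i := y)))) \<partial>lborel)
          = (\<Prod>j\<in>S. f j (x j - \<mu> j x)) * (\<integral>\<^sup>+y. f i (y - \<mu> i x) \<partial>lborel)"
        by (simp only:) (rule nn_integral_cmult[OF fi])
      also have "(\<integral>\<^sup>+y. f i (y - \<mu> i x) \<partial>lborel) = (\<integral>\<^sup>+z. f i z \<partial>lborel)"
        using nn_integral_lborel_translate[of "f i" "- \<mu> i x"] insert.prems(1)[of i] by simp
      finally show "(\<integral>\<^sup>+y. (\<Prod>j\<in>insert i S. f j ((x(i := y)) j - \<mu> j (x(i := y)))) \<partial>lborel)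
          = (\<Prod>j\<in>S. f j (x j - \<mu> j x)) * (\<integral>\<^sup>+z. f i z \<partial>lborel)" .
    qed
    also have "\<dots> = (\<integral>\<^sup>+x. (\<Prod>j\<in>S. f j (x j - \<mu> j x)) \<partial>leb S) * (\<integral>\<^sup>+z. f i z \<partial>lborel)"
      by (rule nn_integral_multc) (rule mf; use mS in auto)
    also have "(\<integral>\<^sup>+x. (\<Prod>j\<in>S. f j (x j - \<mu> j x)) \<partial>leb S) = (\<Prod>j\<in>S. \<integral>\<^sup>+z. f j z \<partial>lborel)"
    proof (rule insert.IH)
      fix j and x y :: "'i \<Rightarrow> complex" assume j: "j \<in> S" and eq: "\<And>l. l \<in> S \<Longrightarrow> rk l < rk j \<Longrightarrow> x l = y l"
      show "\<mu> j x = \<mu> j y"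
      proof (rule insert.prems(3))
        show "j \<in> insert i S" using j by simp
        fix l assume "l \<in> insert i S" "rk l < rk j"
        moreover have "rk j \<le> rk i" using insert.hyps(2) j by simp
        ultimately show "x l = y l" using eq[of l] by auto
      qed
    qed (simp_all only: insert.prems(1) mS insertI2)
    finally show ?thesis using insert.hyps(1) False by (simp add: mult.commute)
  qed
qed

section \<open>Simulating side information\<close>

lemma sigma_finite_leb: "finite I \<Longrightarrow> sigma_finite_measure (leb I)"
  by (rule lebs.sigma_finite)

lemma prob_space_cnp: "prob_space (cnp I)"
  by (rule prob_space_PiM) (rule prob_space_CN)

lemma nn_integral_cnp:
  assumes "finite I" and "f \<in> borel_measurable (leb I)"
  shows "(\<integral>\<^sup>+z. f z \<partial>cnp I) = (\<integral>\<^sup>+v. gdens I (\<lambda>_. 0) v * f v \<partial>leb I)"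
proof -
  have "(\<integral>\<^sup>+z. f z \<partial>cnp I) = (\<integral>\<^sup>+z. f (\<lambda>i\<in>I. 0 + z i) \<partial>cnp I)"
  proof (rule nn_integral_cong)
    fix z assume "z \<in> space (cnp I)"
    then have "(\<lambda>i\<in>I. 0 + z i) = z"
      by (auto simp: space_PiM PiE_def extensional_def)
    then show "f z = f (\<lambda>i\<in>I. 0 + z i)" by simp
  qed
  also have "\<dots> = (\<integral>\<^sup>+v. gdens I (\<lambda>_. 0) v * f v \<partial>leb I)"
    by (rule nn_integral_cnp_shift[OF assms])
  finally show ?thesis .
qed

lemma gdens_le: "gdens I c v \<le> ennreal ((1 / pi) ^ card I)"
proof -
  have "(\<Prod>i\<in>I. gauss (v i - c i)) \<le> (\<Prod>i\<in>I. 1 / pi)"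
    by (rule prod_mono) (auto simp: gauss_def divide_right_mono)
  then show ?thesis by (simp add: gdens_eq ennreal_leI)
qed

lemma gdens_exp:
  "gdens I c v = ennreal ((1 / pi) ^ card I * exp (- (\<Sum>i\<in>I. (cmod (v i - c i))\<^sup>2)))"
proof (cases "finite I")
  case True
  then show ?thesis
    by (simp add: gdens_eq gauss_def prod_dividef exp_sum sum_negf[symmetric] power_divide)
qed (simp add: gdens_eq)

lemma cmod_diff_square_le: "(cmod (a - b))\<^sup>2 \<le> 2 * (cmod a)\<^sup>2 + 2 * (cmod b)\<^sup>2"
proof -
  have "(cmod (a - b))\<^sup>2 \<le> (cmod a + cmod b)\<^sup>2"
    by (intro power_mono norm_triangle_ineq4) auto
  also have "\<dots> \<le> 2 * (cmod a)\<^sup>2 + 2 * (cmod b)\<^sup>2"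
    using sum_squares_bound[of "cmod a" "cmod b"] by (simp add: power2_sum)
  finally show ?thesis .
qed

text \<open>Noise and displacement of the mean are both small, so \<open>v\<close> lies within
  squared distance \<open>2 * (Z + A)\<close> of the new mean. There the new density is at least
  \<open>exp (- 2 * (Z + A))\<close> times its peak, and the old density never exceeds the same
  peak. With \<open>Z\<close> and \<open>A\<close> of order \<open>card I\<close> this costs a
  constant per symbol.\<close>

lemma gdens_change:
  assumes "(\<Sum>i\<in>I. (cmod (v i - \<kappa> * s i))\<^sup>2) \<le> Z" and "(\<Sum>i\<in>I. (cmod (s i - t i))\<^sup>2) \<le> \<theta>"
    and "(cmod \<kappa>)\<^sup>2 * \<theta> \<le> A"
  shows "gdens I (\<lambda>i. \<kappa> * s i) v \<le> ennreal (exp (2 * (Z + A))) * gdens I (\<lambda>i. \<kappa> * t i) v"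
proof -
  have "(\<Sum>i\<in>I. (cmod (v i - \<kappa> * t i))\<^sup>2)
      \<le> (\<Sum>i\<in>I. 2 * (cmod (v i - \<kappa> * s i))\<^sup>2 + 2 * ((cmod \<kappa>)\<^sup>2 * (cmod (s i - t i))\<^sup>2))"
  proof (rule sum_mono)
    fix i
    have eq: "(v i - \<kappa> * s i) - \<kappa> * (t i - s i) = v i - \<kappa> * t i" by (simp add: algebra_simps)
    show "(cmod (v i - \<kappa> * t i))\<^sup>2
        \<le> 2 * (cmod (v i - \<kappa> * s i))\<^sup>2 + 2 * ((cmod \<kappa>)\<^sup>2 * (cmod (s i - t i))\<^sup>2)"
      using cmod_diff_square_le[of "v i - \<kappa> * s i" "\<kappa> * (t i - s i)"] unfolding eq
      by (simp add: norm_mult power_mult_distrib norm_minus_commute)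
  qed
  also have "\<dots> = 2 * (\<Sum>i\<in>I. (cmod (v i - \<kappa> * s i))\<^sup>2) + 2 * ((cmod \<kappa>)\<^sup>2 * (\<Sum>i\<in>I. (cmod (s i - t i))\<^sup>2))"
    by (simp add: sum.distrib sum_distrib_left)
  finally have le: "(\<Sum>i\<in>I. (cmod (v i - \<kappa> * t i))\<^sup>2) \<le> 2 * (Z + A)"
    using assms(1,3) mult_left_mono[OF assms(2), of "(cmod \<kappa>)\<^sup>2"] by (auto simp: distrib_left)
  have "gdens I (\<lambda>i. \<kappa> * s i) v \<le> ennreal ((1 / pi) ^ card I)" by (rule gdens_le)
  also have "\<dots> \<le> ennreal (exp (2 * (Z + A)) * ((1 / pi) ^ card I * exp (- (\<Sum>i\<in>I. (cmod (v i - \<kappa> * t i))\<^sup>2))))"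
  proof (rule ennreal_leI)
    have "1 \<le> exp (2 * (Z + A)) * exp (- (\<Sum>i\<in>I. (cmod (v i - \<kappa> * t i))\<^sup>2))"
      using le by (simp add: exp_add[symmetric])
    from mult_left_mono[OF this, of "(1 / pi) ^ card I"]
    show "(1 / pi) ^ card I \<le> exp (2 * (Z + A)) * ((1 / pi) ^ card I * exp (- (\<Sum>i\<in>I. (cmod (v i - \<kappa> * t i))\<^sup>2)))"
      by (simp add: mult_ac)
  qed
  also have "\<dots> = ennreal (exp (2 * (Z + A))) * gdens I (\<lambda>i. \<kappa> * t i) v"
    by (simp add: gdens_exp ennreal_mult')
  finally show ?thesis .
qed

text \<open>Chernoff's method: the Gaussian density is replaced by its peak and the indicator of the
  ball by \<open>exp (card I - S / D)\<close>, where S is the squared distance to the centre and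
  \<open>D\<close> the squared radius per coordinate. The bound is uniform in the centre, so any
  estimate may be inserted.\<close>

lemma cnp_ball_le:
  assumes "finite I" and m: "card I > 0" and \<theta>: "\<theta> > 0"
  shows "(\<integral>\<^sup>+s. (if (\<Sum>i\<in>I. (cmod (s i - c i))\<^sup>2) \<le> \<theta> then 1 else 0) \<partial>cnp I)
    \<le> ennreal (exp 1 * \<theta> / card I) ^ card I"
proof -
  define D where "D = \<theta> / card I"
  have D: "D > 0" using m \<theta> by (simp add: D_def)
  have "(\<integral>\<^sup>+s. (if (\<Sum>i\<in>I. (cmod (s i - c i))\<^sup>2) \<le> \<theta> then 1 else 0) \<partial>cnp I)
      = (\<integral>\<^sup>+s. gdens I (\<lambda>_. 0) s * (if (\<Sum>i\<in>I. (cmod (s i - c i))\<^sup>2) \<le> \<theta> then 1 else 0) \<partial>leb I)"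
    by (rule nn_integral_cnp[OF assms(1)]) measurable
  also have "\<dots> \<le> (\<integral>\<^sup>+s. (\<Prod>i\<in>I. ennreal (exp (- ((cmod (s i - c i))\<^sup>2 / D))) * ennreal (exp 1 / pi)) \<partial>leb I)"
  proof (rule nn_integral_mono)
    fix s
    let ?S = "\<Sum>i\<in>I. (cmod (s i - c i))\<^sup>2"
    have eq: "(\<Prod>i\<in>I. ennreal (exp (- ((cmod (s i - c i))\<^sup>2 / D))) * ennreal (exp 1 / pi))
        = ennreal (exp (real (card I) - ?S / D) * (1 / pi) ^ card I)"
    proof -
      have "(\<Prod>i\<in>I. exp (- ((cmod (s i - c i))\<^sup>2 / D)) * (exp 1 / pi))
        = (\<Prod>i\<in>I. exp (- ((cmod (s i - c i))\<^sup>2 / D))) * (exp 1 / pi) ^ card I"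
        by (simp only: prod.distrib prod_constant)
      also have "(\<Prod>i\<in>I. exp (- ((cmod (s i - c i))\<^sup>2 / D))) = exp (- (?S / D))"
        using assms(1) by (simp add: exp_sum[symmetric] sum_negf sum_divide_distrib)
      also have "(exp 1 / pi) ^ card I = exp (real (card I)) * (1 / pi) ^ card I"
        by (simp add: power_divide exp_of_nat_mult[symmetric])
      finally show ?thesis
        by (simp add: prod_ennreal ennreal_mult'[symmetric] exp_diff exp_minus divide_inverse mult_ac)
    qed
    show "gdens I (\<lambda>_. 0) s * (if ?S \<le> \<theta> then 1 else 0)
      \<le> (\<Prod>i\<in>I. ennreal (exp (- ((cmod (s i - c i))\<^sup>2 / D))) * ennreal (exp 1 / pi))"
    proof (cases "?S \<le> \<theta>")
      case True
      then have "?S / D \<le> real (card I)" using D m by (simp add: D_def field_simps)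
      then have "1 * (1 / pi) ^ card I \<le> exp (real (card I) - ?S / D) * (1 / pi) ^ card I"
        by (intro mult_right_mono) auto
      then show ?thesis unfolding eq using True gdens_le[of I "\<lambda>_. 0" s]
        by (auto intro: order_trans ennreal_leI)
    qed simp
  qed
  also have "\<dots> = (\<Prod>i\<in>I. \<integral>\<^sup>+z. ennreal (exp (- ((cmod z)\<^sup>2 / D))) * ennreal (exp 1 / pi) \<partial>lborel)"
    by (rule nn_integral_triangular[where rk="\<lambda>_. 0" and \<mu>="\<lambda>i _. c i"
         and f="\<lambda>i z. ennreal (exp (- ((cmod z)\<^sup>2 / D))) * ennreal (exp 1 / pi)"]) (use assms(1) in auto)
  also have "(\<integral>\<^sup>+z. ennreal (exp (- ((cmod z)\<^sup>2 / D))) * ennreal (exp 1 / pi) \<partial>lborel) = ennreal (pi * D) * ennreal (exp 1 / pi)"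
    using D by (subst nn_integral_multc) (auto simp: nn_integral_exp_cmod_square)
  also have "\<dots> = ennreal (pi * D * (exp 1 / pi))"
    by (rule ennreal_mult[symmetric]) (use D in auto)
  also have "pi * D * (exp 1 / pi) = exp 1 * \<theta> / card I"
    by (simp add: D_def)
  finally show ?thesis by simp
qed

text \<open>The conditional probability, given the source, that one block of side information is
  good: its noise has energy at most \<open>Z\<close> and the estimate made from it is within
  \<open>\<theta>\<close>. The noise condition is built in because \<open>gdens_change\<close>
  relies on it.\<close>

definition look ::
  "'i set \<Rightarrow> complex \<Rightarrow> (('i \<Rightarrow> complex) \<Rightarrow> 'i \<Rightarrow> complex) \<Rightarrow> real \<Rightarrow> real \<Rightarrow> ('i \<Rightarrow> complex) \<Rightarrow> ennreal" where
  "look I \<kappa> d Z \<theta> s = (\<integral>\<^sup>+v. gdens I (\<lambda>i. \<kappa> * s i) v *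
     (if (\<Sum>i\<in>I. (cmod (v i - \<kappa> * s i))\<^sup>2) \<le> Z \<and> (\<Sum>i\<in>I. (cmod (s i - d v i))\<^sup>2) \<le> \<theta> then 1 else 0) \<partial>leb I)"

lemma look_measurable:
  assumes "finite I"
    and [measurable]: "\<And>i. i \<in> I \<Longrightarrow> (\<lambda>(x, v). d x v i) \<in> borel_measurable (M \<Otimes>\<^sub>M leb I)"
    and [measurable]: "\<And>i. i \<in> I \<Longrightarrow> (\<lambda>x. s x i) \<in> borel_measurable M"
  shows "(\<lambda>x. look I \<kappa> (d x) Z \<theta> (s x)) \<in> borel_measurable M"
proof -
  interpret sigma_finite_measure "leb I" by (rule sigma_finite_leb[OF assms(1)])
  show ?thesis unfolding look_def by measurable
qed

lemma look_le_1:
  assumes "finite I"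
  shows "look I \<kappa> d Z \<theta> s \<le> 1"
proof -
  have "look I \<kappa> d Z \<theta> s \<le> (\<integral>\<^sup>+v. gdens I (\<lambda>i. \<kappa> * s i) v \<partial>leb I)"
    unfolding look_def by (rule nn_integral_mono) auto
  then show ?thesis by (simp add: nn_integral_gdens[OF assms])
qed

text \<open>Each look at the source may be replaced by one centred at the estimate obtained from the
  previous look; the estimates at levels \<open>k, k + 1, \<dots>\<close> are decoupled from the source one at a
  time, and only the final estimation ball remains.\<close>

lemma look_chain:
  fixes \<theta> :: "nat \<Rightarrow> real"
  assumes fin: "finite I" and m: "card I > 0" and \<theta>: "\<theta> n > 0"
    and d: "\<And>k i. k < n \<Longrightarrow> i \<in> I \<Longrightarrow> (\<lambda>v. d k v i) \<in> borel_measurable (leb I)"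
    and A: "\<And>k. k < n \<Longrightarrow> (cmod (\<kappa> k))\<^sup>2 * \<theta> k \<le> A"
    and "k \<le> n"
  shows "(\<integral>\<^sup>+s. (if (\<Sum>i\<in>I. (cmod (s i - t i))\<^sup>2) \<le> \<theta> k then 1 else 0)
       * (\<Prod>j\<in>{k..<n}. look I (\<kappa> j) (d j) Z (\<theta> (Suc j)) s) \<partial>cnp I)
    \<le> ennreal (exp (2 * (Z + A))) ^ (n - k) * ennreal (exp 1 * \<theta> n / card I) ^ card I"
  using \<open>k \<le> n\<close>
\<comment> \<open>The induction runs down from the final ball. The centre stays arbitrary because at
  the next level it is the estimate \<open>d k v\<close>, a function of the look just
  introduced.\<close>
proof (induction k arbitrary: t rule: inc_induct)
  case base
  then show ?case using cnp_ball_le[OF fin m \<theta>] by simp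
next
  case (step k)
  interpret sigma_finite_measure "leb I" by (rule sigma_finite_leb[OF fin])
  interpret P: prob_space "cnp I" by (rule prob_space_cnp)
  interpret pair_sigma_finite "cnp I" "leb I" by unfold_locales
  let ?E = "ennreal (exp (2 * (Z + A)))"
  let ?B = "?E ^ (n - Suc k) * ennreal (exp 1 * \<theta> n / card I) ^ card I"
  let ?W = "\<lambda>s. \<Prod>j\<in>{Suc k..<n}. look I (\<kappa> j) (d j) Z (\<theta> (Suc j)) s"
  note d[OF step.hyps(2), measurable]
  have [measurable]: "look I (\<kappa> j) (d j) Z (\<theta> (Suc j)) \<in> borel_measurable (leb I)" if "j < n" for j
  proof (rule look_measurable[OF fin, of "\<lambda>_. d j" "leb I" "\<lambda>s. s"])
    fix i assume i: "i \<in> I"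
    note d[OF that i, measurable]
    show "(\<lambda>(x, v). d j v i) \<in> borel_measurable (leb I \<Otimes>\<^sub>M leb I)" by measurable
    show "(\<lambda>x. x i) \<in> borel_measurable (leb I)" using i by simp
  qed
  have W [measurable]: "?W \<in> borel_measurable (leb I)" by measurable
  then have W' [measurable]: "?W \<in> borel_measurable (cnp I)" by (simp only: measurable_cnp_leb)
  let ?g = "\<lambda>s v. if (\<Sum>i\<in>I. (cmod (s i - d k v i))\<^sup>2) \<le> \<theta> (Suc k) then 1 else 0 :: ennreal"
  have split: "(\<Prod>j\<in>{k..<n}. look I (\<kappa> j) (d j) Z (\<theta> (Suc j)) s)
      = look I (\<kappa> k) (d k) Z (\<theta> (Suc k)) s * ?W s" for s
    using step.hyps by (simp add: prod.atLeast_Suc_lessThan)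
  have "(\<integral>\<^sup>+s. (if (\<Sum>i\<in>I. (cmod (s i - t i))\<^sup>2) \<le> \<theta> k then 1 else 0)
       * (\<Prod>j\<in>{k..<n}. look I (\<kappa> j) (d j) Z (\<theta> (Suc j)) s) \<partial>cnp I)
     \<le> (\<integral>\<^sup>+s. \<integral>\<^sup>+v. ?E * (gdens I (\<lambda>i. \<kappa> k * t i) v * (?g s v * ?W s)) \<partial>leb I \<partial>cnp I)"
  proof (rule nn_integral_mono)
    fix s assume s: "s \<in> space (cnp I)"
    have si: "s \<in> space (leb I)" using s by (simp add: space_cnp_leb)
    show "(if (\<Sum>i\<in>I. (cmod (s i - t i))\<^sup>2) \<le> \<theta> k then 1 else 0)
       * (\<Prod>j\<in>{k..<n}. look I (\<kappa> j) (d j) Z (\<theta> (Suc j)) s)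
       \<le> (\<integral>\<^sup>+v. ?E * (gdens I (\<lambda>i. \<kappa> k * t i) v * (?g s v * ?W s)) \<partial>leb I)"
    proof (cases "(\<Sum>i\<in>I. (cmod (s i - t i))\<^sup>2) \<le> \<theta> k")
      case True
      have "look I (\<kappa> k) (d k) Z (\<theta> (Suc k)) s * ?W s
        = (\<integral>\<^sup>+v. gdens I (\<lambda>i. \<kappa> k * s i) v * (if (\<Sum>i\<in>I. (cmod (v i - \<kappa> k * s i))\<^sup>2) \<le> Z
             \<and> (\<Sum>i\<in>I. (cmod (s i - d k v i))\<^sup>2) \<le> \<theta> (Suc k) then 1 else 0) * ?W s \<partial>leb I)"
        unfolding look_def[of I "\<kappa> k"] by (rule nn_integral_multc[symmetric]) measurable
      also have "\<dots> \<le> (\<integral>\<^sup>+v. ?E * (gdens I (\<lambda>i. \<kappa> k * t i) v * (?g s v * ?W s)) \<partial>leb I)"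
      proof (rule nn_integral_mono)
        fix v
        show "gdens I (\<lambda>i. \<kappa> k * s i) v * (if (\<Sum>i\<in>I. (cmod (v i - \<kappa> k * s i))\<^sup>2) \<le> Z
             \<and> (\<Sum>i\<in>I. (cmod (s i - d k v i))\<^sup>2) \<le> \<theta> (Suc k) then 1 else 0) * ?W s
          \<le> ?E * (gdens I (\<lambda>i. \<kappa> k * t i) v * (?g s v * ?W s))"
        proof (cases "(\<Sum>i\<in>I. (cmod (v i - \<kappa> k * s i))\<^sup>2) \<le> Z \<and> (\<Sum>i\<in>I. (cmod (s i - d k v i))\<^sup>2) \<le> \<theta> (Suc k)")
          case T: True
          have "gdens I (\<lambda>i. \<kappa> k * s i) v \<le> ?E * gdens I (\<lambda>i. \<kappa> k * t i) v"
            by (rule gdens_change[OF conjunct1[OF T] True A[OF step.hyps(2)]])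
          from mult_right_mono[OF this, of "?W s"] show ?thesis using T by (simp add: mult.assoc)
        next
          case F: False
          then show ?thesis by (simp only: if_False mult_zero_right mult_zero_left zero_le)
        qed
      qed
      finally show ?thesis using True by (simp add: split)
    qed simp
  qed
  \<comment> \<open>The law of \<open>v\<close> is now centred at the fixed \<open>t\<close> and no
    longer involves \<open>s\<close>, so \<open>v\<close> can be integrated last. For frozen
    \<open>v\<close> the estimate is a fixed centre, as the induction hypothesis demands.\<close>
  also have "\<dots> = (\<integral>\<^sup>+v. \<integral>\<^sup>+s. ?E * (gdens I (\<lambda>i. \<kappa> k * t i) v * (?g s v * ?W s)) \<partial>cnp I \<partial>leb I)"
    by (rule Fubini'[symmetric]) measurable
  also have "\<dots> = (\<integral>\<^sup>+v. ?E * gdens I (\<lambda>i. \<kappa> k * t i) v * (\<integral>\<^sup>+s. ?g s v * ?W s \<partial>cnp I) \<partial>leb I)"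
  proof (rule nn_integral_cong)
    fix v
    have [measurable]: "(\<lambda>s. ?g s v * ?W s) \<in> borel_measurable (cnp I)" by measurable
    show "(\<integral>\<^sup>+s. ?E * (gdens I (\<lambda>i. \<kappa> k * t i) v * (?g s v * ?W s)) \<partial>cnp I)
      = ?E * gdens I (\<lambda>i. \<kappa> k * t i) v * (\<integral>\<^sup>+s. ?g s v * ?W s \<partial>cnp I)"
      by (subst mult.assoc[symmetric], rule nn_integral_cmult) measurable
  qed
  also have "\<dots> \<le> (\<integral>\<^sup>+v. ?E * gdens I (\<lambda>i. \<kappa> k * t i) v * ?B \<partial>leb I)"
    by (intro nn_integral_mono mult_left_mono step.IH) simp
  also have "\<dots> = ?E * ?B * (\<integral>\<^sup>+v. gdens I (\<lambda>i. \<kappa> k * t i) v \<partial>leb I)"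
    by (subst nn_integral_cmult[symmetric]) (measurable, simp add: mult_ac)
  also have "\<dots> = ?E * ?B" by (simp add: nn_integral_gdens[OF fin])
  also have "\<dots> = ?E ^ (n - k) * ennreal (exp 1 * \<theta> n / card I) ^ card I"
    using step.hyps by (simp add: Suc_diff_Suc[symmetric] mult.assoc)
  finally show ?case .
qed

section \<open>Markov and union bounds, and the decoupling inequality\<close>

lemma prod_add_sum_ge_1:
  fixes a b :: "'k \<Rightarrow> ennreal"
  assumes "finite K" and "\<And>k. k \<in> K \<Longrightarrow> a k \<le> 1" and "\<And>k. k \<in> K \<Longrightarrow> 1 \<le> a k + b k"
  shows "1 \<le> (\<Prod>k\<in>K. a k) + (\<Sum>k\<in>K. b k)"
  using assms
proof (induction K rule: finite_induct)
  case (insert k K)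
  have le1: "a k \<le> 1" and ge: "1 \<le> a k + b k"
    and IH: "1 \<le> (\<Prod>k\<in>K. a k) + (\<Sum>k\<in>K. b k)"
    using insert by auto
  have "1 \<le> a k * 1 + b k" using ge by simp
  also have "\<dots> \<le> a k * ((\<Prod>k\<in>K. a k) + (\<Sum>k\<in>K. b k)) + b k"
    by (intro add_right_mono mult_left_mono IH) simp
  also have "\<dots> \<le> a k * (\<Prod>k\<in>K. a k) + (1 * (\<Sum>k\<in>K. b k) + b k)"
    unfolding distrib_left add.assoc
    by (intro add_left_mono add_right_mono mult_right_mono le1) simp
  finally show ?case using insert.hyps by (simp add: add_ac)
qed simp

lemma indicator_markov:
  assumes "b > 0" and "0 \<le> x"
  shows "(if x \<le> b then 0 else 1) \<le> ennreal (1 / b) * ennreal x"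
proof -
  have "1 \<le> 1 / b * x" if "\<not> x \<le> b" using assms that by (simp add: field_simps)
  then show ?thesis using assms by (auto simp: ennreal_mult[symmetric] ennreal_le_iff2 simp flip: ennreal_1)
qed

lemma second_moment_gdens:
  assumes "finite I"
  shows "(\<integral>\<^sup>+v. gdens I c v * ennreal (\<Sum>i\<in>I. (cmod (v i - c i))\<^sup>2) \<partial>leb I) \<le> 4 * of_nat (card I)"
proof -
  have "(\<integral>\<^sup>+v. gdens I c v * ennreal (\<Sum>i\<in>I. (cmod (v i - c i))\<^sup>2) \<partial>leb I)
     = (\<integral>\<^sup>+z. ennreal (\<Sum>i\<in>I. (cmod ((\<lambda>i\<in>I. c i + z i) i - c i))\<^sup>2) \<partial>cnp I)"
    by (rule nn_integral_cnp_shift[OF assms, symmetric]) measurable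
  also have "\<dots> = (\<integral>\<^sup>+z. ennreal (\<Sum>i\<in>I. (cmod (z i))\<^sup>2) \<partial>cnp I)"
    by (intro nn_integral_cong) simp
  finally show ?thesis using second_moment_cnp[OF assms] by simp
qed

lemma look_ge:
  assumes fin: "finite I" and Z: "Z > 0" and \<theta>: "\<theta> > 0"
    and [measurable]: "\<And>i. i \<in> I \<Longrightarrow> (\<lambda>v. d v i) \<in> borel_measurable (leb I)"
  shows "1 \<le> look I \<kappa> d Z \<theta> s + (ennreal (1 / Z) * (4 * of_nat (card I))
     + ennreal (1 / \<theta>) * (\<integral>\<^sup>+v. gdens I (\<lambda>i. \<kappa> * s i) v * ennreal (\<Sum>i\<in>I. (cmod (s i - d v i))\<^sup>2) \<partial>leb I))"
proof -
  let ?g = "gdens I (\<lambda>i. \<kappa> * s i)"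
  let ?X = "\<lambda>v. \<Sum>i\<in>I. (cmod (v i - \<kappa> * s i))\<^sup>2" and ?Y = "\<lambda>v. \<Sum>i\<in>I. (cmod (s i - d v i))\<^sup>2"
  have X: "(\<integral>\<^sup>+v. ?g v * ennreal (?X v) \<partial>leb I) \<le> 4 * of_nat (card I)"
    by (rule second_moment_gdens[OF fin])
  have "1 = (\<integral>\<^sup>+v. ?g v \<partial>leb I)" by (simp add: nn_integral_gdens[OF fin])
  also have "\<dots> \<le> (\<integral>\<^sup>+v. ?g v * (if ?X v \<le> Z \<and> ?Y v \<le> \<theta> then 1 else 0)
     + (ennreal (1 / Z) * (?g v * ennreal (?X v)) + ennreal (1 / \<theta>) * (?g v * ennreal (?Y v))) \<partial>leb I)"
  proof (rule nn_integral_mono)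
    fix v
    have "(1::ennreal) \<le> (if ?X v \<le> Z \<and> ?Y v \<le> \<theta> then 1 else 0)
       + ((if ?X v \<le> Z then 0 else 1) + (if ?Y v \<le> \<theta> then 0 else 1))" by auto
    also have "\<dots> \<le> (if ?X v \<le> Z \<and> ?Y v \<le> \<theta> then 1 else 0)
       + (ennreal (1 / Z) * ennreal (?X v) + ennreal (1 / \<theta>) * ennreal (?Y v))"
      by (intro add_left_mono add_mono indicator_markov Z \<theta>) (auto intro: sum_nonneg)
    finally have "?g v * 1 \<le> ?g v * \<dots>" by (rule mult_left_mono) simp
    then show "?g v \<le> ?g v * (if ?X v \<le> Z \<and> ?Y v \<le> \<theta> then 1 else 0)
     + (ennreal (1 / Z) * (?g v * ennreal (?X v)) + ennreal (1 / \<theta>) * (?g v * ennreal (?Y v)))"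
      by (simp add: distrib_left mult_ac)
  qed
  also have "\<dots> = look I \<kappa> d Z \<theta> s + (ennreal (1 / Z) * (\<integral>\<^sup>+v. ?g v * ennreal (?X v) \<partial>leb I)
     + ennreal (1 / \<theta>) * (\<integral>\<^sup>+v. ?g v * ennreal (?Y v) \<partial>leb I))"
    unfolding look_def
    by (subst nn_integral_add, measurable, subst nn_integral_add, measurable)
       (simp add: nn_integral_cmult)
  also have "\<dots> \<le> look I \<kappa> d Z \<theta> s + (ennreal (1 / Z) * (4 * of_nat (card I))
     + ennreal (1 / \<theta>) * (\<integral>\<^sup>+v. ?g v * ennreal (?Y v) \<partial>leb I))"
    by (intro add_left_mono add_right_mono mult_left_mono X) simp
  finally show ?thesis .
qed

lemma ennreal_mult_4_of_nat: "0 \<le> a \<Longrightarrow> ennreal a * (4 * of_nat k) = ennreal (a * (4 * real k))"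
  by (simp add: ennreal_mult ennreal_of_nat_eq_real_of_nat)

text \<open>The received block \<open>y\<close> is common to all looks; given the source and
  \<open>y\<close>, the looks are independent. Everything is typical with probability at least 1/2.
  On that event the law of \<open>y\<close> is dominated by \<open>R * q\<close>, which does not see
  the source, and for each frozen \<open>y\<close> the looks are decoupled by
  \<open>look_chain\<close>. The hypotheses on \<open>\<kappa>\<close> say that each look is weak
  relative to the accuracy already reached.\<close>

lemma half_le_decoupled:
  fixes D :: "nat \<Rightarrow> real"
  assumes fin: "finite I" "finite J" and m: "card I > 0" and n: "n > 0"
    and D: "\<And>k. k < n \<Longrightarrow> D k > 0"
    and c: "\<And>j. j \<in> J \<Longrightarrow> (\<lambda>s. c s j) \<in> borel_measurable (leb I)"
    and q: "q \<in> borel_measurable (leb J)" "(\<integral>\<^sup>+y. q y \<partial>leb J) \<le> 1"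
    and PY: "Measurable.pred (leb I \<Otimes>\<^sub>M leb J) (\<lambda>(s, y). PY s y)"
    and ratio: "\<And>s y. PY s y \<Longrightarrow> gdens J (c s) y \<le> R * q y"
    and bad: "(\<integral>\<^sup>+s. \<integral>\<^sup>+y. gdens J (c s) y * (if PY s y then 0 else 1) \<partial>leb J \<partial>cnp I) \<le> ennreal (1 / 8)"
    and d: "\<And>k i. k < n \<Longrightarrow> i \<in> I \<Longrightarrow> (\<lambda>(y, v). d k y v i) \<in> borel_measurable (leb J \<Otimes>\<^sub>M leb I)"
    and dist: "\<And>k. k < n \<Longrightarrow> (\<integral>\<^sup>+s. \<integral>\<^sup>+y. gdens J (c s) y *
      (\<integral>\<^sup>+v. gdens I (\<lambda>i. \<kappa> k * s i) v * ennreal (\<Sum>i\<in>I. (cmod (s i - d k y v i))\<^sup>2) \<partial>leb I) \<partial>leb J \<partial>cnp I)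
      \<le> ennreal (card I * D k)"
    and \<kappa>0: "(cmod (\<kappa> 0))\<^sup>2 \<le> 1"
    and \<kappa>Suc: "\<And>k. Suc k < n \<Longrightarrow> (cmod (\<kappa> (Suc k)))\<^sup>2 * D k \<le> 1"
  shows "ennreal (1 / 2) \<le> R * (ennreal (exp (128 * n * card I)) ^ n
     * ennreal (exp 1 * (8 * n * card I * D (n - 1)) / card I) ^ card I)"
proof -
  \<comment> \<open>The radii and \<open>Z\<close> make each Markov failure small: 1/8 for the
    source leaving the initial ball around 0, and \<open>1 / (8 * n)\<close> each for the noise and
    for the error of one of the \<open>n\<close> looks. With 1/8 for the received block, the
    failures add up to 1/2.\<close>
  define \<theta> where "\<theta> k = (case k of 0 \<Rightarrow> 32 * real (card I) | Suc k \<Rightarrow> 8 * n * card I * D k)" for k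
  define Z where "Z = 32 * real n * card I"
  have Z: "Z > 0" using n m by (simp add: Z_def)
  have \<theta>Suc: "\<theta> (Suc k) > 0" if "k < n" for k using n m D[OF that] by (simp add: \<theta>_def)
  interpret S: prob_space "cnp I" by (rule prob_space_cnp)
  interpret V: sigma_finite_measure "leb I" by (rule sigma_finite_leb[OF fin(1)])
  interpret Y: sigma_finite_measure "leb J" by (rule sigma_finite_leb[OF fin(2)])
  interpret SY: pair_sigma_finite "cnp I" "leb J" by unfold_locales
  let ?P = "cnp I \<Otimes>\<^sub>M leb J"
  have setsP: "sets ?P = sets (leb I \<Otimes>\<^sub>M leb J)"
    by (rule sets_pair_measure_cong[OF sets_cnp_leb refl])
  have mP: "measurable ?P N = measurable (leb I \<Otimes>\<^sub>M leb J) N" for N :: "ennreal measure"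
    by (rule measurable_cong_sets[OF setsP refl])
  define g where "g p = gdens J (c (fst p)) (snd p)" for p
  have g' [measurable]: "g \<in> borel_measurable (leb I \<Otimes>\<^sub>M leb J)"
  proof -
    note c[measurable]
    show ?thesis unfolding g_def by measurable
  qed
  then have g [measurable]: "g \<in> borel_measurable ?P" by (simp only: mP)
  define N where "N = density ?P g"
  have E: "(\<integral>\<^sup>+p. \<phi> p \<partial>N) = (\<integral>\<^sup>+s. \<integral>\<^sup>+y. gdens J (c s) y * \<phi> (s, y) \<partial>leb J \<partial>cnp I)"
    if "\<phi> \<in> borel_measurable (leb I \<Otimes>\<^sub>M leb J)" for \<phi>
  proof -
    have [measurable]: "\<phi> \<in> borel_measurable ?P" using that by (simp only: mP)
    have "(\<integral>\<^sup>+p. \<phi> p \<partial>N) = (\<integral>\<^sup>+p. g p * \<phi> p \<partial>?P)"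
      unfolding N_def by (rule nn_integral_density) measurable
    also have "\<dots> = (\<integral>\<^sup>+s. \<integral>\<^sup>+y. g (s, y) * \<phi> (s, y) \<partial>leb J \<partial>cnp I)"
      by (rule Y.nn_integral_fst[symmetric]) measurable
    finally show ?thesis by (simp add: g_def)
  qed
  have mN: "\<phi> \<in> borel_measurable N" if "\<phi> \<in> borel_measurable (leb I \<Otimes>\<^sub>M leb J)" for \<phi> :: "_ \<Rightarrow> ennreal"
    using that by (simp add: N_def mP)
  define L where "L k p = look I (\<kappa> k) (d k (snd p)) Z (\<theta> (Suc k)) (fst p)" for k p
  define G where "G k p = (\<integral>\<^sup>+v. gdens I (\<lambda>i. \<kappa> k * fst p i) v
      * ennreal (\<Sum>i\<in>I. (cmod (fst p i - d k (snd p) v i))\<^sup>2) \<partial>leb I)" for k p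
  define W where "W p = (\<Prod>k\<in>{0..<n}. L k p)" for p
  \<comment> \<open>Written with \<open>- 0\<close> to match the ball around the initial guess
    \<open>t\<close> in \<open>look_chain\<close>.\<close>
  define gS where "gS p = (if (\<Sum>i\<in>I. (cmod (fst p i - 0))\<^sup>2) \<le> \<theta> 0 then 1 else 0 :: ennreal)"
    for p :: "('a \<Rightarrow> complex) \<times> ('b \<Rightarrow> complex)"
  define gY where "gY p = (if PY (fst p) (snd p) then 1 else 0 :: ennreal)" for p
  define bS where "bS p = (if (\<Sum>i\<in>I. (cmod (fst p i))\<^sup>2) \<le> \<theta> 0 then 0 else 1 :: ennreal)"
    for p :: "('a \<Rightarrow> complex) \<times> ('b \<Rightarrow> complex)"
  define bY where "bY p = (if PY (fst p) (snd p) then 0 else 1 :: ennreal)" for p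
  have dm [measurable]: "(\<lambda>x. d k (snd (fst x)) (snd x) i) \<in> borel_measurable ((leb I \<Otimes>\<^sub>M leb J) \<Otimes>\<^sub>M leb I)"
    if "k < n" "i \<in> I" for k i
  proof -
    have "(\<lambda>x. (snd (fst x), snd x)) \<in> (leb I \<Otimes>\<^sub>M leb J) \<Otimes>\<^sub>M leb I \<rightarrow>\<^sub>M leb J \<Otimes>\<^sub>M leb I" by measurable
    from measurable_compose[OF this d[OF that]] show ?thesis by simp
  qed
  have L [measurable]: "L k \<in> borel_measurable (leb I \<Otimes>\<^sub>M leb J)" if "k < n" for k
    unfolding L_def[abs_def]
  proof (rule look_measurable[OF fin(1)])
    show "(\<lambda>(x, v). d k (snd x) v i) \<in> borel_measurable ((leb I \<Otimes>\<^sub>M leb J) \<Otimes>\<^sub>M leb I)" if "i \<in> I" for i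
      using dm[OF \<open>k < n\<close> that] by (simp add: case_prod_unfold)
    show "(\<lambda>x. fst x i) \<in> borel_measurable (leb I \<Otimes>\<^sub>M leb J)" if "i \<in> I" for i
      using that by measurable
  qed
  have G [measurable]: "G k \<in> borel_measurable (leb I \<Otimes>\<^sub>M leb J)" if "k < n" for k
  proof -
    note dm[OF that, measurable]
    show ?thesis unfolding G_def[abs_def] by measurable
  qed
  have W [measurable]: "W \<in> borel_measurable (leb I \<Otimes>\<^sub>M leb J)"
    unfolding W_def[abs_def] by measurable
  have [measurable]: "gS \<in> borel_measurable (leb I \<Otimes>\<^sub>M leb J)" "bS \<in> borel_measurable (leb I \<Otimes>\<^sub>M leb J)"
    unfolding gS_def[abs_def] bS_def[abs_def] by measurable
  have PY': "Measurable.pred (leb I \<Otimes>\<^sub>M leb J) (\<lambda>p. PY (fst p) (snd p))"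
    using PY by (simp add: case_prod_unfold)
  have [measurable]: "gY \<in> borel_measurable (leb I \<Otimes>\<^sub>M leb J)" "bY \<in> borel_measurable (leb I \<Otimes>\<^sub>M leb J)"
    unfolding gY_def[abs_def] bY_def[abs_def] using PY' by measurable
  define B where "B k p = ennreal (1 / (8 * n)) + ennreal (1 / \<theta> (Suc k)) * G k p" for k p
  have Bm [measurable]: "B k \<in> borel_measurable (leb I \<Otimes>\<^sub>M leb J)" if "k < n" for k
  proof -
    note G[OF that, measurable]
    show ?thesis unfolding B_def[abs_def] by measurable
  qed
  have ge: "1 \<le> gS p * gY p * W p + (bS p + bY p + (\<Sum>k\<in>{0..<n}. B k p))"
    if p: "p \<in> space (leb I \<Otimes>\<^sub>M leb J)" for p
  proof -
    \<comment> \<open>A union bound: given source and received block, \<open>W p\<close> is the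
      probability that independent looks all succeed, and \<open>B k p\<close> bounds the failure of
      look \<open>k\<close>.\<close>
    have "1 \<le> W p + (\<Sum>k\<in>{0..<n}. B k p)"
      unfolding W_def
    proof (rule prod_add_sum_ge_1)
      fix k assume k: "k \<in> {0..<n}"
      then have kn: "k < n" by simp
      show "L k p \<le> 1" unfolding L_def by (rule look_le_1[OF fin(1)])
      have dk: "(\<lambda>v. d k (snd p) v i) \<in> borel_measurable (leb I)" if "i \<in> I" for i
        using measurable_Pair2[OF d[OF kn that]] p by (auto simp: space_pair_measure)
      have "ennreal (1 / Z) * (4 * of_nat (card I)) = ennreal (1 / Z * (4 * real (card I)))"
        using Z by (intro ennreal_mult_4_of_nat) simp
      also have "1 / Z * (4 * real (card I)) = 1 / (8 * n)"
        using m n by (simp add: Z_def field_simps)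
      finally show "1 \<le> L k p + B k p"
        using look_ge[OF fin(1) Z \<theta>Suc[OF kn] dk, where \<kappa>="\<kappa> k" and s="fst p"]
        by (simp add: L_def B_def G_def)
    qed simp
    then show ?thesis
      by (auto simp: gS_def gY_def bS_def bY_def intro: order_trans[OF _ le_iff_add[THEN iffD2]]
          intro!: add_increasing2)
  qed
  have "1 = (\<integral>\<^sup>+p. 1 \<partial>N)"
    by (subst E) (simp_all add: nn_integral_gdens[OF fin(2)] S.emeasure_space_1)
  also have "\<dots> \<le> (\<integral>\<^sup>+p. gS p * gY p * W p + (bS p + bY p + (\<Sum>k\<in>{0..<n}. B k p)) \<partial>N)"
  proof (rule nn_integral_mono)
    fix p assume "p \<in> space N"
    then have "p \<in> space (leb I \<Otimes>\<^sub>M leb J)"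
      by (simp add: N_def sets_eq_imp_space_eq[OF setsP])
    then show "1 \<le> gS p * gY p * W p + (bS p + bY p + (\<Sum>k\<in>{0..<n}. B k p))" by (rule ge)
  qed
  also have "\<dots> = (\<integral>\<^sup>+p. gS p * gY p * W p \<partial>N) + ((\<integral>\<^sup>+p. bS p \<partial>N) + (\<integral>\<^sup>+p. bY p \<partial>N)
      + (\<Sum>k\<in>{0..<n}. \<integral>\<^sup>+p. B k p \<partial>N))"
  proof -
    have a: "(\<lambda>p. gS p * gY p * W p) \<in> borel_measurable N" by (rule mN) measurable
    have b1: "bS \<in> borel_measurable N" by (rule mN) measurable
    have b2: "bY \<in> borel_measurable N" by (rule mN) measurable
    have e: "B k \<in> borel_measurable N" if "k \<in> {0..<n}" for k using that by (intro mN) auto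
    have f: "(\<lambda>p. \<Sum>k\<in>{0..<n}. B k p) \<in> borel_measurable N"
      using e by (rule borel_measurable_sum)
    have "(\<integral>\<^sup>+p. (\<Sum>k\<in>{0..<n}. B k p) \<partial>N) = (\<Sum>k\<in>{0..<n}. \<integral>\<^sup>+p. B k p \<partial>N)"
      by (rule nn_integral_sum) (rule e)
    then show ?thesis
      by (subst nn_integral_add[OF a]) (use b1 b2 f in \<open>auto simp: nn_integral_add\<close>)
  qed
  also have "\<dots> \<le> (\<integral>\<^sup>+p. gS p * gY p * W p \<partial>N) + (ennreal (1/8) + ennreal (1/8) + (\<Sum>k\<in>{0..<n}. ennreal (1 / (4 * n))))"
  proof (intro add_left_mono add_mono sum_mono)
    have "(\<integral>\<^sup>+p. bS p \<partial>N) = (\<integral>\<^sup>+s. \<integral>\<^sup>+y. gdens J (c s) y * (if (\<Sum>i\<in>I. (cmod (s i))\<^sup>2) \<le> \<theta> 0 then 0 else 1) \<partial>leb J \<partial>cnp I)"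
      by (subst E) (simp_all add: bS_def)
    also have "\<dots> = (\<integral>\<^sup>+s. (if (\<Sum>i\<in>I. (cmod (s i))\<^sup>2) \<le> \<theta> 0 then 0 else 1) \<partial>cnp I)"
      by (rule nn_integral_cong) (simp add: nn_integral_gdens[OF fin(2)])
    also have "\<dots> \<le> (\<integral>\<^sup>+s. ennreal (1 / \<theta> 0) * ennreal (\<Sum>i\<in>I. (cmod (s i))\<^sup>2) \<partial>cnp I)"
      by (intro nn_integral_mono indicator_markov sum_nonneg) (use m in \<open>auto simp: \<theta>_def\<close>)
    also have "\<dots> = ennreal (1 / \<theta> 0) * (\<integral>\<^sup>+s. ennreal (\<Sum>i\<in>I. (cmod (s i))\<^sup>2) \<partial>cnp I)"
      by (rule nn_integral_cmult) measurable
    also have "\<dots> \<le> ennreal (1 / \<theta> 0) * (4 * of_nat (card I))"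
      by (intro mult_left_mono second_moment_cnp fin) simp
    also have "\<dots> = ennreal (1 / \<theta> 0 * (4 * real (card I)))"
      by (intro ennreal_mult_4_of_nat) (simp add: \<theta>_def)
    also have "1 / \<theta> 0 * (4 * real (card I)) = 1 / 8" using m by (simp add: \<theta>_def)
    finally show "(\<integral>\<^sup>+p. bS p \<partial>N) \<le> ennreal (1 / 8)" .
    show "(\<integral>\<^sup>+p. bY p \<partial>N) \<le> ennreal (1 / 8)"
      using bad by (subst E) (simp_all add: bY_def)
    fix k assume "k \<in> {0..<n}"
    then have k: "k < n" by simp
    note G[OF k, measurable]
    have "(\<integral>\<^sup>+p. B k p \<partial>N) = (\<integral>\<^sup>+p. ennreal (1 / (8 * n)) \<partial>N) + ennreal (1 / \<theta> (Suc k)) * (\<integral>\<^sup>+p. G k p \<partial>N)"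
      unfolding B_def using mN[OF G[OF k]] by (subst nn_integral_add) (auto simp: nn_integral_cmult)
    also have "(\<integral>\<^sup>+p. ennreal (1 / (8 * n)) \<partial>N) = ennreal (1 / (8 * n))"
    proof -
      have "(\<integral>\<^sup>+p. ennreal (1 / (8 * n)) \<partial>N) = (\<integral>\<^sup>+s. (\<integral>\<^sup>+y. gdens J (c s) y * ennreal (1 / (8 * n)) \<partial>leb J) \<partial>cnp I)"
        by (rule E) measurable
      also have "\<dots> = (\<integral>\<^sup>+s. ennreal (1 / (8 * n)) \<partial>cnp I)"
      proof (rule nn_integral_cong)
        fix s
        have "(\<integral>\<^sup>+y. gdens J (c s) y * ennreal (1 / (8 * n)) \<partial>leb J) = (\<integral>\<^sup>+y. gdens J (c s) y \<partial>leb J) * ennreal (1 / (8 * n))"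
          by (rule nn_integral_multc) measurable
        then show "(\<integral>\<^sup>+y. gdens J (c s) y * ennreal (1 / (8 * n)) \<partial>leb J) = ennreal (1 / (8 * n))"
          by (simp add: nn_integral_gdens[OF fin(2)])
      qed
      finally show ?thesis by (simp add: S.emeasure_space_1)
    qed
    also have "ennreal (1 / (8 * n)) + ennreal (1 / \<theta> (Suc k)) * (\<integral>\<^sup>+p. G k p \<partial>N)
       \<le> ennreal (1 / (8 * n)) + ennreal (1 / \<theta> (Suc k)) * ennreal (card I * D k)"
      using dist[OF k] by (intro add_left_mono mult_left_mono) (subst E, auto simp: G_def)
    also have "ennreal (1 / \<theta> (Suc k)) * ennreal (card I * D k) = ennreal (1 / \<theta> (Suc k) * (card I * D k))"
      by (rule ennreal_mult[symmetric]) (use \<theta>Suc[OF k] D[OF k] in auto)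
    also have "ennreal (1 / (8 * n)) + ennreal (1 / \<theta> (Suc k) * (card I * D k)) = ennreal (1 / (8 * n) + 1 / \<theta> (Suc k) * (card I * D k))"
      by (rule ennreal_plus[symmetric]) (use \<theta>Suc[OF k] D[OF k] in auto)
    also have "1 / (8 * n) + 1 / \<theta> (Suc k) * (card I * D k) = 1 / (4 * n)"
      using m n D[OF k] by (simp add: \<theta>_def field_simps)
    finally show "(\<integral>\<^sup>+p. B k p \<partial>N) \<le> ennreal (1 / (4 * n))" .
  qed
  also have "(\<Sum>k\<in>{0..<n}. ennreal (1 / (4 * n))) = ennreal (1/4)"
    using n by (simp add: ennreal_of_nat_eq_real_of_nat ennreal_mult'[symmetric])
  also have "ennreal (1/8) + ennreal (1/8) + ennreal (1/4) = ennreal (1/2)"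
    by (simp add: ennreal_plus[symmetric] del: ennreal_plus)
  finally have half: "1 \<le> (\<integral>\<^sup>+p. gS p * gY p * W p \<partial>N) + ennreal (1/2)" .
  let ?B = "ennreal (exp (2 * (Z + Z))) ^ (n - 0) * ennreal (exp 1 * \<theta> n / card I) ^ card I"
  have "(\<integral>\<^sup>+p. gS p * gY p * W p \<partial>N)
      = (\<integral>\<^sup>+s. \<integral>\<^sup>+y. gdens J (c s) y * (gS (s, y) * gY (s, y) * W (s, y)) \<partial>leb J \<partial>cnp I)"
    by (rule E) measurable
  \<comment> \<open>The typicality factor \<open>gY\<close> is used up here: it licenses the density
    comparison that frees \<open>y\<close> from the source.\<close>
  also have "\<dots> \<le> (\<integral>\<^sup>+s. \<integral>\<^sup>+y. R * q y * (gS (s, y) * W (s, y)) \<partial>leb J \<partial>cnp I)"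
  proof (intro nn_integral_mono)
    fix s y
    show "gdens J (c s) y * (gS (s, y) * gY (s, y) * W (s, y)) \<le> R * q y * (gS (s, y) * W (s, y))"
      using mult_right_mono[OF ratio[of s y], of "gS (s, y) * W (s, y)"]
      by (auto simp: gY_def)
  qed
  also have "\<dots> = (\<integral>\<^sup>+y. \<integral>\<^sup>+s. R * q y * (gS (s, y) * W (s, y)) \<partial>cnp I \<partial>leb J)"
  proof (rule SY.Fubini'[symmetric])
    note q(1)[measurable]
    show "(\<lambda>(s, y). R * q y * (gS (s, y) * W (s, y))) \<in> borel_measurable ?P"
      unfolding mP by measurable
  qed
  also have "\<dots> \<le> (\<integral>\<^sup>+y. R * q y * ?B \<partial>leb J)"
  proof (rule nn_integral_mono)
    fix y assume y: "y \<in> space (leb J)"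
    have mm: "(\<lambda>s. gS (s, y) * W (s, y)) \<in> borel_measurable (cnp I)"
    proof -
      have "(\<lambda>p. gS p * W p) \<in> borel_measurable (leb I \<Otimes>\<^sub>M leb J)" by measurable
      from measurable_Pair1[OF this y] show ?thesis by (simp only: measurable_cnp_leb)
    qed
    have "(\<integral>\<^sup>+s. R * q y * (gS (s, y) * W (s, y)) \<partial>cnp I) = R * q y * (\<integral>\<^sup>+s. gS (s, y) * W (s, y) \<partial>cnp I)"
      by (rule nn_integral_cmult[OF mm])
    also have "\<dots> \<le> R * q y * ?B"
    proof (rule mult_left_mono)
      show "(\<integral>\<^sup>+s. gS (s, y) * W (s, y) \<partial>cnp I) \<le> ?B"
        unfolding gS_def W_def L_def fst_conv snd_conv
      proof (rule look_chain[OF fin(1) m])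
        show "\<theta> n > 0" using \<theta>Suc[of "n - 1"] n by simp
        show "(\<lambda>v. d k y v i) \<in> borel_measurable (leb I)" if "k < n" "i \<in> I" for k i
          using measurable_Pair2[OF d[OF that] y] by simp
        \<comment> \<open>The shift energy of every look fits into the noise budget, so
          \<open>look_chain\<close> is applied with \<open>A = Z\<close>; this produces the exponent
          \<open>2 * (Z + Z) = 128 * n * card I\<close>.\<close>
        show "(cmod (\<kappa> k))\<^sup>2 * \<theta> k \<le> Z" if "k < n" for k
        proof (cases k)
          case 0
          have "(cmod (\<kappa> 0))\<^sup>2 * (32 * real (card I)) \<le> 1 * (32 * real (card I))"
            by (rule mult_right_mono[OF \<kappa>0]) simp
          also have "\<dots> \<le> Z" using n mult_right_mono[of 1 "real n" "real (card I)"] by (simp add: Z_def)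
          finally show ?thesis using 0 by (simp add: \<theta>_def)
        next
          case (Suc j)
          have "(cmod (\<kappa> k))\<^sup>2 * \<theta> k = ((cmod (\<kappa> (Suc j)))\<^sup>2 * D j) * (8 * real n * real (card I))"
            using Suc by (simp add: \<theta>_def)
          also have "\<dots> \<le> 1 * (8 * real n * real (card I))"
            by (rule mult_right_mono) (use \<kappa>Suc[of j] Suc that in auto)
          also have "\<dots> \<le> Z" by (simp add: Z_def)
          finally show ?thesis .
        qed
      qed simp
    qed simp
    finally show "(\<integral>\<^sup>+s. R * q y * (gS (s, y) * W (s, y)) \<partial>cnp I) \<le> R * q y * ?B" .
  qed
  also have "\<dots> = R * ?B * (\<integral>\<^sup>+y. q y \<partial>leb J)"
    using q(1) by (subst nn_integral_cmult[symmetric]) (auto simp: mult_ac)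
  also have "\<dots> \<le> R * ?B * 1" by (intro mult_left_mono q) simp
  finally have "(\<integral>\<^sup>+p. gS p * gY p * W p \<partial>N) \<le> R * ?B" by simp
  then have "(\<integral>\<^sup>+p. gS p * gY p * W p \<partial>N) + ennreal (1/2) \<le> R * ?B + ennreal (1/2)"
    by (rule add_right_mono)
  from order_trans[OF half this] have le: "1 \<le> ennreal (1/2) + R * ?B" by (simp only: add.commute)
  have one: "(1::ennreal) = ennreal (1/2) + ennreal (1/2)"
    by (subst ennreal_plus[symmetric]) auto
  have "ennreal (1/2) \<le> R * ?B"
    using le unfolding one ennreal_add_left_cancel_le by (auto simp del: ennreal_plus)
  moreover have "\<theta> n = 8 * n * card I * D (n - 1)" using n by (cases n) (auto simp: \<theta>_def)
  moreover have "2 * (Z + Z) = 128 * n * card I" by (simp add: Z_def)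
  ultimately show ?thesis by (simp only: diff_zero)
qed

section \<open>Gaussian elimination of the channel\<close>

text \<open>Entries of the successive Schur complements, without row exchanges. Division by a zero
  pivot yields multiplier 0; on the channels used below the pivots stay away from 0.\<close>

fun elim :: "(nat \<times> nat \<Rightarrow> complex) \<Rightarrow> nat \<Rightarrow> nat \<Rightarrow> nat \<Rightarrow> complex" where
  "elim H 0 i t = H (i, t)"
| "elim H (Suc p) i t = elim H p i t - elim H p i p / elim H p p p * elim H p p t"

text \<open>The same row operations, with the multipliers of \<open>H\<close>, applied to one column
  of the received block. By linearity they act on signal and noise separately.\<close>

fun velim :: "(nat \<times> nat \<Rightarrow> complex) \<Rightarrow> (nat \<Rightarrow> complex) \<Rightarrow> nat \<Rightarrow> nat \<Rightarrow> complex" where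
  "velim H v 0 i = v i"
| "velim H v (Suc p) i = velim H v p i - elim H p i p / elim H p p p * velim H v p p"

lemma velim_linear:
  "velim H (\<lambda>i. a * (\<Sum>t\<in>T. H (i, t) * x t) + w i) q i = a * (\<Sum>t\<in>T. elim H q i t * x t) + velim H w q i"
proof (induction q arbitrary: i)
  case (Suc q)
  have eq: "(\<Sum>t\<in>T. elim H (Suc q) i t * x t)
      = (\<Sum>t\<in>T. elim H q i t * x t) - elim H q i q / elim H q q q * (\<Sum>t\<in>T. elim H q q t * x t)"
    by (simp add: sum_distrib_left sum_subtractf[symmetric] left_diff_distrib mult.assoc)
  show ?case unfolding velim.simps Suc.IH eq by (simp add: algebra_simps)
qed simp

text \<open>The row operations are lower unipotent: the correction added to an entry is built only
  from the entries used as pivots. This triangularity makes the passage to innovations volume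
  preserving.\<close>

lemma velim_dep:
  assumes "\<And>j. j < q \<Longrightarrow> v j = w j"
  shows "velim H v q i - v i = velim H w q i - w i"
  using assms
proof (induction q arbitrary: i)
  case (Suc q)
  have 1: "velim H v q j - v j = velim H w q j - w j" for j
    by (rule Suc.IH) (simp add: Suc.prems)
  have 2: "velim H v q q = velim H w q q" using 1[of q] Suc.prems[of q] by simp
  show ?case using 1[of i] by (simp add: 2 algebra_simps)
qed simp

lemma velim_measurable:
  assumes "i < m" "q \<le> m" and [measurable]: "\<And>j. j < m \<Longrightarrow> (\<lambda>y. v y j) \<in> borel_measurable M"
  shows "(\<lambda>y. velim H (v y) q i) \<in> borel_measurable M"
  using assms(1,2)
proof (induction q arbitrary: i)
  case (Suc q)
  have [measurable]: "(\<lambda>y. velim H (v y) q i) \<in> borel_measurable M"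
    "(\<lambda>y. velim H (v y) q q) \<in> borel_measurable M"
    using Suc by auto
  show ?case by simp
qed (simp add: assms(3))

text \<open>The analogous triangularity for the matrix itself, ordered by the level
  \<open>min i t\<close>: the first \<open>p\<close> steps correct an entry only through pivot rows
  and columns, whose entries have level below \<open>p\<close>.\<close>

lemma elim_dep:
  assumes "\<And>i t. i < r \<Longrightarrow> t < c \<Longrightarrow> min i t < p \<Longrightarrow> H (i, t) = H' (i, t)"
    and "i < r" "t < c" "p \<le> i" "p \<le> t"
  shows "elim H p i t - H (i, t) = elim H' p i t - H' (i, t)"
  using assms
proof (induction p arbitrary: i t)
  case (Suc p)
  have 1: "elim H p i' t' - H (i', t') = elim H' p i' t' - H' (i', t')"
    if "i' < r" "t' < c" "p \<le> i'" "p \<le> t'" for i' t'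
    by (rule Suc.IH) (use Suc.prems(1) that in auto)
  have 2: "elim H p i' t' = elim H' p i' t'" if "i' < r" "t' < c" "p \<le> i'" "p \<le> t'" "min i' t' = p" for i' t'
    using 1[OF that(1-4)] Suc.prems(1)[of i' t'] that by simp
  have "elim H p i p = elim H' p i p" "elim H p p p = elim H' p p p" "elim H p p t = elim H' p p t"
    by (rule 2; use Suc.prems in auto)+
  then show ?case using 1[of i t] Suc.prems by (simp add: algebra_simps)
qed simp

lemma elim_measurable:
  assumes "i < r" "t < c" "p \<le> r" "p \<le> c"
  shows "(\<lambda>H. elim H p i t) \<in> borel_measurable (leb ({..<r} \<times> {..<c}))"
  using assms
proof (induction p arbitrary: i t)
  case 0
  then have "(\<lambda>H. H (i, t)) \<in> leb ({..<r} \<times> {..<c}) \<rightarrow>\<^sub>M lborel"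
    by (intro measurable_component_singleton) auto
  then show ?case by simp
next
  case (Suc p)
  have [measurable]: "(\<lambda>H. elim H p i t) \<in> borel_measurable (leb ({..<r} \<times> {..<c}))"
    "(\<lambda>H. elim H p i p) \<in> borel_measurable (leb ({..<r} \<times> {..<c}))"
    "(\<lambda>H. elim H p p p) \<in> borel_measurable (leb ({..<r} \<times> {..<c}))"
    "(\<lambda>H. elim H p p t) \<in> borel_measurable (leb ({..<r} \<times> {..<c}))"
    using Suc by auto
  show ?case by simp
qed

text \<open>Channel matrices whose elimination has \<open>k + 1\<close> pivots of modulus about
  \<open>\<epsilon> 0, \<dots>, \<epsilon> k\<close> and a remainder of size \<open>\<epsilon> (k + 1)\<close>. The residual of entry \<open>(i, t)\<close> at its
  own level depends on lower levels only through a shift, so the volume of this set is explicit.\<close>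

definition nearly_singular :: "nat \<Rightarrow> nat \<Rightarrow> nat \<Rightarrow> (nat \<Rightarrow> real) \<Rightarrow> (nat \<times> nat \<Rightarrow> complex) \<Rightarrow> bool" where
  "nearly_singular r c k \<epsilon> H \<longleftrightarrow> (\<forall>i<r. \<forall>t<c.
     cmod (elim H (min (min i t) (Suc k)) i t - (if i = t \<and> i \<le> k then of_real (\<epsilon> i) else 0))
       \<le> \<epsilon> (min (min i t) (Suc k)) / 2)"

locale elimination =
  fixes r c k :: nat and \<epsilon> :: "nat \<Rightarrow> real" and H :: "nat \<times> nat \<Rightarrow> complex"
  assumes ns: "nearly_singular r c k \<epsilon> H" and kr: "k < r" and kc: "k < c"
    and \<epsilon>0: "\<And>p. 0 < \<epsilon> p" and \<epsilon>1: "\<And>p. \<epsilon> p \<le> 1"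
begin

lemma elim_level:
  assumes "i < r" "t < c"
  shows "cmod (elim H (min (min i t) (Suc k)) i t - (if i = t \<and> i \<le> k then of_real (\<epsilon> i) else 0))
       \<le> \<epsilon> (min (min i t) (Suc k)) / 2"
  using ns assms by (auto simp: nearly_singular_def)

lemma pivot_ge:
  assumes "p \<le> k"
  shows "\<epsilon> p / 2 \<le> cmod (elim H p p p)"
proof -
  have "cmod (elim H p p p - of_real (\<epsilon> p)) \<le> \<epsilon> p / 2"
    using elim_level[of p p] assms kr kc by (simp add: min_def)
  moreover have "cmod (of_real (\<epsilon> p)) = \<epsilon> p" using \<epsilon>0[of p] by simp
  ultimately show ?thesis
    using norm_triangle_ineq4[of "elim H p p p" "elim H p p p - of_real (\<epsilon> p)"] by simp
qed

lemma pivot_nz: "p \<le> k \<Longrightarrow> elim H p p p \<noteq> 0"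
  using pivot_ge[of p] \<epsilon>0[of p] by auto

lemma elim_zero:
  assumes "q \<le> Suc k" "t < q"
  shows "elim H q i t = 0"
  using assms
proof (induction q arbitrary: i)
  case (Suc q)
  then show ?case
    by (cases "t = q") (auto simp: pivot_nz)
qed simp

lemma elim_own_level_le:
  assumes "i < r" "t < c"
  shows "cmod (elim H (min (min i t) (Suc k)) i t) \<le> 3 / 2 * \<epsilon> (min (min i t) (Suc k))"
proof (cases "i = t \<and> i \<le> k")
  case True
  then have "cmod (elim H i i i - of_real (\<epsilon> i)) \<le> \<epsilon> i / 2"
    using elim_level[of i i] kr kc by (simp add: min_def)
  moreover have "cmod (of_real (\<epsilon> i)) = \<epsilon> i" using \<epsilon>0[of i] by simp
  ultimately have "cmod (elim H i i i) \<le> 3 / 2 * \<epsilon> i"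
    using norm_triangle_ineq[of "elim H i i i - of_real (\<epsilon> i)" "of_real (\<epsilon> i)"] by simp
  then show ?thesis using True by (simp add: min_def)
next
  case False
  then have "cmod (elim H (min (min i t) (Suc k)) i t) \<le> \<epsilon> (min (min i t) (Suc k)) / 2"
    using elim_level[OF assms] unfolding if_not_P[OF False] by simp
  then show ?thesis using \<epsilon>0[of "min (min i t) (Suc k)"] by linarith
qed

lemma row_le:
  assumes "i < r" "t < c"
  shows "cmod (elim H (min i (Suc k)) i t) \<le> 3 / 2 * \<epsilon> (min i (Suc k))"
proof (cases "t < min i (Suc k)")
  case True
  then show ?thesis using elim_zero[of "min i (Suc k)" t i] \<epsilon>0[of "min i (Suc k)"] by simp
next
  case False
  then have "min (min i t) (Suc k) = min i (Suc k)" by auto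
  then show ?thesis using elim_own_level_le[OF assms] by simp
qed

text \<open>The reason for the choice of discs: a pivot lies within \<open>\<epsilon> p / 2\<close>
  of \<open>\<epsilon> p\<close>, hence has modulus at least \<open>\<epsilon> p / 2\<close>, while
  the entries below it lie within \<open>\<epsilon> p / 2\<close> of 0. Multipliers thus stay
  bounded without row exchanges.\<close>

lemma coeff_le_1:
  assumes "p \<le> k" "p < i" "i < r"
  shows "cmod (elim H p i p / elim H p p p) \<le> 1"
proof -
  have "cmod (elim H p i p) \<le> \<epsilon> p / 2"
    using elim_level[of i p] assms kc by (simp add: min_def)
  also have "\<dots> \<le> cmod (elim H p p p)" by (rule pivot_ge[OF assms(1)])
  finally show ?thesis using pivot_nz[OF assms(1)] by (simp add: norm_divide)
qed

text \<open>With multipliers of modulus at most 1, each step at most doubles the bound.\<close>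

lemma velim_le:
  assumes "q \<le> Suc k" "q \<le> i" "i < r"
  shows "cmod (velim H v q i) \<le> 2 ^ q * (\<Sum>j<r. cmod (v j))"
  using assms
proof (induction q arbitrary: i)
  case 0
  then show ?case using member_le_sum[of i "{..<r}" "\<lambda>j. cmod (v j)"] by simp
next
  case (Suc q)
  have "cmod (velim H v (Suc q) i) \<le> cmod (velim H v q i) + cmod (elim H q i q / elim H q q q) * cmod (velim H v q q)"
    using norm_triangle_ineq4[of "velim H v q i" "elim H q i q / elim H q q q * velim H v q q"]
    by (simp only: velim.simps norm_mult)
  also have "\<dots> \<le> cmod (velim H v q i) + 1 * cmod (velim H v q q)"
    by (intro add_left_mono mult_right_mono coeff_le_1) (use Suc.prems in auto)
  also have "\<dots> \<le> 2 ^ q * (\<Sum>j<r. cmod (v j)) + 1 * (2 ^ q * (\<Sum>j<r. cmod (v j)))"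
    by (intro add_mono mult_left_mono Suc.IH) (use Suc.prems in auto)
  finally show ?case by simp
qed

text \<open>The elimination is run backwards: undoing a step adds a multiplier of modulus at most 1
  times a pivot-row entry of modulus at most 2. A bound free of \<open>\<epsilon>\<close> keeps the
  Gaussian density above a constant on the whole set.\<close>

lemma entry_le:
  assumes "i < r" "t < c"
  shows "cmod (H (i, t)) \<le> 2 * real (k + 2)"
proof -
  have "cmod (H (i, t)) \<le> cmod (elim H p i t) + 2 * real p" if "p \<le> min (min i t) (Suc k)" for p
    using that
  proof (induction p)
    case (Suc p)
    have row: "cmod (elim H p p t) \<le> 2"
    proof -
      have "cmod (elim H p p t) \<le> 3 / 2 * \<epsilon> p"
        using row_le[of p t] Suc.prems assms by (simp add: min.absorb1)
      then show ?thesis using \<epsilon>1[of p] by linarith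
    qed
    have "elim H p i t = elim H (Suc p) i t + elim H p i p / elim H p p p * elim H p p t" by simp
    then have "cmod (elim H p i t) \<le> cmod (elim H (Suc p) i t) + cmod (elim H p i p / elim H p p p) * cmod (elim H p p t)"
      by (metis norm_triangle_ineq norm_mult)
    also have "\<dots> \<le> cmod (elim H (Suc p) i t) + 1 * 2"
      by (intro add_left_mono mult_mono coeff_le_1 row) (use Suc.prems assms in auto)
    finally show ?case using Suc by simp
  qed simp
  from this[of "min (min i t) (Suc k)"]
  have "cmod (H (i, t)) \<le> cmod (elim H (min (min i t) (Suc k)) i t) + 2 * real (min (min i t) (Suc k))"
    by simp
  moreover have "real (min (min i t) (Suc k)) \<le> real k + 1" by simp
  ultimately show ?thesis
    using elim_own_level_le[OF assms] \<epsilon>1[of "min (min i t) (Suc k)"] by (simp del: of_nat_min)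
qed

end

lemma elim_residual_measurable:
  assumes "i < r" "t < c" "k < r" "k < c"
  shows "(\<lambda>H. elim H (min (min i t) (Suc k)) i t) \<in> borel_measurable (leb ({..<r} \<times> {..<c}))"
  by (rule elim_measurable) (use assms in auto)

lemma pred_in_disc:
  fixes f :: "'z \<Rightarrow> complex"
  assumes [measurable]: "f \<in> borel_measurable M"
  shows "Measurable.pred M (\<lambda>x. cmod (f x - a) \<le> b)"
  by measurable

lemma nearly_singular_measurable:
  assumes "k < r" "k < c"
  shows "Measurable.pred (leb ({..<r} \<times> {..<c})) (nearly_singular r c k \<epsilon>)"
proof -
  have "Measurable.pred (leb ({..<r} \<times> {..<c})) (\<lambda>H. \<forall>i\<in>{..<r}. \<forall>t\<in>{..<c}.
     cmod (elim H (min (min i t) (Suc k)) i t - (if i = t \<and> i \<le> k then of_real (\<epsilon> i) else 0))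
       \<le> \<epsilon> (min (min i t) (Suc k)) / 2)"
  proof (rule pred_intros_finite(3)[OF finite_lessThan], rule pred_intros_finite(3)[OF finite_lessThan])
    fix i t assume "i \<in> {..<r}" "t \<in> {..<c}"
    then have m: "(\<lambda>H. elim H (min (min i t) (Suc k)) i t) \<in> borel_measurable (leb ({..<r} \<times> {..<c}))"
      using assms by (intro elim_residual_measurable) auto
    show "Measurable.pred (leb ({..<r} \<times> {..<c})) (\<lambda>H. cmod (elim H (min (min i t) (Suc k)) i t
        - (if i = t \<and> i \<le> k then of_real (\<epsilon> i) else 0)) \<le> \<epsilon> (min (min i t) (Suc k)) / 2)"
      using m by (rule pred_in_disc)
  qed
  then show ?thesis unfolding nearly_singular_def[abs_def] Ball_def lessThan_iff .
qed

lemma emeasure_disc: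
  fixes a :: complex
  assumes "0 \<le> s"
  shows "emeasure lborel (cball a s) = ennreal (pi * s\<^sup>2)"
  using emeasure_cball[OF assms, of a] by (simp add: unit_ball_vol_2)

text \<open>In the residual coordinates, triangular in the level \<open>min i t\<close>, the set is
  a product of discs, so its Lebesgue measure is explicit. On it \<open>entry_le\<close> bounds the
  Gaussian density from below.\<close>

lemma nearly_singular_prob_ge:
  assumes kr: "k < r" and kc: "k < c" and \<epsilon>0: "\<And>p. 0 < \<epsilon> p" and \<epsilon>1: "\<And>p. \<epsilon> p \<le> 1"
  shows "ennreal ((\<Prod>(i, t)\<in>{..<r} \<times> {..<c}. exp (- (2 * real (k + 2))\<^sup>2) / 4 * (\<epsilon> (min (min i t) (Suc k)))\<^sup>2))
    \<le> (\<integral>\<^sup>+H. (if nearly_singular r c k \<epsilon> H then 1 else 0) \<partial>cnp ({..<r} \<times> {..<c}))"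
proof -
  let ?J = "{..<r} \<times> {..<c}"
  define e where "e j = \<epsilon> (min (min (fst j) (snd j)) (Suc k))" for j :: "nat \<times> nat"
  define ctr where "ctr j = (if fst j = snd j \<and> fst j \<le> k then complex_of_real (\<epsilon> (fst j)) else 0)" for j :: "nat \<times> nat"
  define z where "z H j = elim H (min (min (fst j) (snd j)) (Suc k)) (fst j) (snd j)" for H and j :: "nat \<times> nat"
  \<comment> \<open>Lower bound for the density of one entry. The disc area
    \<open>pi * (e j / 2)^2\<close> cancels its \<open>pi\<close> and leaves the factor 1/4 of the
    statement.\<close>
  let ?C = "exp (- (2 * real (k + 2))\<^sup>2) / pi"
  let ?f = "\<lambda>j w. ennreal ?C * indicator (cball (ctr j) (e j / 2)) w :: ennreal"
  have e0: "0 < e j" for j using \<epsilon>0 by (simp add: e_def)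
  have zm: "(\<lambda>H. z H j) \<in> borel_measurable (leb ?J)" if "j \<in> ?J" for j
    unfolding z_def by (rule elim_residual_measurable) (use that kr kc in auto)
  have "(\<integral>\<^sup>+H. (\<Prod>j\<in>?J. ?f j (H j - (H j - z H j))) \<partial>leb ?J) = (\<Prod>j\<in>?J. \<integral>\<^sup>+w. ?f j w \<partial>lborel)"
  proof (rule nn_integral_triangular[where rk="\<lambda>j. min (fst j) (snd j)"])
    show "?f j \<in> borel_measurable borel" for j
      by (intro borel_measurable_times_ennreal borel_measurable_const borel_measurable_indicator) simp
    show "(\<lambda>H. H j - z H j) \<in> borel_measurable (leb ?J)" if "j \<in> ?J" for j
    proof -
      have [measurable]: "(\<lambda>H. z H j) \<in> borel_measurable (leb ?J)" by (rule zm[OF that])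
      show ?thesis using that by measurable
    qed
    fix j and H H' :: "nat \<times> nat \<Rightarrow> complex"
    assume j: "j \<in> ?J" and eq: "\<And>l. l \<in> ?J \<Longrightarrow> min (fst l) (snd l) < min (fst j) (snd j) \<Longrightarrow> H l = H' l"
    have "elim H (min (min (fst j) (snd j)) (Suc k)) (fst j) (snd j) - H (fst j, snd j)
        = elim H' (min (min (fst j) (snd j)) (Suc k)) (fst j) (snd j) - H' (fst j, snd j)"
    proof (rule elim_dep[where r=r and c=c])
      fix i t assume "i < r" "t < c" "min i t < min (min (fst j) (snd j)) (Suc k)"
      then show "H (i, t) = H' (i, t)" using eq[of "(i, t)"] by simp
    qed (use j in auto)
    then have "z H j - H j = z H' j - H' j" by (simp add: z_def)
    then show "H j - z H j = H' j - z H' j" by (simp add: algebra_simps)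
  qed simp
  also have "\<dots> = (\<Prod>j\<in>?J. ennreal (exp (- (2 * real (k + 2))\<^sup>2) / 4 * (e j)\<^sup>2))"
  proof (rule prod.cong[OF refl])
    fix j
    have "(\<integral>\<^sup>+w. ?f j w \<partial>lborel) = ennreal ?C * ennreal (pi * (e j / 2)\<^sup>2)"
    proof -
      have "(\<integral>\<^sup>+w. ?f j w \<partial>lborel) = ennreal ?C * (\<integral>\<^sup>+w. indicator (cball (ctr j) (e j / 2)) w \<partial>lborel)"
        by (rule nn_integral_cmult) (rule borel_measurable_indicator, simp)
      also have "(\<integral>\<^sup>+w. indicator (cball (ctr j) (e j / 2)) w \<partial>lborel) = emeasure lborel (cball (ctr j) (e j / 2))"
        by (rule nn_integral_indicator) simp
      also have "\<dots> = ennreal (pi * (e j / 2)\<^sup>2)"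
        using e0[of j] by (intro emeasure_disc) simp
      finally show ?thesis .
    qed
    also have "\<dots> = ennreal (?C * (pi * (e j / 2)\<^sup>2))" by (rule ennreal_mult[symmetric]) auto
    also have "?C * (pi * (e j / 2)\<^sup>2) = exp (- (2 * real (k + 2))\<^sup>2) / 4 * (e j)\<^sup>2"
      by (simp add: power_divide)
    finally show "(\<integral>\<^sup>+w. ?f j w \<partial>lborel) = ennreal (exp (- (2 * real (k + 2))\<^sup>2) / 4 * (e j)\<^sup>2)" .
  qed
  also have "\<dots> = ennreal (\<Prod>j\<in>?J. exp (- (2 * real (k + 2))\<^sup>2) / 4 * (e j)\<^sup>2)"
    by (rule prod_ennreal) simp
  finally have eq: "(\<integral>\<^sup>+H. (\<Prod>j\<in>?J. ?f j (z H j)) \<partial>leb ?J) = \<dots>" by simp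
  have "(\<integral>\<^sup>+H. (\<Prod>j\<in>?J. ?f j (z H j)) \<partial>leb ?J)
     \<le> (\<integral>\<^sup>+H. gdens ?J (\<lambda>_. 0) H * (if nearly_singular r c k \<epsilon> H then 1 else 0) \<partial>leb ?J)"
  proof (rule nn_integral_mono)
    fix H :: "nat \<times> nat \<Rightarrow> complex"
    show "(\<Prod>j\<in>?J. ?f j (z H j)) \<le> gdens ?J (\<lambda>_. 0) H * (if nearly_singular r c k \<epsilon> H then 1 else 0)"
    proof (cases "nearly_singular r c k \<epsilon> H")
      case True
      interpret elimination r c k \<epsilon> H
        by unfold_locales (use True kr kc \<epsilon>0 \<epsilon>1 in auto)
      have "(\<Prod>j\<in>?J. ?f j (z H j)) \<le> (\<Prod>j\<in>?J. ennreal (gauss (H j - 0)))"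
      proof (rule prod_mono_ennreal)
        fix j assume j: "j \<in> ?J"
        have "(cmod (H j))\<^sup>2 \<le> (2 * real (k + 2))\<^sup>2"
          using entry_le[of "fst j" "snd j"] j by (intro power_mono) auto
        then have "?C \<le> gauss (H j - 0)" by (simp add: gauss_def divide_right_mono)
        then have "ennreal ?C \<le> ennreal (gauss (H j - 0))" by (rule ennreal_leI)
        then show "?f j (z H j) \<le> ennreal (gauss (H j - 0))" by (auto simp: indicator_def)
      qed
      then show ?thesis using True by (simp add: gdens_def)
    next
      case False
      then obtain i t where it: "i < r" "t < c" "\<not> cmod (elim H (min (min i t) (Suc k)) i t
          - (if i = t \<and> i \<le> k then of_real (\<epsilon> i) else 0)) \<le> \<epsilon> (min (min i t) (Suc k)) / 2"
        unfolding nearly_singular_def by blast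
      have "\<not> cmod (z H (i, t) - ctr (i, t)) \<le> e (i, t) / 2"
        using it(3) unfolding z_def ctr_def e_def fst_conv snd_conv .
      then have "z H (i, t) \<notin> cball (ctr (i, t)) (e (i, t) / 2)"
        by (simp add: dist_norm norm_minus_commute)
      then have "\<exists>j\<in>?J. ?f j (z H j) = 0"
        using it(1,2) by (intro bexI[of _ "(i, t)"]) auto
      then have "(\<Prod>j\<in>?J. ?f j (z H j)) = 0" by (intro prod_zero) auto
      then show ?thesis by (simp only: zero_le)
    qed
  qed
  also have "\<dots> = (\<integral>\<^sup>+H. (if nearly_singular r c k \<epsilon> H then 1 else 0) \<partial>cnp ?J)"
  proof (rule nn_integral_cnp[symmetric])
    note nearly_singular_measurable[OF kr kc, measurable]
    show "(\<lambda>H. if nearly_singular r c k \<epsilon> H then 1 else 0 :: ennreal) \<in> borel_measurable (leb ?J)" by measurable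
  qed simp
  finally show ?thesis unfolding eq by (simp add: e_def case_prod_unfold)
qed

section \<open>A law of the received block that does not involve the source\<close>

definition innov :: "nat \<Rightarrow> (nat \<times> nat \<Rightarrow> complex) \<Rightarrow> (nat \<times> nat \<Rightarrow> complex) \<Rightarrow> nat \<times> nat \<Rightarrow> complex" where
  "innov k H y j = velim H (\<lambda>i. y (i, snd j)) (min (fst j) (Suc k)) (fst j)"

text \<open>Density of a block whose innovations, the outputs after elimination of earlier rows, are
  independent complex Gaussians with row variances \<open>\<sigma>\<close>. It depends on the
  channel only, and it is normalised because the innovations are triangular in the row
  index.\<close>

definition pred_dens ::
  "nat \<Rightarrow> nat \<Rightarrow> nat \<Rightarrow> (nat \<Rightarrow> real) \<Rightarrow> (nat \<times> nat \<Rightarrow> complex) \<Rightarrow> (nat \<times> nat \<Rightarrow> complex) \<Rightarrow> ennreal" where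
  "pred_dens r n k \<sigma> H y = (\<Prod>j\<in>{..<r} \<times> {..<n}.
     ennreal (exp (- ((cmod (innov k H y j))\<^sup>2 / \<sigma> (fst j))) / (pi * \<sigma> (fst j))))"

lemma innov_measurable:
  assumes "j \<in> {..<r} \<times> {..<n}"
  shows "(\<lambda>y. innov k H y j) \<in> borel_measurable (leb ({..<r} \<times> {..<n}))"
  unfolding innov_def
proof (rule velim_measurable)
  show "(\<lambda>y. y (i, snd j)) \<in> borel_measurable (leb ({..<r} \<times> {..<n}))" if "i < r" for i
    using measurable_component_singleton[of "(i, snd j)" "{..<r} \<times> {..<n}" "\<lambda>_. lborel :: complex measure"]
      that assms by auto
qed (use assms in auto)

lemma borel_measurable_exp_density:
  fixes f :: "'z \<Rightarrow> complex"
  assumes [measurable]: "f \<in> borel_measurable M"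
  shows "(\<lambda>x. ennreal (exp (- ((cmod (f x))\<^sup>2 / s)) / c)) \<in> borel_measurable M"
  by measurable

lemma pred_dens_measurable:
  "pred_dens r n k \<sigma> H \<in> borel_measurable (leb ({..<r} \<times> {..<n}))"
  unfolding pred_dens_def[abs_def]
  by (intro borel_measurable_prod_ennreal borel_measurable_exp_density innov_measurable)

lemma nn_integral_pred_dens:
  assumes "\<And>i. 0 < \<sigma> i"
  shows "(\<integral>\<^sup>+y. pred_dens r n k \<sigma> H y \<partial>leb ({..<r} \<times> {..<n})) = 1"
proof -
  let ?J = "{..<r} \<times> {..<n}"
  let ?f = "\<lambda>j z. ennreal (exp (- ((cmod z)\<^sup>2 / \<sigma> (fst j))) / (pi * \<sigma> (fst j)))"
  have "(\<integral>\<^sup>+y. (\<Prod>j\<in>?J. ?f j (y j - (y j - innov k H y j))) \<partial>leb ?J)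
      = (\<Prod>j\<in>?J. \<integral>\<^sup>+z. ?f j z \<partial>lborel)"
  proof (rule nn_integral_triangular[where rk=fst])
    show "?f j \<in> borel_measurable borel" for j :: "nat \<times> nat"
      by (rule borel_measurable_exp_density) simp
    show "(\<lambda>y. y j - innov k H y j) \<in> borel_measurable (leb ?J)" if "j \<in> ?J" for j
      using measurable_component_singleton[OF that, of "\<lambda>_. lborel :: complex measure"]
      by (intro borel_measurable_diff innov_measurable that) simp
    fix j and y y' :: "nat \<times> nat \<Rightarrow> complex"
    assume j: "j \<in> ?J" and eq: "\<And>l. l \<in> ?J \<Longrightarrow> fst l < fst j \<Longrightarrow> y l = y' l"
    have "innov k H y j - y (fst j, snd j) = innov k H y' j - y' (fst j, snd j)"
      unfolding innov_def by (rule velim_dep) (use eq j in auto)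
    then show "y j - innov k H y j = y' j - innov k H y' j" by (simp add: algebra_simps)
  qed simp
  also have "\<dots> = (\<Prod>j\<in>?J. 1)"
  proof (rule prod.cong[OF refl])
    fix j :: "nat \<times> nat"
    have "(\<integral>\<^sup>+z. ?f j z \<partial>lborel)
        = (\<integral>\<^sup>+z. ennreal (exp (- ((cmod z)\<^sup>2 / \<sigma> (fst j)))) * ennreal (1 / (pi * \<sigma> (fst j))) \<partial>lborel)"
      using assms by (intro nn_integral_cong) (simp add: ennreal_mult[symmetric] less_imp_le)
    also have "\<dots> = (\<integral>\<^sup>+z. ennreal (exp (- ((cmod z)\<^sup>2 / \<sigma> (fst j)))) \<partial>lborel) * ennreal (1 / (pi * \<sigma> (fst j)))"
      by (rule nn_integral_multc) measurable
    also have "\<dots> = ennreal (pi * \<sigma> (fst j)) * ennreal (1 / (pi * \<sigma> (fst j)))"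
      by (simp only: nn_integral_exp_cmod_square[OF assms])
    also have "\<dots> = ennreal (pi * \<sigma> (fst j) * (1 / (pi * \<sigma> (fst j))))"
      using assms[of "fst j"] by (intro ennreal_mult[symmetric]) auto
    also have "\<dots> = 1" using assms[of "fst j"] by simp
    finally show "(\<integral>\<^sup>+z. ?f j z \<partial>lborel) = 1" .
  qed
  finally show ?thesis by (simp add: pred_dens_def)
qed

definition chan_mean :: "nat \<Rightarrow> real \<Rightarrow> (nat \<times> nat \<Rightarrow> complex) \<Rightarrow> (nat \<times> nat \<Rightarrow> complex) \<Rightarrow> nat \<times> nat \<Rightarrow> complex" where
  "chan_mean c \<rho> H x j = complex_of_real (sqrt (\<rho> / real c)) * (\<Sum>t<c. H (fst j, t) * x (t, snd j))"

context elimination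
begin

text \<open>The scale of the signal power left in row \<open>i\<close> after elimination, taken as
  the variance of its innovation.\<close>

abbreviation noise_var :: "real \<Rightarrow> nat \<Rightarrow> real" where
  "noise_var \<rho> i \<equiv> \<rho> * (\<epsilon> (min i (Suc k)))\<^sup>2"

text \<open>Signal part: the residual row has entries at most \<open>3 / 2 * \<epsilon>\<close>, so
  by Cauchy-Schwarz its energy is at most \<open>9 / 4 * noise_var\<close> times the input energy,
  the number of antennas cancelling against the power normalisation; the doubled 9/4 is rounded up
  to 5. Noise part: elimination costs at most \<open>2 ^ r\<close> against the sum of moduli, and
  \<open>noise_var \<ge> 1\<close> allows the division.\<close>

lemma innov_le:
  assumes "i < r" and \<rho>: "\<And>p. p \<le> Suc k \<Longrightarrow> 1 \<le> \<rho> * (\<epsilon> p)\<^sup>2"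
  shows "(cmod (innov k H y (i, \<tau>)))\<^sup>2 / noise_var \<rho> i
    \<le> 5 * (\<Sum>t<c. (cmod (x (t, \<tau>)))\<^sup>2)
      + 2 * 4 ^ r * real r * (\<Sum>j<r. (cmod (y (j, \<tau>) - chan_mean c \<rho> H x (j, \<tau>)))\<^sup>2)"
proof -
  let ?q = "min i (Suc k)"
  let ?a = "complex_of_real (sqrt (\<rho> / real c))"
  let ?w = "\<lambda>j. y (j, \<tau>) - chan_mean c \<rho> H x (j, \<tau>)"
  let ?P = "\<Sum>t<c. (cmod (x (t, \<tau>)))\<^sup>2" and ?N = "\<Sum>j<r. (cmod (?w j))\<^sup>2"
  have \<sigma>1: "1 \<le> noise_var \<rho> i" using \<rho>[of ?q] by simp
  then have \<rho>0: "0 < \<rho>" by (metis not_less mult_nonpos_nonneg zero_le_power2 order_trans not_one_le_zero)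
  have c0: "0 < real c" using kc by simp
  have dec: "innov k H y (i, \<tau>) = ?a * (\<Sum>t<c. elim H ?q i t * x (t, \<tau>)) + velim H ?w ?q i"
  proof -
    have "(\<lambda>j. y (j, \<tau>)) = (\<lambda>j. ?a * (\<Sum>t<c. H (j, t) * x (t, \<tau>)) + ?w j)"
      by (simp add: chan_mean_def)
    then show ?thesis
      unfolding innov_def fst_conv snd_conv
      using velim_linear[of H ?a "\<lambda>t. x (t, \<tau>)" "{..<c}" ?w ?q i] by (simp only:)
  qed
  let ?A = "?a * (\<Sum>t<c. elim H ?q i t * x (t, \<tau>))" and ?B = "velim H ?w ?q i"
  have A: "(cmod ?A)\<^sup>2 \<le> 9 / 4 * noise_var \<rho> i * ?P"
  proof -
    have "cmod (\<Sum>t<c. elim H ?q i t * x (t, \<tau>)) \<le> (\<Sum>t<c. 3 / 2 * \<epsilon> ?q * cmod (x (t, \<tau>)))"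
    proof (rule sum_norm_le)
      fix t assume "t \<in> {..<c}"
      then show "cmod (elim H ?q i t * x (t, \<tau>)) \<le> 3 / 2 * \<epsilon> ?q * cmod (x (t, \<tau>))"
        unfolding norm_mult by (intro mult_right_mono row_le assms(1)) auto
    qed
    also have "\<dots> = 3 / 2 * \<epsilon> ?q * (\<Sum>t<c. cmod (x (t, \<tau>)))" by (simp add: sum_distrib_left)
    finally have "(cmod (\<Sum>t<c. elim H ?q i t * x (t, \<tau>)))\<^sup>2 \<le> (3 / 2 * \<epsilon> ?q * (\<Sum>t<c. cmod (x (t, \<tau>))))\<^sup>2"
      by (intro power_mono) auto
    also have "\<dots> = 9 / 4 * (\<epsilon> ?q)\<^sup>2 * (\<Sum>t<c. cmod (x (t, \<tau>)))\<^sup>2"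
      by (simp add: power_mult_distrib power_divide)
    also have "\<dots> \<le> 9 / 4 * (\<epsilon> ?q)\<^sup>2 * (?P * c)"
      using sum_squared_le_sum_of_squares[of "\<lambda>t. cmod (x (t, \<tau>))" "{..<c}"]
      by (intro mult_left_mono) auto
    finally have "\<rho> / c * (cmod (\<Sum>t<c. elim H ?q i t * x (t, \<tau>)))\<^sup>2 \<le> \<rho> / c * (9 / 4 * (\<epsilon> ?q)\<^sup>2 * (?P * c))"
      using \<rho>0 by (intro mult_left_mono) auto
    also have "\<dots> = 9 / 4 * noise_var \<rho> i * ?P" using c0 by simp
    also have "\<rho> / c * (cmod (\<Sum>t<c. elim H ?q i t * x (t, \<tau>)))\<^sup>2 = (cmod ?A)\<^sup>2"
      using \<rho>0 by (simp add: norm_mult power_mult_distrib)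
    finally show ?thesis .
  qed
  have B: "(cmod ?B)\<^sup>2 \<le> 4 ^ r * real r * ?N"
  proof -
    have "cmod ?B \<le> 2 ^ ?q * (\<Sum>j<r. cmod (?w j))" by (rule velim_le) (use assms in auto)
    also have "\<dots> \<le> 2 ^ r * (\<Sum>j<r. cmod (?w j))"
      using assms(1) by (intro mult_right_mono power_increasing sum_nonneg) auto
    finally have "(cmod ?B)\<^sup>2 \<le> (2 ^ r * (\<Sum>j<r. cmod (?w j)))\<^sup>2" by (intro power_mono) auto
    also have "\<dots> = 4 ^ r * (\<Sum>j<r. cmod (?w j))\<^sup>2"
      by (simp add: power_mult_distrib power2_eq_square power_mult_distrib[symmetric])
    also have "\<dots> \<le> 4 ^ r * (?N * r)"
      using sum_squared_le_sum_of_squares[of "\<lambda>j. cmod (?w j)" "{..<r}"]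
      by (intro mult_left_mono) auto
    finally show ?thesis by (simp add: mult_ac)
  qed
  have "(cmod (innov k H y (i, \<tau>)))\<^sup>2 \<le> 2 * (cmod ?A)\<^sup>2 + 2 * (cmod ?B)\<^sup>2"
    using cmod_diff_square_le[of ?A "- ?B"] by (simp add: dec)
  also have "\<dots> \<le> noise_var \<rho> i * (5 * ?P) + 2 * 4 ^ r * real r * ?N"
  proof -
    have "0 \<le> noise_var \<rho> i * ?P" using \<rho>0 by (intro mult_nonneg_nonneg sum_nonneg) auto
    then show ?thesis using A B by (simp add: algebra_simps)
  qed
  also have "\<dots> \<le> noise_var \<rho> i * (5 * ?P) + noise_var \<rho> i * (2 * 4 ^ r * real r * ?N)"
  proof -
    have "1 * (2 * 4 ^ r * real r * ?N) \<le> noise_var \<rho> i * (2 * 4 ^ r * real r * ?N)"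
      by (intro mult_right_mono \<sigma>1 mult_nonneg_nonneg sum_nonneg) auto
    then show ?thesis by simp
  qed
  also have "\<dots> = noise_var \<rho> i * (5 * ?P + 2 * 4 ^ r * real r * ?N)" by (simp add: distrib_left)
  finally show ?thesis using \<sigma>1 by (simp add: pos_divide_le_eq mult.commute)
qed

text \<open>For typical input and noise the normalised innovations have energy of order
  \<open>B\<close>, so the reference density is at least its peak times the exponential of a
  negative multiple of \<open>B\<close>. The two peaks differ by the product of the variances, once
  per channel use; with the pivot sizes chosen later this is \<rho> to the power r n.\<close>

lemma gdens_le_pred_dens:
  assumes \<rho>: "\<And>p. p \<le> Suc k \<Longrightarrow> 1 \<le> \<rho> * (\<epsilon> p)\<^sup>2"
    and P: "(\<Sum>\<tau><n. \<Sum>t<c. (cmod (x (t, \<tau>)))\<^sup>2) \<le> B"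
    and N: "(\<Sum>j\<in>{..<r} \<times> {..<n}. (cmod (y j - chan_mean c \<rho> H x j))\<^sup>2) \<le> B"
  shows "gdens ({..<r} \<times> {..<n}) (chan_mean c \<rho> H x) y
    \<le> ennreal ((\<Prod>i<r. noise_var \<rho> i) ^ n * exp (real r * (5 + 2 * 4 ^ r * real r) * B))
      * pred_dens r n k (noise_var \<rho>) H y"
proof -
  let ?J = "{..<r} \<times> {..<n}"
  let ?\<sigma> = "noise_var \<rho>"
  have \<sigma>1: "1 \<le> ?\<sigma> i" for i using \<rho>[of "min i (Suc k)"] by simp
  have \<sigma>0: "0 < ?\<sigma> i" for i using \<sigma>1[of i] by linarith
  let ?S = "\<Sum>j\<in>?J. (cmod (innov k H y j))\<^sup>2 / ?\<sigma> (fst j)"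
  have pd: "pred_dens r n k ?\<sigma> H y = ennreal (exp (- ?S) * (1 / pi) ^ card ?J / (\<Prod>i<r. ?\<sigma> i) ^ n)"
  proof -
    have "(\<Prod>j\<in>?J. exp (- ((cmod (innov k H y j))\<^sup>2 / ?\<sigma> (fst j))) / (pi * ?\<sigma> (fst j)))
      = (\<Prod>j\<in>?J. exp (- ((cmod (innov k H y j))\<^sup>2 / ?\<sigma> (fst j))) * ((1 / pi) * (1 / ?\<sigma> (fst j))))"
      by (intro prod.cong) auto
    also have "\<dots> = (\<Prod>j\<in>?J. exp (- ((cmod (innov k H y j))\<^sup>2 / ?\<sigma> (fst j)))) * ((\<Prod>j\<in>?J. 1 / pi) * (\<Prod>j\<in>?J. 1 / ?\<sigma> (fst j)))"
      by (simp only: prod.distrib)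
    also have "(\<Prod>j\<in>?J. exp (- ((cmod (innov k H y j))\<^sup>2 / ?\<sigma> (fst j)))) = exp (- ?S)"
      by (simp add: exp_sum[symmetric] sum_negf)
    also have "(\<Prod>j\<in>?J. 1 / ?\<sigma> (fst j)) = 1 / (\<Prod>i<r. ?\<sigma> i) ^ n"
    proof -
      have "(\<Prod>j\<in>?J. 1 / ?\<sigma> (fst j)) = (\<Prod>i<r. \<Prod>\<tau><n. 1 / ?\<sigma> i)"
        by (simp only: prod.cartesian_product) (simp only: case_prod_unfold)
      also have "\<dots> = 1 / (\<Prod>i<r. ?\<sigma> i) ^ n"
        by (simp only: prod_constant card_lessThan power_one_over prod_dividef prod.neutral_const prod_power_distrib power_one)
      finally show ?thesis .
    qed
    finally have "(\<Prod>j\<in>?J. exp (- ((cmod (innov k H y j))\<^sup>2 / ?\<sigma> (fst j))) / (pi * ?\<sigma> (fst j)))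
       = exp (- ?S) * (1 / pi) ^ card ?J / (\<Prod>i<r. ?\<sigma> i) ^ n"
      by (simp only: prod_constant times_divide_eq_right mult_1_right)
    moreover have "0 \<le> exp (- ((cmod (innov k H y j))\<^sup>2 / ?\<sigma> (fst j))) / (pi * ?\<sigma> (fst j))" for j
      by (intro divide_nonneg_nonneg mult_nonneg_nonneg less_imp_le[OF \<sigma>0]) auto
    ultimately show ?thesis unfolding pred_dens_def by (subst prod_ennreal) auto
  qed
  let ?K = "5 + 2 * 4 ^ r * real r"
  have "?S = (\<Sum>i<r. \<Sum>\<tau><n. (cmod (innov k H y (i, \<tau>)))\<^sup>2 / ?\<sigma> i)"
    by (simp add: sum.cartesian_product case_prod_unfold)
  also have "\<dots> \<le> (\<Sum>i<r. \<Sum>\<tau><n. 5 * (\<Sum>t<c. (cmod (x (t, \<tau>)))\<^sup>2)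
      + 2 * 4 ^ r * real r * (\<Sum>j<r. (cmod (y (j, \<tau>) - chan_mean c \<rho> H x (j, \<tau>)))\<^sup>2))"
    by (intro sum_mono innov_le \<rho>) auto
  also have "\<dots> = real r * (5 * (\<Sum>\<tau><n. \<Sum>t<c. (cmod (x (t, \<tau>)))\<^sup>2)
      + 2 * 4 ^ r * real r * (\<Sum>\<tau><n. \<Sum>j<r. (cmod (y (j, \<tau>) - chan_mean c \<rho> H x (j, \<tau>)))\<^sup>2))"
    by (simp add: sum.distrib sum_distrib_left)
  also have "(\<Sum>\<tau><n. \<Sum>j<r. (cmod (y (j, \<tau>) - chan_mean c \<rho> H x (j, \<tau>)))\<^sup>2)
      = (\<Sum>j\<in>?J. (cmod (y j - chan_mean c \<rho> H x j))\<^sup>2)"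
    by (subst sum.swap) (simp add: sum.cartesian_product case_prod_unfold)
  also have "real r * (5 * (\<Sum>\<tau><n. \<Sum>t<c. (cmod (x (t, \<tau>)))\<^sup>2)
      + 2 * 4 ^ r * real r * (\<Sum>j\<in>?J. (cmod (y j - chan_mean c \<rho> H x j))\<^sup>2))
      \<le> real r * (5 * B + 2 * 4 ^ r * real r * B)"
    by (intro mult_left_mono add_mono P N) auto
  also have "\<dots> = real r * ?K * B" by (simp add: algebra_simps)
  finally have S: "?S \<le> real r * ?K * B" .
  have prod0: "0 < (\<Prod>i<r. ?\<sigma> i) ^ n" using \<sigma>0 by (intro zero_less_power prod_pos) auto
  have "gdens ?J (chan_mean c \<rho> H x) y \<le> ennreal ((1 / pi) ^ card ?J)" by (rule gdens_le)
  also have "\<dots> \<le> ennreal (((\<Prod>i<r. ?\<sigma> i) ^ n * exp (real r * ?K * B))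
      * (exp (- ?S) * (1 / pi) ^ card ?J / (\<Prod>i<r. ?\<sigma> i) ^ n))"
  proof (rule ennreal_leI)
    have "1 \<le> exp (real r * ?K * B) * exp (- ?S)" using S by (simp add: exp_add[symmetric])
    from mult_right_mono[OF this, of "(1 / pi) ^ card ?J"]
    have "(1 / pi) ^ card ?J \<le> exp (real r * ?K * B) * exp (- ?S) * (1 / pi) ^ card ?J" by simp
    also have "\<dots> = ((\<Prod>i<r. ?\<sigma> i) ^ n * exp (real r * ?K * B))
      * (exp (- ?S) * (1 / pi) ^ card ?J / (\<Prod>i<r. ?\<sigma> i) ^ n)"
    proof -
      have "e * f * g = X * e * (f * g / X)" if "0 < X" for X e f g :: real using that by simp
      from this[OF prod0] show ?thesis .
    qed
    finally show "(1 / pi) ^ card ?J \<le> \<dots>" .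
  qed
  also have "\<dots> = ennreal ((\<Prod>i<r. ?\<sigma> i) ^ n * exp (real r * ?K * B)) * pred_dens r n k ?\<sigma> H y"
    unfolding pd using prod0 by (intro ennreal_mult) auto
  finally show ?thesis .
qed

end

section \<open>Distortion for a fixed channel\<close>

text \<open>On the unit disc the Gaussian density is at least \<open>exp (-1) / pi\<close>, so the
  disc of squared radius \<open>a\<close> has mass at least \<open>a / exp 1\<close>. If every gain
  in it were bad, the disc alone would exceed the average.\<close>

lemma CN_disc_average:
  assumes "0 < a" "a \<le> 1" and F: "(\<integral>\<^sup>+g. G g \<partial>CN) < ennreal F'"
  shows "\<exists>g. (cmod g)\<^sup>2 \<le> a \<and> G g \<le> ennreal (exp 1 * F' / a)"
proof (rule ccontr)
  assume "\<not> ?thesis"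
  then have G: "ennreal (exp 1 * F' / a) \<le> G g" if "(cmod g)\<^sup>2 \<le> a" for g
    using that by (metis linear)
  have F'0: "0 < F'" using F by (metis ennreal_neg linorder_not_le not_less_zero)
  let ?D = "cball (0::complex) (sqrt a)"
  have inD: "g \<in> ?D \<longleftrightarrow> (cmod g)\<^sup>2 \<le> a" for g
    using real_sqrt_le_iff[of "(cmod g)\<^sup>2" a] by simp
  have "ennreal F' = ennreal (exp 1 * F' / a) * ennreal (exp (-1) * a)"
  proof -
    have "ennreal (exp 1 * F' / a) * ennreal (exp (-1) * a) = ennreal (exp 1 * F' / a * (exp (-1) * a))"
      using F'0 assms(1) by (intro ennreal_mult[symmetric]) auto
    also have "exp 1 * F' / a * (exp (-1) * a) = F' * (exp 1 * exp (-1))"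
      using assms(1) by simp
    also have "\<dots> = F'" by (simp add: exp_add[symmetric])
    finally show ?thesis by simp
  qed
  also have "ennreal (exp (-1) * a) = (\<integral>\<^sup>+g. ennreal (exp (-1) / pi) * indicator ?D g \<partial>lborel)"
  proof -
    have "(\<integral>\<^sup>+g. ennreal (exp (-1) / pi) * indicator ?D g \<partial>lborel) = ennreal (exp (-1) / pi) * emeasure lborel ?D"
      by (rule nn_integral_cmult_indicator) simp
    also have "\<dots> = ennreal (exp (-1) / pi) * ennreal (pi * a)"
      using assms(1) by (simp add: emeasure_disc)
    also have "\<dots> = ennreal (exp (-1) / pi * (pi * a))" using assms(1) by (intro ennreal_mult[symmetric]) auto
    finally show ?thesis by simp
  qed
  also have "\<dots> \<le> (\<integral>\<^sup>+g. ennreal (gauss g) * indicator ?D g \<partial>lborel)"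
  proof (rule nn_integral_mono)
    fix g
    show "ennreal (exp (-1) / pi) * indicator ?D g \<le> ennreal (gauss g) * indicator ?D g"
    proof (cases "g \<in> ?D")
      case True
      then have "(cmod g)\<^sup>2 \<le> 1" using inD assms(2) by auto
      then have "exp (-1) / pi \<le> gauss g" by (simp add: gauss_def divide_right_mono)
      then show ?thesis using True by (simp add: ennreal_leI)
    qed simp
  qed
  also have "(\<integral>\<^sup>+g. ennreal (gauss g) * indicator ?D g \<partial>lborel) = (\<integral>\<^sup>+g. indicator ?D g \<partial>CN)"
    by (rule nn_integral_CN[symmetric]) (rule borel_measurable_indicator, simp)
  also have "ennreal (exp 1 * F' / a) * (\<integral>\<^sup>+g. indicator ?D g \<partial>CN) = (\<integral>\<^sup>+g. ennreal (exp 1 * F' / a) * indicator ?D g \<partial>CN)"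
    by (rule nn_integral_cmult[symmetric]) (rule borel_measurable_indicator, simp add: sets_CN)
  also have "\<dots> \<le> (\<integral>\<^sup>+g. G g \<partial>CN)"
    by (rule nn_integral_mono) (use G inD in \<open>auto simp: indicator_def\<close>)
  finally show False using F by (simp add: mult_left_mono)
qed

text \<open>Mean distortion per symbol for a fixed channel and a fixed side-information gain:
  \<open>c\<close> gives the noiseless channel output, \<open>\<kappa>\<close> the effective gain,
  \<open>d\<close> the decoder.\<close>

definition noise_form ::
  "'j set \<Rightarrow> 'i set \<Rightarrow> (('i \<Rightarrow> complex) \<Rightarrow> 'j \<Rightarrow> complex) \<Rightarrow> complex
    \<Rightarrow> (('j \<Rightarrow> complex) \<Rightarrow> ('i \<Rightarrow> complex) \<Rightarrow> 'i \<Rightarrow> complex) \<Rightarrow> ennreal" where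
  "noise_form J I c \<kappa> d = (\<integral>\<^sup>+s. \<integral>\<^sup>+w. \<integral>\<^sup>+z. ennreal (1 / real (card I) * (\<Sum>i\<in>I.
     (cmod (s i - d (\<lambda>j\<in>J. c s j + w j) (\<lambda>i\<in>I. \<kappa> * s i + z i) i))\<^sup>2)) \<partial>cnp I \<partial>cnp J \<partial>cnp I)"

text \<open>Moves from noise variables to observation densities, the form required by
  \<open>half_le_decoupled\<close>; the factor \<open>card I\<close> undoes the normalisation per
  symbol.\<close>

lemma noise_form_density:
  assumes fin: "finite I" "finite J" and m: "card I > 0"
    and d: "\<And>i. i \<in> I \<Longrightarrow> (\<lambda>(y, v). d y v i) \<in> borel_measurable (leb J \<Otimes>\<^sub>M leb I)"
    and c: "\<And>j. j \<in> J \<Longrightarrow> (\<lambda>s. c s j) \<in> borel_measurable (leb I)"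
  shows "(\<integral>\<^sup>+s. \<integral>\<^sup>+y. gdens J (c s) y *
      (\<integral>\<^sup>+v. gdens I (\<lambda>i. \<kappa> * s i) v * ennreal (\<Sum>i\<in>I. (cmod (s i - d y v i))\<^sup>2) \<partial>leb I) \<partial>leb J \<partial>cnp I)
    = ennreal (card I) * noise_form J I c \<kappa> d"
proof -
  let ?e = "\<lambda>s y v. ennreal (\<Sum>i\<in>I. (cmod (s i - d y v i))\<^sup>2)"
  interpret V: sigma_finite_measure "leb I" by (rule sigma_finite_leb[OF fin(1)])
  interpret Z: prob_space "cnp I" by (rule prob_space_cnp)
  interpret Y: sigma_finite_measure "leb J" by (rule sigma_finite_leb[OF fin(2)])
  interpret W: prob_space "cnp J" by (rule prob_space_cnp)
  have dm [measurable]: "(\<lambda>x. d (snd (fst x)) (snd x) i) \<in> borel_measurable ((leb I \<Otimes>\<^sub>M leb J) \<Otimes>\<^sub>M leb I)"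
    if "i \<in> I" for i
  proof -
    have "(\<lambda>x. (snd (fst x), snd x)) \<in> (leb I \<Otimes>\<^sub>M leb J) \<Otimes>\<^sub>M leb I \<rightarrow>\<^sub>M leb J \<Otimes>\<^sub>M leb I" by measurable
    from measurable_compose[OF this d[OF that]] show ?thesis by simp
  qed
  have inner: "(\<integral>\<^sup>+v. gdens I (\<lambda>i. \<kappa> * s i) v * ?e s y v \<partial>leb I) = (\<integral>\<^sup>+z. ?e s y (\<lambda>i\<in>I. \<kappa> * s i + z i) \<partial>cnp I)"
    if y: "y \<in> space (leb J)" for s y
  proof (rule nn_integral_cnp_shift[OF fin(1), symmetric])
    have [measurable]: "(\<lambda>v. d y v i) \<in> borel_measurable (leb I)" if "i \<in> I" for i
      using measurable_Pair2[OF d[OF that] y] by simp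
    show "?e s y \<in> borel_measurable (leb I)" by measurable
  qed
  have Km: "(\<lambda>p. \<integral>\<^sup>+v. gdens I (\<lambda>i. \<kappa> * fst p i) v * ?e (fst p) (snd p) v \<partial>leb I)
      \<in> borel_measurable (leb I \<Otimes>\<^sub>M leb J)" by measurable
  have outer: "(\<integral>\<^sup>+y. gdens J (c s) y * (\<integral>\<^sup>+v. gdens I (\<lambda>i. \<kappa> * s i) v * ?e s y v \<partial>leb I) \<partial>leb J)
     = (\<integral>\<^sup>+w. \<integral>\<^sup>+z. ?e s (\<lambda>j\<in>J. c s j + w j) (\<lambda>i\<in>I. \<kappa> * s i + z i) \<partial>cnp I \<partial>cnp J)"
    if s: "s \<in> space (leb I)" for s
  proof -
    have "(\<lambda>y. \<integral>\<^sup>+v. gdens I (\<lambda>i. \<kappa> * s i) v * ?e s y v \<partial>leb I) \<in> borel_measurable (leb J)"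
      using measurable_Pair2[OF Km s] by simp
    from nn_integral_cnp_shift[OF fin(2) this, of "c s"]
    have "(\<integral>\<^sup>+y. gdens J (c s) y * (\<integral>\<^sup>+v. gdens I (\<lambda>i. \<kappa> * s i) v * ?e s y v \<partial>leb I) \<partial>leb J)
       = (\<integral>\<^sup>+w. \<integral>\<^sup>+v. gdens I (\<lambda>i. \<kappa> * s i) v * ?e s (\<lambda>j\<in>J. c s j + w j) v \<partial>leb I \<partial>cnp J)"
      by simp
    also have "\<dots> = (\<integral>\<^sup>+w. \<integral>\<^sup>+z. ?e s (\<lambda>j\<in>J. c s j + w j) (\<lambda>i\<in>I. \<kappa> * s i + z i) \<partial>cnp I \<partial>cnp J)"
      by (rule nn_integral_cong, rule inner) (simp add: space_PiM)
    finally show ?thesis .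
  qed
  let ?h = "\<lambda>s w z. ennreal (1 / real (card I) * (\<Sum>i\<in>I.
     (cmod (s i - d (\<lambda>j\<in>J. c s j + w j) (\<lambda>i\<in>I. \<kappa> * s i + z i) i))\<^sup>2))"
  let ?M = "(leb I \<Otimes>\<^sub>M cnp J) \<Otimes>\<^sub>M cnp I"
  have hm: "(\<lambda>x. ?h (fst (fst x)) (snd (fst x)) (snd x)) \<in> borel_measurable ?M"
  proof -
    have cj: "(\<lambda>x. c (fst (fst x)) j + snd (fst x) j) \<in> borel_measurable ?M" if "j \<in> J" for j
    proof -
      have "(\<lambda>x. c (fst (fst x)) j) \<in> borel_measurable ?M"
        by (rule measurable_compose[OF _ c[OF that]]) measurable
      moreover have "(\<lambda>x. snd (fst x) j) \<in> borel_measurable ?M" using that by measurable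
      ultimately show ?thesis by (rule borel_measurable_add)
    qed
    have yv: "(\<lambda>x. (\<lambda>j\<in>J. c (fst (fst x)) j + snd (fst x) j, \<lambda>i\<in>I. \<kappa> * fst (fst x) i + snd x i)) \<in> ?M \<rightarrow>\<^sub>M leb J \<Otimes>\<^sub>M leb I"
    proof (rule measurable_Pair)
      show "(\<lambda>x. \<lambda>j\<in>J. c (fst (fst x)) j + snd (fst x) j) \<in> ?M \<rightarrow>\<^sub>M leb J"
        by (rule measurable_restrict) (use cj in simp)
      show "(\<lambda>x. \<lambda>i\<in>I. \<kappa> * fst (fst x) i + snd x i) \<in> ?M \<rightarrow>\<^sub>M leb I"
        by measurable
    qed
    have [measurable]: "(\<lambda>x. d (\<lambda>j\<in>J. c (fst (fst x)) j + snd (fst x) j) (\<lambda>i\<in>I. \<kappa> * fst (fst x) i + snd x i) i) \<in> borel_measurable ?M"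
      if "i \<in> I" for i
      using measurable_compose[OF yv d[OF that]] by simp
    show ?thesis by measurable
  qed
  have "(\<integral>\<^sup>+s. \<integral>\<^sup>+y. gdens J (c s) y * (\<integral>\<^sup>+v. gdens I (\<lambda>i. \<kappa> * s i) v * ?e s y v \<partial>leb I) \<partial>leb J \<partial>cnp I)
     = (\<integral>\<^sup>+s. \<integral>\<^sup>+w. \<integral>\<^sup>+z. ?e s (\<lambda>j\<in>J. c s j + w j) (\<lambda>i\<in>I. \<kappa> * s i + z i) \<partial>cnp I \<partial>cnp J \<partial>cnp I)"
    by (rule nn_integral_cong, rule outer) (simp add: space_cnp_leb)
  also have "\<dots> = (\<integral>\<^sup>+s. \<integral>\<^sup>+w. \<integral>\<^sup>+z. ennreal (card I) * ?h s w z \<partial>cnp I \<partial>cnp J \<partial>cnp I)"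
    using m by (simp add: ennreal_mult'[symmetric])
  also have "\<dots> = (\<integral>\<^sup>+s. ennreal (card I) * (\<integral>\<^sup>+w. \<integral>\<^sup>+z. ?h s w z \<partial>cnp I \<partial>cnp J) \<partial>cnp I)"
  proof (rule nn_integral_cong)
    fix s assume "s \<in> space (cnp I)"
    then have s: "s \<in> space (leb I)" by (simp add: space_cnp_leb)
    have hw: "(\<lambda>p. ?h s (fst p) (snd p)) \<in> borel_measurable (cnp J \<Otimes>\<^sub>M cnp I)"
    proof -
      have "(\<lambda>p. ((s, fst p), snd p)) \<in> cnp J \<Otimes>\<^sub>M cnp I \<rightarrow>\<^sub>M ?M" using s by measurable
      from measurable_compose[OF this hm] show ?thesis by simp
    qed
    have "(\<integral>\<^sup>+z. ennreal (card I) * ?h s w z \<partial>cnp I) = ennreal (card I) * (\<integral>\<^sup>+z. ?h s w z \<partial>cnp I)"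
      if "w \<in> space (cnp J)" for w
      using measurable_Pair2[OF hw that] by (intro nn_integral_cmult) simp
    moreover have "(\<lambda>w. \<integral>\<^sup>+z. ?h s w z \<partial>cnp I) \<in> borel_measurable (cnp J)"
      using Z.borel_measurable_nn_integral_fst[OF hw] by simp
    ultimately show "(\<integral>\<^sup>+w. \<integral>\<^sup>+z. ennreal (card I) * ?h s w z \<partial>cnp I \<partial>cnp J)
       = ennreal (card I) * (\<integral>\<^sup>+w. \<integral>\<^sup>+z. ?h s w z \<partial>cnp I \<partial>cnp J)"
      by (simp add: nn_integral_cmult cong: nn_integral_cong)
  qed
  also have "\<dots> = ennreal (card I) * noise_form J I c \<kappa> d"
    unfolding noise_form_def
  proof (rule nn_integral_cmult)
    have "(\<lambda>p. \<integral>\<^sup>+z. ?h (fst p) (snd p) z \<partial>cnp I) \<in> borel_measurable (leb I \<Otimes>\<^sub>M cnp J)"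
      using Z.borel_measurable_nn_integral_fst[OF hm] by simp
    from W.borel_measurable_nn_integral_fst[OF this]
    show "(\<lambda>s. \<integral>\<^sup>+w. \<integral>\<^sup>+z. ?h s w z \<partial>cnp I \<partial>cnp J) \<in> borel_measurable (cnp I)"
      by (simp add: measurable_cnp_leb)
  qed
  finally show ?thesis .
qed

lemma power_and_noise_markov:
  assumes fin: "finite J" and B: "B > 0"
    and c: "\<And>j. j \<in> J \<Longrightarrow> (\<lambda>s. c s j) \<in> borel_measurable M"
    and P: "P \<in> borel_measurable M" "\<And>s. 0 \<le> P s" "(\<integral>\<^sup>+s. ennreal (P s) \<partial>M) \<le> ennreal b"
    and M: "prob_space M" and b: "0 \<le> b" "b + 4 * real (card J) \<le> B / 8"
  shows "(\<integral>\<^sup>+s. \<integral>\<^sup>+y. gdens J (c s) y *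
      (if P s \<le> B \<and> (\<Sum>j\<in>J. (cmod (y j - c s j))\<^sup>2) \<le> B then 0 else 1) \<partial>leb J \<partial>M) \<le> ennreal (1 / 8)"
proof -
  interpret prob_space M by (rule M)
  let ?N = "\<lambda>s y. \<Sum>j\<in>J. (cmod (y j - c s j))\<^sup>2"
  have "(\<integral>\<^sup>+s. \<integral>\<^sup>+y. gdens J (c s) y * (if P s \<le> B \<and> ?N s y \<le> B then 0 else 1) \<partial>leb J \<partial>M)
    \<le> (\<integral>\<^sup>+s. ennreal (1 / B) * ennreal (P s) + ennreal (1 / B * (4 * real (card J))) \<partial>M)"
  proof (rule nn_integral_mono)
    fix s
    have "(\<integral>\<^sup>+y. gdens J (c s) y * (if P s \<le> B \<and> ?N s y \<le> B then 0 else 1) \<partial>leb J)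
      \<le> (\<integral>\<^sup>+y. gdens J (c s) y * (ennreal (1 / B) * ennreal (P s)) + ennreal (1 / B) * (gdens J (c s) y * ennreal (?N s y)) \<partial>leb J)"
    proof (rule nn_integral_mono)
      fix y
      have "(if P s \<le> B \<and> ?N s y \<le> B then 0 else 1) \<le> (if P s \<le> B then 0 else 1) + (if ?N s y \<le> B then 0 else 1 :: ennreal)"
        by auto
      also have "\<dots> \<le> ennreal (1 / B) * ennreal (P s) + ennreal (1 / B) * ennreal (?N s y)"
        by (intro add_mono indicator_markov B P(2) sum_nonneg) simp
      finally have "gdens J (c s) y * (if P s \<le> B \<and> ?N s y \<le> B then 0 else 1) \<le> gdens J (c s) y * \<dots>"
        by (rule mult_left_mono) simp
      then show "gdens J (c s) y * (if P s \<le> B \<and> ?N s y \<le> B then 0 else 1)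
        \<le> gdens J (c s) y * (ennreal (1 / B) * ennreal (P s)) + ennreal (1 / B) * (gdens J (c s) y * ennreal (?N s y))"
        by (simp add: distrib_left mult_ac)
    qed
    also have "\<dots> = (\<integral>\<^sup>+y. gdens J (c s) y * (ennreal (1 / B) * ennreal (P s)) \<partial>leb J)
        + (\<integral>\<^sup>+y. ennreal (1 / B) * (gdens J (c s) y * ennreal (?N s y)) \<partial>leb J)"
      by (rule nn_integral_add) measurable
    also have "(\<integral>\<^sup>+y. gdens J (c s) y * (ennreal (1 / B) * ennreal (P s)) \<partial>leb J)
        = (\<integral>\<^sup>+y. gdens J (c s) y \<partial>leb J) * (ennreal (1 / B) * ennreal (P s))"
      by (rule nn_integral_multc) measurable
    also have "\<dots> = ennreal (1 / B) * ennreal (P s)" by (simp add: nn_integral_gdens[OF fin])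
    also have "(\<integral>\<^sup>+y. ennreal (1 / B) * (gdens J (c s) y * ennreal (?N s y)) \<partial>leb J)
       = ennreal (1 / B) * (\<integral>\<^sup>+y. gdens J (c s) y * ennreal (?N s y) \<partial>leb J)"
      by (rule nn_integral_cmult) measurable
    also have "ennreal (1 / B) * ennreal (P s) + \<dots> \<le> ennreal (1 / B) * ennreal (P s) + ennreal (1 / B) * (4 * of_nat (card J))"
      by (intro add_left_mono mult_left_mono second_moment_gdens fin) simp
    also have "ennreal (1 / B) * (4 * of_nat (card J)) = ennreal (1 / B * (4 * real (card J)))"
      using B by (intro ennreal_mult_4_of_nat) simp
    finally show "(\<integral>\<^sup>+y. gdens J (c s) y * (if P s \<le> B \<and> ?N s y \<le> B then 0 else 1) \<partial>leb J)
      \<le> ennreal (1 / B) * ennreal (P s) + ennreal (1 / B * (4 * real (card J)))" .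
  qed
  also have "\<dots> = (\<integral>\<^sup>+s. ennreal (1 / B) * ennreal (P s) \<partial>M) + (\<integral>\<^sup>+s. ennreal (1 / B * (4 * real (card J))) \<partial>M)"
    by (rule nn_integral_add) (use P(1) in measurable)
  also have "(\<integral>\<^sup>+s. ennreal (1 / B) * ennreal (P s) \<partial>M) = ennreal (1 / B) * (\<integral>\<^sup>+s. ennreal (P s) \<partial>M)"
    by (rule nn_integral_cmult) (use P(1) in measurable)
  also have "(\<integral>\<^sup>+s. ennreal (1 / B * (4 * real (card J))) \<partial>M) = ennreal (1 / B * (4 * real (card J)))"
    by (simp add: emeasure_space_1)
  also have "ennreal (1 / B) * (\<integral>\<^sup>+s. ennreal (P s) \<partial>M) + ennreal (1 / B * (4 * real (card J)))
     \<le> ennreal (1 / B) * ennreal b + ennreal (1 / B * (4 * real (card J)))"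
    by (intro add_right_mono mult_left_mono P) simp
  also have "ennreal (1 / B) * ennreal b = ennreal (1 / B * b)" using B b by (intro ennreal_mult[symmetric]) auto
  also have "ennreal (1 / B * b) + ennreal (1 / B * (4 * real (card J))) = ennreal (1 / B * b + 1 / B * (4 * real (card J)))"
    using B b by (intro ennreal_plus[symmetric]) auto
  also have "\<dots> \<le> ennreal (1 / 8)"
    using B b by (intro ennreal_leI) (simp add: field_simps)
  finally show ?thesis .
qed

lemma (in elimination) half_le_decoupled_channel:
  fixes enc :: "(nat \<Rightarrow> complex) \<Rightarrow> nat \<times> nat \<Rightarrow> complex" and m n L :: nat
  assumes m: "0 < m" and L: "0 < L" and \<rho>s: "0 < \<rho>s"
    and \<rho>: "\<And>p. p \<le> Suc k \<Longrightarrow> 1 \<le> \<rho> * (\<epsilon> p)\<^sup>2"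
    and encm: "\<And>t i. (\<lambda>S. enc S (t, i)) \<in> borel_measurable (leb {..<m})"
    and pow: "(\<integral>\<^sup>+S. ennreal (\<Sum>i<n. \<Sum>t<c. (cmod (enc S (t, i)))\<^sup>2) \<partial>cnp {..<m}) \<le> ennreal (real n * real c)"
    and estm: "\<And>g i. i \<in> {..<m} \<Longrightarrow> (\<lambda>(y, v). est g y v i) \<in> borel_measurable (leb ({..<r} \<times> {..<n}) \<Otimes>\<^sub>M leb {..<m})"
    and F: "(\<integral>\<^sup>+g. noise_form ({..<r} \<times> {..<n}) {..<m} (\<lambda>s. chan_mean c \<rho> H (enc s))
       (complex_of_real (sqrt \<rho>s) * g) (est g) \<partial>CN) < ennreal F'"
    and F': "F' * (exp 1 * (max \<rho>s 1 powr (1 / L) * max \<rho>s 1)) \<le> 1"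
  shows "1 / 2 \<le> (\<Prod>i<r. noise_var \<rho> i) ^ n * exp (real r * (5 + 2 * 4 ^ r * real r) * (64 * (real c + real r) * (real n + real m)))
     * (exp (128 * real (Suc L) * real m) ^ Suc L * (exp 1 * (8 * real (Suc L) * real m * (exp 1 * F')) / real m) ^ m)"
proof -
  let ?I = "{..<m}" and ?J = "{..<r} \<times> {..<n}"
  let ?c = "\<lambda>s. chan_mean c \<rho> H (enc s)"
  \<comment> \<open>Squared gains grow by the factor \<open>\<tau>\<close> from
    \<open>1 / \<sigma>\<close> to 1, so look \<open>k\<close> has power at most
    \<open>\<tau> ^ k\<close>. Look 0 is harmless against unit noise, and the power of look
    \<open>k + 1\<close> times \<open>D k\<close> is at most
    \<open>F' * (exp 1 * (\<tau> * \<sigma>))\<close>, the same number for all \<open>k\<close>. The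
    maximum with 1 keeps the discs inside the unit disc also for small
    \<open>\<rho>s\<close>.\<close>
  define \<sigma> where "\<sigma> = max \<rho>s 1"
  define \<tau> where "\<tau> = \<sigma> powr (1 / L)"
  define a where "a k = \<tau> ^ k / \<sigma>" for k
  \<comment> \<open>Linear in \<open>n + m\<close>, so that the exponential of a multiple of
    \<open>B\<close> is a constant per symbol; the summand \<open>m\<close> keeps \<open>B\<close>
    positive when \<open>n = 0\<close>.\<close>
  define B where "B = 64 * (real c + real r) * (real n + real m)"
  have B: "B > 0" using kc m by (simp add: B_def zero_less_mult_iff)
  have F'0: "0 < F'" using F by (metis ennreal_neg linorder_not_le not_less_zero)
  have \<sigma>1: "1 \<le> \<sigma>" by (simp add: \<sigma>_def)
  have \<tau>1: "1 \<le> \<tau>" using \<sigma>1 by (simp add: \<tau>_def ge_one_powr_ge_zero)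
  have \<tau>L: "\<tau> ^ L = \<sigma>" using L \<sigma>1 by (simp add: \<tau>_def powr_realpow[symmetric] powr_powr)
  have a0: "0 < a k" for k using \<tau>1 \<sigma>1 by (simp add: a_def)
  have a1: "a k \<le> 1" if "k \<le> L" for k
  proof -
    have "\<tau> ^ k \<le> \<tau> ^ L" using that \<tau>1 by (rule power_increasing)
    then show ?thesis using \<sigma>1 by (simp add: a_def \<tau>L)
  qed
  have "\<exists>g. (cmod g)\<^sup>2 \<le> a k \<and> noise_form ?J ?I ?c (complex_of_real (sqrt \<rho>s) * g) (est g) \<le> ennreal (exp 1 * F' / a k)"
    if "k \<le> L" for k
    by (rule CN_disc_average[OF a0 a1[OF that] F])
  then obtain g where g: "\<And>k. k \<le> L \<Longrightarrow> (cmod (g k))\<^sup>2 \<le> a k"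
    "\<And>k. k \<le> L \<Longrightarrow> noise_form ?J ?I ?c (complex_of_real (sqrt \<rho>s) * g k) (est (g k)) \<le> ennreal (exp 1 * F' / a k)"
    by metis
  define \<kappa> where "\<kappa> k = complex_of_real (sqrt \<rho>s) * g k" for k
  define D where "D k = exp 1 * F' / a k" for k
  have \<kappa>: "(cmod (\<kappa> k))\<^sup>2 \<le> \<tau> ^ k" if "k \<le> L" for k
  proof -
    have "(cmod (\<kappa> k))\<^sup>2 = \<rho>s * (cmod (g k))\<^sup>2" using \<rho>s by (simp add: \<kappa>_def norm_mult power_mult_distrib)
    also have "\<dots> \<le> \<sigma> * a k" by (rule mult_mono) (use g that \<sigma>1 in \<open>auto simp: \<sigma>_def\<close>)
    finally show ?thesis using \<sigma>1 by (simp add: a_def)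
  qed
  have cm: "(\<lambda>s. ?c s j) \<in> borel_measurable (leb ?I)" for j
    unfolding chan_mean_def
    by (intro borel_measurable_times borel_measurable_const borel_measurable_sum encm)
  let ?P = "\<lambda>s. \<Sum>i<n. \<Sum>t<c. (cmod (enc s (t, i)))\<^sup>2"
  have Pm: "?P \<in> borel_measurable (leb ?I)"
    by (intro borel_measurable_sum borel_measurable_power measurable_compose[OF encm borel_measurable_norm])
  let ?PY = "\<lambda>s y. ?P s \<le> B \<and> (\<Sum>j\<in>?J. (cmod (y j - ?c s j))\<^sup>2) \<le> B"
  let ?R = "ennreal ((\<Prod>i<r. noise_var \<rho> i) ^ n * exp (real r * (5 + 2 * 4 ^ r * real r) * B))"
  have \<sigma>0: "0 < noise_var \<rho> i" for i using \<rho>[of "min i (Suc k)"] by simp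
  have "ennreal (1 / 2) \<le> ?R * (ennreal (exp (128 * Suc L * card ?I)) ^ Suc L
     * ennreal (exp 1 * (8 * Suc L * card ?I * D (Suc L - 1)) / card ?I) ^ card ?I)"
  proof (rule half_le_decoupled[where c="?c" and PY="?PY" and q="pred_dens r n k (noise_var \<rho>) H"
        and d="\<lambda>k. est (g k)" and \<kappa>=\<kappa> and J="?J"])
    show "card ?I > 0" using m by simp
    show "D k > 0" for k using F'0 a0[of k] by (simp add: D_def)
    show "(\<lambda>s. ?c s j) \<in> borel_measurable (leb ?I)" for j by (rule cm)
    show "pred_dens r n k (noise_var \<rho>) H \<in> borel_measurable (leb ?J)" by (rule pred_dens_measurable)
    show "(\<integral>\<^sup>+y. pred_dens r n k (noise_var \<rho>) H y \<partial>leb ?J) \<le> 1"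
      by (simp only: nn_integral_pred_dens[OF \<sigma>0] order_refl)
    show "Measurable.pred (leb ?I \<Otimes>\<^sub>M leb ?J) (\<lambda>(s, y). ?PY s y)"
    proof -
      have 1: "(\<lambda>p. ?P (fst p)) \<in> borel_measurable (leb ?I \<Otimes>\<^sub>M leb ?J)"
        by (rule measurable_compose[OF measurable_fst Pm])
      have 2: "(\<lambda>p. \<Sum>j\<in>?J. (cmod (snd p j - ?c (fst p) j))\<^sup>2) \<in> borel_measurable (leb ?I \<Otimes>\<^sub>M leb ?J)"
      proof (rule borel_measurable_sum, rule borel_measurable_power, rule measurable_compose[OF borel_measurable_diff borel_measurable_norm])
        fix j assume j: "j \<in> ?J"
        show "(\<lambda>p. snd p j) \<in> borel_measurable (leb ?I \<Otimes>\<^sub>M leb ?J)"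
          using measurable_compose[OF measurable_snd measurable_component_singleton[OF j, of "\<lambda>_. lborel :: complex measure"]]
          by simp
        show "(\<lambda>p. ?c (fst p) j) \<in> borel_measurable (leb ?I \<Otimes>\<^sub>M leb ?J)"
          by (rule measurable_compose[OF measurable_fst cm])
      qed
      have le: "Measurable.pred M (\<lambda>p. f p \<le> B \<and> h p \<le> B)"
        if "f \<in> borel_measurable M" "h \<in> borel_measurable M" for f h :: "'z \<Rightarrow> real" and M
        using that by measurable
      show ?thesis using le[OF 1 2] by (simp only: case_prod_unfold)
    qed
    show "gdens ?J (?c s) y \<le> ?R * pred_dens r n k (noise_var \<rho>) H y" if "?PY s y" for s y
      by (rule gdens_le_pred_dens[OF \<rho>]) (use that in auto)
    show "(\<integral>\<^sup>+s. \<integral>\<^sup>+y. gdens ?J (?c s) y * (if ?PY s y then 0 else 1) \<partial>leb ?J \<partial>cnp ?I) \<le> ennreal (1 / 8)"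
    proof (rule power_and_noise_markov[OF _ B])
      show "(\<lambda>s. ?c s j) \<in> borel_measurable (cnp ?I)" for j using cm by (simp only: measurable_cnp_leb)
      show "?P \<in> borel_measurable (cnp ?I)" using Pm by (simp only: measurable_cnp_leb)
      show "(\<integral>\<^sup>+s. ennreal (?P s) \<partial>cnp ?I) \<le> ennreal (real n * real c)" by (rule pow)
      show "real n * real c + 4 * real (card ?J) \<le> B / 8"
      proof -
        have "real n * real c + 4 * (real n * real r) \<le> 8 * ((real c + real r) * real n)"
          by (simp add: algebra_simps)
        also have "\<dots> \<le> 8 * ((real c + real r) * (real n + real m))" by (intro mult_left_mono) auto
        also have "\<dots> = B / 8" by (simp add: B_def)
        finally show ?thesis by (simp add: mult.commute)
      qed
    qed (auto intro!: sum_nonneg prob_space_cnp)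
    show "(\<lambda>(y, v). est (g k) y v i) \<in> borel_measurable (leb ?J \<Otimes>\<^sub>M leb ?I)" if "i \<in> ?I" for k i
      by (rule estm[OF that])
    show "(\<integral>\<^sup>+s. \<integral>\<^sup>+y. gdens ?J (?c s) y * (\<integral>\<^sup>+v. gdens ?I (\<lambda>i. \<kappa> k * s i) v
        * ennreal (\<Sum>i\<in>?I. (cmod (s i - est (g k) y v i))\<^sup>2) \<partial>leb ?I) \<partial>leb ?J \<partial>cnp ?I) \<le> ennreal (card ?I * D k)"
      if "k < Suc L" for k
    proof -
      have "(\<integral>\<^sup>+s. \<integral>\<^sup>+y. gdens ?J (?c s) y * (\<integral>\<^sup>+v. gdens ?I (\<lambda>i. \<kappa> k * s i) v
        * ennreal (\<Sum>i\<in>?I. (cmod (s i - est (g k) y v i))\<^sup>2) \<partial>leb ?I) \<partial>leb ?J \<partial>cnp ?I)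
        = ennreal (card ?I) * noise_form ?J ?I ?c (\<kappa> k) (est (g k))"
        by (rule noise_form_density) (use m estm cm in auto)
      also have "\<dots> \<le> ennreal (card ?I) * ennreal (D k)"
        using g(2)[of k] that by (intro mult_left_mono) (auto simp: D_def \<kappa>_def)
      also have "\<dots> = ennreal (card ?I * D k)"
        using F'0 a0[of k] by (intro ennreal_mult[symmetric]) (auto simp: D_def)
      finally show ?thesis .
    qed
    show "(cmod (\<kappa> 0))\<^sup>2 \<le> 1" using \<kappa>[of 0] by simp
    show "(cmod (\<kappa> (Suc k)))\<^sup>2 * D k \<le> 1" if "Suc k < Suc L" for k
    proof -
      have "(cmod (\<kappa> (Suc k)))\<^sup>2 * D k \<le> \<tau> ^ Suc k * D k"
        using \<kappa>[of "Suc k"] that F'0 a0[of k] by (intro mult_right_mono) (auto simp: D_def)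
      also have "\<dots> = F' * (exp 1 * (\<tau> * \<sigma>))"
        using \<tau>1 \<sigma>1 by (simp add: D_def a_def)
      also have "\<dots> \<le> 1" using F' by (simp add: \<tau>_def \<sigma>_def)
      finally show ?thesis .
    qed
  qed auto
  \<comment> \<open>The last disc is the unit disc, so the final accuracy is the average distortion
    itself up to a constant.\<close>
  also have "D (Suc L - 1) = exp 1 * F'" using \<tau>L \<sigma>1 by (simp add: D_def a_def)
  also have "?R * (ennreal (exp (128 * Suc L * card ?I)) ^ Suc L
     * ennreal (exp 1 * (8 * Suc L * card ?I * (exp 1 * F')) / card ?I) ^ card ?I)
    = ennreal (((\<Prod>i<r. noise_var \<rho> i) ^ n * exp (real r * (5 + 2 * 4 ^ r * real r) * B))
     * (exp (128 * Suc L * card ?I) ^ Suc L * (exp 1 * (8 * Suc L * card ?I * (exp 1 * F')) / card ?I) ^ card ?I))"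
  proof -
    have *: "ennreal A * (ennreal E ^ p * ennreal X ^ q) = ennreal (A * (E ^ p * X ^ q))"
      if "0 \<le> A" "0 \<le> E" "0 \<le> X" for A E X and p q :: nat
      using that by (simp add: ennreal_mult ennreal_power)
    have "0 \<le> (\<Prod>i<r. noise_var \<rho> i) ^ n * exp (real r * (5 + 2 * 4 ^ r * real r) * B)"
      by (intro mult_nonneg_nonneg zero_le_power prod_nonneg ballI less_imp_le[OF \<sigma>0]) simp
    moreover have "0 \<le> exp 1 * (8 * Suc L * card ?I * (exp 1 * F')) / card ?I"
      using F'0 by (intro divide_nonneg_nonneg mult_nonneg_nonneg) auto
    ultimately show ?thesis by (intro * exp_ge_zero)
  qed
  finally have "1 / 2 \<le> ((\<Prod>i<r. noise_var \<rho> i) ^ n * exp (real r * (5 + 2 * 4 ^ r * real r) * B))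
     * (exp (128 * Suc L * card ?I) ^ Suc L * (exp 1 * (8 * Suc L * card ?I * (exp 1 * F')) / card ?I) ^ card ?I)"
    unfolding ennreal_le_iff2 by linarith
  then show ?thesis by (simp only: B_def card_lessThan of_nat_mult of_nat_numeral)
qed

text \<open>A smaller distortion would turn the decoupled inequality into
  \<open>1 / 2 \<le> X ^ m\<close> with \<open>X \<le> 1 / 4\<close>. \<open>Q\<close> collects the
  exponents per source symbol: the cost of the received block, of order \<open>n + m\<close> and
  hence at most \<open>b + 1\<close> per symbol; \<open>L + 1\<close> looks at
  \<open>128 * (L + 1)\<close> each; and two factors \<open>exp 1\<close>, from the ball volume and
  from the disc average. The 32 is 4 times the 8 in the error radius.\<close>

lemma (in elimination) channel_distortion_ge:
  fixes enc :: "(nat \<Rightarrow> complex) \<Rightarrow> nat \<times> nat \<Rightarrow> complex" and m n L :: nat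
  assumes m: "0 < m" and L: "0 < L" and \<rho>s: "0 < \<rho>s" and nb: "real n \<le> b * real m"
    and \<rho>: "\<And>p. p \<le> Suc k \<Longrightarrow> 1 \<le> \<rho> * (\<epsilon> p)\<^sup>2"
    and encm: "\<And>t i. (\<lambda>S. enc S (t, i)) \<in> borel_measurable (leb {..<m})"
    and pow: "(\<integral>\<^sup>+S. ennreal (\<Sum>i<n. \<Sum>t<c. (cmod (enc S (t, i)))\<^sup>2) \<partial>cnp {..<m}) \<le> ennreal (real n * real c)"
    and estm: "\<And>g i. i \<in> {..<m} \<Longrightarrow> (\<lambda>(y, v). est g y v i) \<in> borel_measurable (leb ({..<r} \<times> {..<n}) \<Otimes>\<^sub>M leb {..<m})"
  defines "Q \<equiv> 64 * (real r * (5 + 2 * 4 ^ r * real r) * (real c + real r)) * (b + 1) + 128 * (real (Suc L))\<^sup>2 + 2"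
  shows "ennreal (min (1 / (exp 1 * (max \<rho>s 1 powr (1 / L) * max \<rho>s 1)))
       (1 / (32 * real (Suc L) * exp Q) * (\<Prod>i<r. noise_var \<rho> i) powr (- b)))
    \<le> (\<integral>\<^sup>+g. noise_form ({..<r} \<times> {..<n}) {..<m} (\<lambda>s. chan_mean c \<rho> H (enc s))
       (complex_of_real (sqrt \<rho>s) * g) (est g) \<partial>CN)"
proof (rule ccontr)
  let ?E = "exp 1 * (max \<rho>s 1 powr (1 / L) * max \<rho>s 1)"
  let ?V = "\<Prod>i<r. noise_var \<rho> i"
  let ?C = "32 * real (Suc L) * exp Q"
  define F' where "F' = min (1 / ?E) (1 / ?C * ?V powr (- b))"
  assume "\<not> ?thesis"
  then have F: "(\<integral>\<^sup>+g. noise_form ({..<r} \<times> {..<n}) {..<m} (\<lambda>s. chan_mean c \<rho> H (enc s))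
       (complex_of_real (sqrt \<rho>s) * g) (est g) \<partial>CN) < ennreal F'"
    by (simp add: F'_def)
  have E0: "0 < ?E" by (intro mult_pos_pos) auto
  have V1: "1 \<le> ?V" by (intro prod_ge_1 \<rho>) auto
  have F'E: "F' * ?E \<le> 1"
  proof -
    have "F' * ?E \<le> 1 / ?E * ?E" by (intro mult_right_mono less_imp_le[OF E0]) (simp add: F'_def)
    moreover have "1 / x * x = 1" if "0 < x" for x :: real using that by simp
    ultimately show ?thesis using E0 by (simp only:)
  qed
  have F'0: "0 < F'" using F by (metis ennreal_neg linorder_not_le not_less_zero)
  have b0: "0 \<le> b"
  proof (rule ccontr)
    assume "\<not> 0 \<le> b"
    then have "b * real m < 0" using m by (simp add: mult_neg_pos)
    then show False using nb by linarith
  qed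
  let ?K = "real r * (5 + 2 * 4 ^ r * real r)"
  let ?X = "?V powr b * exp Q * (8 * real (Suc L) * F')"
  have "?X \<le> 1 / 4"
  proof -
    have "F' \<le> 1 / ?C * ?V powr (- b)" by (simp add: F'_def)
    then have "?X \<le> ?V powr b * exp Q * (8 * real (Suc L) * (1 / ?C * ?V powr (- b)))"
      by (intro mult_left_mono) auto
    also have "\<dots> = (?V powr b * ?V powr (- b)) * (exp Q * (8 * real (Suc L)) / ?C)" by simp
    also have "?V powr b * ?V powr (- b) = 1"
    proof -
      have "v powr b * v powr (- b) = 1" if "1 \<le> v" for v :: real
        using that by (simp add: powr_add[symmetric])
      from this[OF V1] show ?thesis .
    qed
    also have "1 * (exp Q * (8 * real (Suc L)) / ?C) = 1 / 4" by simp
    finally show ?thesis .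
  qed
  have "1 / 2 \<le> ?V ^ n * exp (?K * (64 * (real c + real r) * (real n + real m)))
     * (exp (128 * real (Suc L) * real m) ^ Suc L * (exp 1 * (8 * real (Suc L) * real m * (exp 1 * F')) / real m) ^ m)"
    by (rule half_le_decoupled_channel[OF m L \<rho>s \<rho> encm pow estm F F'E])
  also have "\<dots> \<le> (?V powr b) ^ m * exp (64 * (?K * (real c + real r)) * (b + 1)) ^ m
     * (exp (128 * (real (Suc L))\<^sup>2) ^ m * (exp 2 * (8 * real (Suc L) * F')) ^ m)"
  proof (intro mult_mono)
    \<comment> \<open>As the base is at least 1, the exponent \<open>n\<close> may be enlarged to
      the real number \<open>b * m\<close>.\<close>
    have "v ^ n \<le> (v powr b) ^ m" if "1 \<le> v" for v :: real
    proof -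
      have "v ^ n = v powr real n" using that by (simp add: powr_realpow)
      also have "\<dots> \<le> v powr (b * real m)" using that nb by (intro powr_mono) auto
      also have "\<dots> = (v powr b) ^ m" using that by (simp add: powr_powr[symmetric] powr_realpow)
      finally show ?thesis .
    qed
    from this[OF V1] show "?V ^ n \<le> (?V powr b) ^ m" .
    have "?K * (64 * (real c + real r) * (real n + real m)) \<le> ?K * (64 * (real c + real r) * ((b + 1) * real m))"
      using nb by (intro mult_left_mono) (auto simp: algebra_simps)
    then show "exp (?K * (64 * (real c + real r) * (real n + real m))) \<le> exp (64 * (?K * (real c + real r)) * (b + 1)) ^ m"
      by (simp add: exp_of_nat_mult[symmetric] algebra_simps)
    show "exp (128 * real (Suc L) * real m) ^ Suc L \<le> exp (128 * (real (Suc L))\<^sup>2) ^ m"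
      by (simp only: exp_of_nat_mult[symmetric]) (simp add: power2_eq_square mult_ac)
    have "exp 1 * (8 * real (Suc L) * real m * (exp 1 * F')) / real m = (exp 1 * exp 1) * (8 * real (Suc L) * F')"
      using m by simp
    also have "exp 1 * exp 1 = (exp 2 :: real)" by (simp add: exp_add[symmetric])
    finally show "(exp 1 * (8 * real (Suc L) * real m * (exp 1 * F')) / real m) ^ m \<le> (exp 2 * (8 * real (Suc L) * F')) ^ m"
      by simp
  qed (use F'0 V1 in \<open>auto intro!: mult_nonneg_nonneg zero_le_power divide_nonneg_nonneg\<close>)
  also have "\<dots> = ?X ^ m"
    by (simp add: Q_def exp_add power_mult_distrib mult_ac)
  also have "\<dots> \<le> (1 / 4) ^ m"
    using \<open>?X \<le> 1 / 4\<close> F'0 by (intro power_mono) auto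
  also have "\<dots> \<le> (1 / 4) ^ 1" using m by (intro power_decreasing) auto
  finally show False by simp
qed

section \<open>From the coding model to fixed channels and gains\<close>

definition pad :: "'i set \<Rightarrow> ('i \<Rightarrow> complex) \<Rightarrow> 'i \<Rightarrow> complex" where
  "pad I v = (\<lambda>i. if i \<in> I then v i else 0)"

text \<open>The observations of the model vanish off their index sets, whereas points of a product
  space are \<open>undefined\<close> there. \<open>pad\<close> translates between the conventions,
  so that the decoder becomes a function of the density variables.\<close>

lemma estimate_eq:
  "estimate Mt Mr m n \<rho> \<rho>s enc dec (S, H, g, N, Z)
    = dec (pad ({..<Mr} \<times> {..<n}) (\<lambda>j\<in>{..<Mr} \<times> {..<n}. chan_mean Mt \<rho> H (enc S) j + N j))
        (pad {..<m} (\<lambda>i\<in>{..<m}. complex_of_real (sqrt \<rho>s) * g * S i + Z i)) H ((cmod g)\<^sup>2)"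
proof -
  have "chan_out Mt Mr n \<rho> (enc S) H N
      = pad ({..<Mr} \<times> {..<n}) (\<lambda>j\<in>{..<Mr} \<times> {..<n}. chan_mean Mt \<rho> H (enc S) j + N j)"
    by (auto simp: chan_out_def pad_def chan_mean_def fun_eq_iff)
  moreover have "side_out m \<rho>s g S Z = pad {..<m} (\<lambda>i\<in>{..<m}. complex_of_real (sqrt \<rho>s) * g * S i + Z i)"
    by (auto simp: side_out_def pad_def fun_eq_iff)
  ultimately show ?thesis by (simp add: estimate_def)
qed

text \<open>Only the composite estimate is assumed measurable. Freezing the source at zero turns the
  dependence on the noises into one on the observations, so each section of the decoder is
  measurable as well.\<close>

lemma decoder_section_measurable:
  assumes dec: "adm_dec Mt Mr m n \<rho> \<rho>s enc dec" and H: "H \<in> space (mat_meas Mr Mt)" and i: "i < m"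
  shows "(\<lambda>(y, v). dec (pad ({..<Mr} \<times> {..<n}) y) (pad {..<m} v) H ((cmod g)\<^sup>2) i)
    \<in> borel_measurable (leb ({..<Mr} \<times> {..<n}) \<Otimes>\<^sub>M leb {..<m})"
proof -
  let ?J = "{..<Mr} \<times> {..<n}" and ?I = "{..<m}"
  let ?S = "\<lambda>i\<in>?I. 0 :: complex"
  let ?c = "chan_mean Mt \<rho> H (enc ?S)"
  let ?\<phi> = "\<lambda>p. (?S, H, g, (\<lambda>j\<in>?J. fst p j - ?c j), (\<lambda>i\<in>?I. snd p i))"
  have S: "?S \<in> space (src_meas m)" by (simp add: src_meas_def space_PiM)
  have \<phi>: "?\<phi> \<in> leb ?J \<Otimes>\<^sub>M leb ?I \<rightarrow>\<^sub>M omega Mt Mr m n"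
    unfolding omega_def
  proof (intro measurable_Pair measurable_const)
    have "(\<lambda>p. \<lambda>j\<in>?J. fst p j - ?c j) \<in> leb ?J \<Otimes>\<^sub>M leb ?I \<rightarrow>\<^sub>M leb ?J" by measurable
    then show "(\<lambda>p. \<lambda>j\<in>?J. fst p j - ?c j) \<in> leb ?J \<Otimes>\<^sub>M leb ?I \<rightarrow>\<^sub>M mat_meas Mr n"
      unfolding mat_meas_def by (simp only: measurable_cong_sets[OF refl sets_cnp_leb])
    have "(\<lambda>p. \<lambda>i\<in>?I. snd p i) \<in> leb ?J \<Otimes>\<^sub>M leb ?I \<rightarrow>\<^sub>M leb ?I" by measurable
    then show "(\<lambda>p. \<lambda>i\<in>?I. snd p i) \<in> leb ?J \<Otimes>\<^sub>M leb ?I \<rightarrow>\<^sub>M src_meas m"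
      unfolding src_meas_def by (simp only: measurable_cong_sets[OF refl sets_cnp_leb])
  qed (use S H in auto)
  have "(\<lambda>\<omega>. estimate Mt Mr m n \<rho> \<rho>s enc dec \<omega> i) \<in> borel_measurable (omega Mt Mr m n)"
    using dec i by (simp add: adm_dec_def)
  from measurable_compose[OF \<phi> this]
  have "(\<lambda>p. estimate Mt Mr m n \<rho> \<rho>s enc dec (?\<phi> p) i) \<in> borel_measurable (leb ?J \<Otimes>\<^sub>M leb ?I)" .
  moreover have "estimate Mt Mr m n \<rho> \<rho>s enc dec (?\<phi> p) i
      = dec (pad ?J (fst p)) (pad ?I (snd p)) H ((cmod g)\<^sup>2) i" for p
  proof -
    have "pad ?J (\<lambda>j\<in>?J. ?c j + (\<lambda>j\<in>?J. fst p j - ?c j) j) = pad ?J (fst p)"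
      by (auto simp: pad_def fun_eq_iff)
    moreover have "pad ?I (\<lambda>i\<in>?I. complex_of_real (sqrt \<rho>s) * g * ?S i + (\<lambda>i\<in>?I. snd p i) i) = pad ?I (snd p)"
      by (auto simp: pad_def fun_eq_iff)
    ultimately show ?thesis by (simp only: estimate_eq)
  qed
  ultimately show ?thesis by (simp add: case_prod_unfold)
qed

text \<open>Tonelli. In \<open>omega\<close> the source is outermost, but the lower bound is proved
  for each fixed channel, with an average over the gain, so these two have to be moved
  outside.\<close>

lemma exp_dist_eq:
  assumes dec: "adm_dec Mt Mr m n \<rho> \<rho>s enc dec"
  shows "exp_dist Mt Mr m n \<rho> \<rho>s enc dec
    = (\<integral>\<^sup>+H. \<integral>\<^sup>+g. noise_form ({..<Mr} \<times> {..<n}) {..<m} (\<lambda>s. chan_mean Mt \<rho> H (enc s))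
         (complex_of_real (sqrt \<rho>s) * g)
         (\<lambda>y v. dec (pad ({..<Mr} \<times> {..<n}) y) (pad {..<m} v) H ((cmod g)\<^sup>2)) \<partial>CN \<partial>mat_meas Mr Mt)"
proof -
  let ?f = "\<lambda>\<omega>. ennreal ((1 / real m) * (\<Sum>j<m. (cmod (fst \<omega> j - estimate Mt Mr m n \<rho> \<rho>s enc dec \<omega> j))\<^sup>2))"
  let ?S = "src_meas m" and ?H = "mat_meas Mr Mt" and ?N = "mat_meas Mr n"
  interpret S: prob_space ?S unfolding src_meas_def by (rule prob_space_cnp)
  interpret H: prob_space ?H unfolding mat_meas_def by (rule prob_space_cnp)
  interpret N: prob_space ?N unfolding mat_meas_def by (rule prob_space_cnp)
  interpret NZ: pair_prob_space ?N ?S ..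
  interpret gNZ: pair_prob_space CN "?N \<Otimes>\<^sub>M ?S" ..
  interpret HgNZ: pair_prob_space ?H "CN \<Otimes>\<^sub>M (?N \<Otimes>\<^sub>M ?S)" ..
  interpret SH: pair_prob_space ?S ?H ..
  interpret Sg: pair_prob_space ?S CN ..
  have f: "?f \<in> borel_measurable (omega Mt Mr m n)"
  proof -
    have est: "(\<lambda>\<omega>. estimate Mt Mr m n \<rho> \<rho>s enc dec \<omega> j) \<in> borel_measurable (omega Mt Mr m n)" if "j < m" for j
      using dec that by (simp add: adm_dec_def)
    have S: "(\<lambda>\<omega>. fst \<omega> j) \<in> borel_measurable (omega Mt Mr m n)" if "j < m" for j
    proof -
      have "(\<lambda>s. s j) \<in> borel_measurable ?S"
        unfolding src_meas_def measurable_cnp_leb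
        using measurable_component_singleton[of j "{..<m}" "\<lambda>_. lborel :: complex measure"] that by simp
      then show ?thesis unfolding omega_def by (rule measurable_compose[OF measurable_fst])
    qed
    have "(\<lambda>\<omega>. (cmod (fst \<omega> j - estimate Mt Mr m n \<rho> \<rho>s enc dec \<omega> j))\<^sup>2) \<in> borel_measurable (omega Mt Mr m n)"
      if "j \<in> {..<m}" for j
      using that by (intro borel_measurable_power measurable_compose[OF borel_measurable_diff borel_measurable_norm] est S) auto
    then have "(\<lambda>\<omega>. \<Sum>j<m. (cmod (fst \<omega> j - estimate Mt Mr m n \<rho> \<rho>s enc dec \<omega> j))\<^sup>2) \<in> borel_measurable (omega Mt Mr m n)"
      by (rule borel_measurable_sum)
    then show ?thesis by measurable
  qed
  note f' = f[unfolded omega_def]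
  have f2: "(\<lambda>p. ?f (fst (fst p), snd (fst p), snd p)) \<in> borel_measurable ((?S \<Otimes>\<^sub>M ?H) \<Otimes>\<^sub>M (CN \<Otimes>\<^sub>M (?N \<Otimes>\<^sub>M ?S)))"
    by (rule measurable_compose[OF _ f']) measurable
  have f3: "(\<lambda>p. ?f (fst (fst p), h, snd (fst p), snd p)) \<in> borel_measurable ((?S \<Otimes>\<^sub>M CN) \<Otimes>\<^sub>M (?N \<Otimes>\<^sub>M ?S))"
    if "h \<in> space ?H" for h
    by (rule measurable_compose[OF _ f']) (use that in measurable)
  have "exp_dist Mt Mr m n \<rho> \<rho>s enc dec = (\<integral>\<^sup>+s. \<integral>\<^sup>+q. ?f (s, q) \<partial>(?H \<Otimes>\<^sub>M (CN \<Otimes>\<^sub>M (?N \<Otimes>\<^sub>M ?S))) \<partial>?S)"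
    unfolding exp_dist_def omega_def by (rule HgNZ.nn_integral_fst[OF f', symmetric])
  also have "\<dots> = (\<integral>\<^sup>+s. \<integral>\<^sup>+h. \<integral>\<^sup>+q. ?f (s, h, q) \<partial>(CN \<Otimes>\<^sub>M (?N \<Otimes>\<^sub>M ?S)) \<partial>?H \<partial>?S)"
  proof (rule nn_integral_cong)
    fix s assume "s \<in> space ?S"
    from measurable_Pair2[OF f' this]
    show "(\<integral>\<^sup>+q. ?f (s, q) \<partial>(?H \<Otimes>\<^sub>M (CN \<Otimes>\<^sub>M (?N \<Otimes>\<^sub>M ?S)))) = (\<integral>\<^sup>+h. \<integral>\<^sup>+q. ?f (s, h, q) \<partial>(CN \<Otimes>\<^sub>M (?N \<Otimes>\<^sub>M ?S)) \<partial>?H)"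
      by (rule gNZ.nn_integral_fst[symmetric])
  qed
  also have "\<dots> = (\<integral>\<^sup>+h. \<integral>\<^sup>+s. \<integral>\<^sup>+q. ?f (s, h, q) \<partial>(CN \<Otimes>\<^sub>M (?N \<Otimes>\<^sub>M ?S)) \<partial>?S \<partial>?H)"
  proof (rule SH.Fubini'[symmetric])
    from gNZ.borel_measurable_nn_integral_fst[OF f2]
    show "(\<lambda>(s, h). \<integral>\<^sup>+q. ?f (s, h, q) \<partial>(CN \<Otimes>\<^sub>M (?N \<Otimes>\<^sub>M ?S))) \<in> borel_measurable (?S \<Otimes>\<^sub>M ?H)"
      by (simp add: case_prod_unfold)
  qed
  also have "\<dots> = (\<integral>\<^sup>+h. \<integral>\<^sup>+g. noise_form ({..<Mr} \<times> {..<n}) {..<m} (\<lambda>s. chan_mean Mt \<rho> h (enc s))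
         (complex_of_real (sqrt \<rho>s) * g)
         (\<lambda>y v. dec (pad ({..<Mr} \<times> {..<n}) y) (pad {..<m} v) h ((cmod g)\<^sup>2)) \<partial>CN \<partial>?H)"
  proof (rule nn_integral_cong)
    fix h assume h: "h \<in> space ?H"
    have f4: "(\<lambda>q. ?f (s, h, q)) \<in> borel_measurable (CN \<Otimes>\<^sub>M (?N \<Otimes>\<^sub>M ?S))" if "s \<in> space ?S" for s
      using measurable_Pair2[OF measurable_Pair2[OF f' that] h] .
    have "(\<integral>\<^sup>+s. \<integral>\<^sup>+q. ?f (s, h, q) \<partial>(CN \<Otimes>\<^sub>M (?N \<Otimes>\<^sub>M ?S)) \<partial>?S)
       = (\<integral>\<^sup>+s. \<integral>\<^sup>+g. \<integral>\<^sup>+q. ?f (s, h, g, q) \<partial>(?N \<Otimes>\<^sub>M ?S) \<partial>CN \<partial>?S)"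
      by (rule nn_integral_cong) (rule NZ.nn_integral_fst[OF f4, symmetric])
    also have "\<dots> = (\<integral>\<^sup>+g. \<integral>\<^sup>+s. \<integral>\<^sup>+q. ?f (s, h, g, q) \<partial>(?N \<Otimes>\<^sub>M ?S) \<partial>?S \<partial>CN)"
    proof (rule Sg.Fubini'[symmetric])
      from NZ.borel_measurable_nn_integral_fst[OF f3[OF h]]
      show "(\<lambda>(s, g). \<integral>\<^sup>+q. ?f (s, h, g, q) \<partial>(?N \<Otimes>\<^sub>M ?S)) \<in> borel_measurable (?S \<Otimes>\<^sub>M CN)"
        by (simp add: case_prod_unfold)
    qed
    also have "\<dots> = (\<integral>\<^sup>+g. \<integral>\<^sup>+s. \<integral>\<^sup>+w. \<integral>\<^sup>+z. ?f (s, h, g, w, z) \<partial>?S \<partial>?N \<partial>?S \<partial>CN)"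
    proof (intro nn_integral_cong)
      fix g s assume s: "s \<in> space ?S"
      have "(\<lambda>q. ?f (s, h, g, q)) \<in> borel_measurable (?N \<Otimes>\<^sub>M ?S)"
        using measurable_Pair2[OF f4[OF s], of g] by simp
      then show "(\<integral>\<^sup>+q. ?f (s, h, g, q) \<partial>(?N \<Otimes>\<^sub>M ?S)) = (\<integral>\<^sup>+w. \<integral>\<^sup>+z. ?f (s, h, g, w, z) \<partial>?S \<partial>?N)"
        by (rule S.nn_integral_fst[symmetric])
    qed
    also have "\<dots> = (\<integral>\<^sup>+g. noise_form ({..<Mr} \<times> {..<n}) {..<m} (\<lambda>s. chan_mean Mt \<rho> h (enc s))
         (complex_of_real (sqrt \<rho>s) * g)
         (\<lambda>y v. dec (pad ({..<Mr} \<times> {..<n}) y) (pad {..<m} v) h ((cmod g)\<^sup>2)) \<partial>CN)"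
      unfolding noise_form_def src_meas_def mat_meas_def by (simp only: estimate_eq fst_conv card_lessThan)
    finally show "(\<integral>\<^sup>+s. \<integral>\<^sup>+q. ?f (s, h, q) \<partial>(CN \<Otimes>\<^sub>M (?N \<Otimes>\<^sub>M ?S)) \<partial>?S)
      = (\<integral>\<^sup>+g. noise_form ({..<Mr} \<times> {..<n}) {..<m} (\<lambda>s. chan_mean Mt \<rho> h (enc s))
         (complex_of_real (sqrt \<rho>s) * g)
         (\<lambda>y v. dec (pad ({..<Mr} \<times> {..<n}) y) (pad {..<m} v) h ((cmod g)\<^sup>2)) \<partial>CN)" .
  qed
  finally show ?thesis .
qed

section \<open>Exponents\<close>

lemma sum_ge_indicator: "(\<Sum>i<r. if a \<le> i then 1 else 0 :: real) = real (r - a)"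
  by (induction r) (auto simp: Suc_diff_le)

lemma sum_ge_indicator2:
  "(\<Sum>i<r. \<Sum>t<c. if a \<le> i \<and> a \<le> t then 1 else 0 :: real) = real (r - a) * real (c - a)"
proof -
  have "(\<Sum>i<r. \<Sum>t<c. if a \<le> i \<and> a \<le> t then 1 else 0 :: real)
      = (\<Sum>i<r. (if a \<le> i then 1 else 0) * (\<Sum>t<c. if a \<le> t then 1 else 0))"
    by (intro sum.cong) auto
  then show ?thesis by (simp add: sum_ge_indicator sum_distrib_right[symmetric])
qed

text \<open>Minus the exponent of the squared pivot sizes as powers of \<rho>: \<open>k\<close>
  pivots of order 1, one intermediate pivot, and a remainder that leaves the signal at noise level.
  The complement \<open>1 - weight\<close> summed over the rows gives the multiplexing gain;
  \<open>weight\<close> summed over the entries gives the diversity.\<close>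

definition weight :: "nat \<Rightarrow> real \<Rightarrow> nat \<Rightarrow> real" where
  "weight k f p = (if p < k then 0 else if p = k then 1 - f else 1)"

lemma sum_weight_rows:
  assumes "k < r"
  shows "(\<Sum>i<r. 1 - weight k f (min i (Suc k))) = real k + f"
proof -
  have "1 - weight k f (min i (Suc k)) = 1 - (1 - f) * (if k \<le> i then 1 else 0) - f * (if Suc k \<le> i then 1 else 0)" for i
    by (auto simp: weight_def)
  then have "(\<Sum>i<r. 1 - weight k f (min i (Suc k)))
      = real r - (1 - f) * (\<Sum>i<r. if k \<le> i then 1 else 0) - f * (\<Sum>i<r. if Suc k \<le> i then 1 else 0)"
    by (simp only: sum_subtractf sum_distrib_left) simp
  also have "\<dots> = real r - (1 - f) * (real r - real k) - f * (real r - real k - 1)"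
    unfolding sum_ge_indicator using assms by (simp add: of_nat_diff)
  also have "\<dots> = real k + f" by (simp add: algebra_simps)
  finally show ?thesis .
qed

text \<open>The weights are a mixture, with coefficients \<open>1 - f\<close> and \<open>f\<close>,
  of the indicators of the blocks left after \<open>k\<close> and \<open>k + 1\<close> pivots. The
  sum interpolates linearly between the block sizes, which is one segment of the tradeoff
  curve.\<close>

lemma sum_weight_entries:
  assumes "k < Mt" "k < Mr"
  shows "(\<Sum>(i, t)\<in>{..<Mr} \<times> {..<Mt}. weight k f (min (min i t) (Suc k))) = Phi Mt Mr k - Ups Mt Mr k * f"
proof -
  have "weight k f (min (min i t) (Suc k)) = (1 - f) * (if k \<le> i \<and> k \<le> t then 1 else 0)
      + f * (if Suc k \<le> i \<and> Suc k \<le> t then 1 else 0)" for i t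
    by (auto simp: weight_def min_def)
  then have "(\<Sum>(i, t)\<in>{..<Mr} \<times> {..<Mt}. weight k f (min (min i t) (Suc k)))
     = (1 - f) * (\<Sum>i<Mr. \<Sum>t<Mt. if k \<le> i \<and> k \<le> t then 1 else 0)
     + f * (\<Sum>i<Mr. \<Sum>t<Mt. if Suc k \<le> i \<and> Suc k \<le> t then 1 else 0)"
    by (simp only: sum.cartesian_product[symmetric] sum.distrib sum_distrib_left)
  also have "\<dots> = (1 - f) * ((real Mr - k) * (real Mt - k)) + f * ((real Mr - k - 1) * (real Mt - k - 1))"
    unfolding sum_ge_indicator2 using assms by (simp add: of_nat_diff diff_diff_eq add.commute)
  also have "\<dots> = (real Mt - k) * (real Mr - k) - (real Mt + real Mr - 2 * real k - 1) * f"
    by (simp add: algebra_simps)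
  also have "\<dots> = Phi Mt Mr k - Ups Mt Mr k * f"
    by (cases "Mt \<le> Mr") (simp_all add: Phi_def Ups_def Mmax_def Mmin_def max_def min_def mult.commute add.commute)
  finally show ?thesis .
qed

definition level :: "real \<Rightarrow> nat \<Rightarrow> real \<Rightarrow> nat \<Rightarrow> real" where
  "level \<rho> k f p = \<rho> powr (- weight k f p / 2)"

lemma level_square:
  assumes "1 \<le> \<rho>"
  shows "(level \<rho> k f p)\<^sup>2 = \<rho> powr (- weight k f p)"
  by (simp add: level_def power2_eq_square powr_add[symmetric])

lemma level_scaled:
  assumes "1 \<le> \<rho>"
  shows "\<rho> * (level \<rho> k f p)\<^sup>2 = \<rho> powr (1 - weight k f p)"
proof -
  have "\<rho> powr (1 - weight k f p) = \<rho> powr 1 * \<rho> powr (- weight k f p)"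
    by (simp only: powr_add[symmetric] add_uminus_conv_diff)
  then show ?thesis using assms by (simp add: level_square)
qed

text \<open>Distortion on nearly singular channels times the probability of such channels. The bound
  does not depend on the block lengths, so it survives the infimum over \<open>n\<close> and the
  liminf over \<open>m\<close>.\<close>

lemma ED_opt_ge:
  fixes Mt Mr k L :: nat and f b \<rho> \<rho>s :: real
  assumes k: "k < Mt" "k < Mr" and f: "0 \<le> f" "f \<le> 1" and b: "0 < b" and \<rho>: "1 \<le> \<rho>"
    and \<rho>s: "0 < \<rho>s" and L: "0 < L"
  defines "Q \<equiv> 64 * (real Mr * (5 + 2 * 4 ^ Mr * real Mr) * (real Mt + real Mr)) * (b + 1) + 128 * (real (Suc L))\<^sup>2 + 2"
  shows "ennreal (min (1 / (exp 1 * (max \<rho>s 1 powr (1 / L) * max \<rho>s 1)))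
        (1 / (32 * real (Suc L) * exp Q) * \<rho> powr (- (b * (real k + f))))
      * ((exp (- (2 * real (k + 2))\<^sup>2) / 4) ^ (Mr * Mt) * \<rho> powr (- (Phi Mt Mr k - Ups Mt Mr k * f))))
    \<le> ED_opt Mt Mr \<rho> \<rho>s b"
proof -
  define \<epsilon> where "\<epsilon> = level \<rho> k f"
  have \<epsilon>0: "0 < \<epsilon> p" for p using \<rho> by (simp add: \<epsilon>_def level_def)
  have w: "0 \<le> weight k f p" "weight k f p \<le> 1" for p using f by (auto simp: weight_def)
  have \<epsilon>1: "\<epsilon> p \<le> 1" for p
    using powr_mono[of "- weight k f p / 2" 0 \<rho>] w[of p] \<rho> by (simp add: \<epsilon>_def level_def)
  have \<rho>\<epsilon>: "1 \<le> \<rho> * (\<epsilon> p)\<^sup>2" for p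
    unfolding \<epsilon>_def level_scaled[OF \<rho>] using w(2)[of p] \<rho> by (simp add: ge_one_powr_ge_zero)
  have rows: "(\<Prod>i<Mr. \<rho> * (\<epsilon> (min i (Suc k)))\<^sup>2) = \<rho> powr (real k + f)"
    unfolding \<epsilon>_def level_scaled[OF \<rho>] sum_weight_rows[OF k(2), symmetric]
    using \<rho> by (intro powr_sum[symmetric]) auto
  let ?J = "{..<Mr} \<times> {..<Mt}"
  let ?C = "exp (- (2 * real (k + 2))\<^sup>2) / 4 :: real"
  have entries: "(\<Prod>(i, t)\<in>?J. ?C * (\<epsilon> (min (min i t) (Suc k)))\<^sup>2)
      = ?C ^ (Mr * Mt) * \<rho> powr (- (Phi Mt Mr k - Ups Mt Mr k * f))"
  proof -
    have "(\<Prod>(i, t)\<in>?J. ?C * (\<epsilon> (min (min i t) (Suc k)))\<^sup>2)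
        = (\<Prod>j\<in>?J. ?C) * (\<Prod>j\<in>?J. \<rho> powr (- weight k f (min (min (fst j) (snd j)) (Suc k))))"
      by (simp only: \<epsilon>_def level_square[OF \<rho>] case_prod_unfold prod.distrib)
    also have "(\<Prod>j\<in>?J. ?C) = ?C ^ (Mr * Mt)" by (simp only: prod_constant card_cartesian_product card_lessThan)
    also have "(\<Prod>j\<in>?J. \<rho> powr (- weight k f (min (min (fst j) (snd j)) (Suc k))))
      = \<rho> powr (\<Sum>j\<in>?J. - weight k f (min (min (fst j) (snd j)) (Suc k)))"
      using \<rho> by (intro powr_sum[symmetric]) auto
    also have "(\<Sum>j\<in>?J. - weight k f (min (min (fst j) (snd j)) (Suc k))) = - (Phi Mt Mr k - Ups Mt Mr k * f)"
      by (simp only: sum_negf sum_weight_entries[OF k, symmetric] case_prod_unfold)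
    finally show ?thesis .
  qed
  define X where "X = min (1 / (exp 1 * (max \<rho>s 1 powr (1 / L) * max \<rho>s 1)))
        (1 / (32 * real (Suc L) * exp Q) * \<rho> powr (- (b * (real k + f))))"
  have X0: "0 \<le> X" by (simp add: X_def)
  define Y where "Y = ?C ^ (Mr * Mt) * \<rho> powr (- (Phi Mt Mr k - Ups Mt Mr k * f))"
  have Y0: "0 \<le> Y" by (simp add: Y_def)
  have block: "ennreal (X * Y) \<le> exp_dist Mt Mr m n \<rho> \<rho>s enc dec"
    if m: "0 < m" and n: "real n \<le> b * real m" and enc: "adm_enc Mt m n enc"
      and dec: "adm_dec Mt Mr m n \<rho> \<rho>s enc dec" for m n enc dec
  proof -
    have encm: "(\<lambda>S. enc S (t, i)) \<in> borel_measurable (leb {..<m})" for t i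
      using enc by (simp add: adm_enc_def src_meas_def measurable_cnp_leb)
    have pow: "(\<integral>\<^sup>+S. ennreal (\<Sum>i<n. \<Sum>t<Mt. (cmod (enc S (t, i)))\<^sup>2) \<partial>cnp {..<m}) \<le> ennreal (real n * real Mt)"
      using enc by (simp add: adm_enc_def src_meas_def)
    have "ennreal (X * Y) = ennreal X * ennreal Y" using X0 Y0 by (rule ennreal_mult)
    also have "\<dots> \<le> ennreal X * (\<integral>\<^sup>+H. (if nearly_singular Mr Mt k \<epsilon> H then 1 else 0) \<partial>cnp ?J)"
      using nearly_singular_prob_ge[where \<epsilon>=\<epsilon>, OF k(2,1) \<epsilon>0 \<epsilon>1] unfolding entries Y_def
      by (intro mult_left_mono) simp_all
    also have "\<dots> = (\<integral>\<^sup>+H. ennreal X * (if nearly_singular Mr Mt k \<epsilon> H then 1 else 0) \<partial>cnp ?J)"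
    proof (rule nn_integral_cmult[symmetric])
      note nearly_singular_measurable[OF k(2,1), measurable]
      show "(\<lambda>H. if nearly_singular Mr Mt k \<epsilon> H then 1 else 0 :: ennreal) \<in> borel_measurable (cnp ?J)"
        unfolding measurable_cnp_leb by measurable
    qed
    also have "\<dots> \<le> exp_dist Mt Mr m n \<rho> \<rho>s enc dec"
      unfolding exp_dist_eq[OF dec] mat_meas_def
    proof (rule nn_integral_mono)
      fix H assume H: "H \<in> space (cnp ?J)"
      show "ennreal X * (if nearly_singular Mr Mt k \<epsilon> H then 1 else 0)
        \<le> (\<integral>\<^sup>+g. noise_form ({..<Mr} \<times> {..<n}) {..<m} (\<lambda>s. chan_mean Mt \<rho> H (enc s))
         (complex_of_real (sqrt \<rho>s) * g)
         (\<lambda>y v. dec (pad ({..<Mr} \<times> {..<n}) y) (pad {..<m} v) H ((cmod g)\<^sup>2)) \<partial>CN)"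
      proof (cases "nearly_singular Mr Mt k \<epsilon> H")
        case True
        interpret elimination Mr Mt k \<epsilon> H
          by unfold_locales (use True k \<epsilon>0 \<epsilon>1 in auto)
        have XX: "X = min (1 / (exp 1 * (max \<rho>s 1 powr (1 / L) * max \<rho>s 1)))
          (1 / (32 * real (Suc L) * exp Q) * (\<Prod>i<Mr. noise_var \<rho> i) powr (- b))"
          unfolding X_def rows powr_powr by (simp add: mult.commute)
        have "ennreal X \<le> (\<integral>\<^sup>+g. noise_form ({..<Mr} \<times> {..<n}) {..<m} (\<lambda>s. chan_mean Mt \<rho> H (enc s))
         (complex_of_real (sqrt \<rho>s) * g)
         (\<lambda>y v. dec (pad ({..<Mr} \<times> {..<n}) y) (pad {..<m} v) H ((cmod g)\<^sup>2)) \<partial>CN)"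
          unfolding XX Q_def
          by (rule channel_distortion_ge[OF m L \<rho>s n \<rho>\<epsilon> encm pow,
                where est="\<lambda>g y v. dec (pad ({..<Mr} \<times> {..<n}) y) (pad {..<m} v) H ((cmod g)\<^sup>2)"])
             (rule decoder_section_measurable[OF dec], use H in \<open>auto simp: mat_meas_def\<close>)
        then show ?thesis using True by simp
      qed simp
    qed
    finally show ?thesis .
  qed
  have "ennreal (X * Y) \<le> ED_len Mt Mr \<rho> \<rho>s b m" if "0 < m" for m
    unfolding ED_len_def ED_block_def
    by (intro INF_greatest) (use block[OF that] in auto)
  then have "ennreal (X * Y) \<le> ED_opt Mt Mr \<rho> \<rho>s b"
    unfolding ED_opt_def by (intro Liminf_bounded eventually_sequentiallyI[of 1]) auto
  then show ?thesis by (simp add: X_def Y_def)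
qed

lemma log_max: "1 < a \<Longrightarrow> 0 < x \<Longrightarrow> 0 < y \<Longrightarrow> log a (max x y) = max (log a x) (log a y)"
  by (auto simp: max_def)

lemma neg_log_min:
  assumes "0 < x" "0 < y"
  shows "- log 2 (min x y) = max (- log 2 x) (- log 2 (y::real))"
  using assms by (auto simp: min_def max_def)

lemma exponent_le:
  fixes Mt Mr k :: nat and f b \<nu> :: real and \<rho>s :: "real \<Rightarrow> real"
  assumes k: "k < Mt" "k < Mr" and f: "0 \<le> f" "f \<le> 1" and b: "0 < b" and \<nu>: "0 \<le> \<nu>"
    and \<rho>s: "\<And>\<rho>. \<rho> > 0 \<Longrightarrow> \<rho>s \<rho> > 0"
    and lim: "((\<lambda>\<rho>. log 2 (\<rho>s \<rho>) / log 2 \<rho>) \<longlongrightarrow> \<nu>) at_top"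
  shows "Limsup at_top (\<lambda>\<rho>::real. ereal (- log 2 (enn2real (ED_opt Mt Mr \<rho> (\<rho>s \<rho>) b)) / log 2 \<rho>))
    \<le> ereal (Phi Mt Mr k - Ups Mt Mr k * f + max \<nu> (b * (real k + f)))"
proof -
  let ?d = "Phi Mt Mr k - Ups Mt Mr k * f"
  let ?X = "\<lambda>\<rho>. enn2real (ED_opt Mt Mr \<rho> (\<rho>s \<rho>) b)"
  let ?l = "\<lambda>\<rho>::real. log 2 \<rho>"
  have bound: "Limsup at_top (\<lambda>\<rho>::real. ereal (- log 2 (?X \<rho>) / ?l \<rho>))
      \<le> ereal (?d + max ((1 / real L + 1) * \<nu>) (b * (real k + f)))" if L: "0 < L" for L :: nat
  proof -
    define Q where "Q = 64 * (real Mr * (5 + 2 * 4 ^ Mr * real Mr) * (real Mt + real Mr)) * (b + 1) + 128 * (real (Suc L))\<^sup>2 + 2"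
    define A where "A = (exp (- (2 * real (k + 2))\<^sup>2) / 4 :: real) ^ (Mr * Mt)"
    define c where "c = 1 / (32 * real (Suc L) * exp Q)"
    define \<sigma> where "\<sigma> \<rho> = max (\<rho>s \<rho>) 1" for \<rho>
    define W where "W \<rho> = min (1 / (exp 1 * (\<sigma> \<rho> powr (1 / L) * \<sigma> \<rho>))) (c * \<rho> powr (- (b * (real k + f)))) * (A * \<rho> powr (- ?d))" for \<rho>
    have A: "0 < A" "A \<le> 1"
    proof -
      show "0 < A" by (simp add: A_def)
      have "exp (- (2 * real (k + 2))\<^sup>2) / 4 \<le> (1::real)"
        using exp_le_one_iff[of "- (2 * real (k + 2))\<^sup>2"] by (simp del: exp_le_one_iff)
      then show "A \<le> 1" unfolding A_def by (intro power_le_one) auto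
    qed
    have c: "0 < c" by (simp add: c_def)
    have \<sigma>: "1 \<le> \<sigma> \<rho>" for \<rho> by (simp add: \<sigma>_def)
    have W0: "0 < W \<rho>" if "1 < \<rho>" for \<rho>
    proof -
      have "0 < 1 / (exp 1 * (\<sigma> \<rho> powr (1 / L) * \<sigma> \<rho>))" using \<sigma>[of \<rho>] by (intro divide_pos_pos mult_pos_pos) auto
      moreover have "0 < c * \<rho> powr (- (b * (real k + f)))" using c that by simp
      ultimately show ?thesis using A that by (simp add: W_def)
    qed
    have W: "ennreal (W \<rho>) \<le> ED_opt Mt Mr \<rho> (\<rho>s \<rho>) b" if "1 < \<rho>" for \<rho>
      using ED_opt_ge[OF k f b, of \<rho> "\<rho>s \<rho>" L] that \<rho>s[of \<rho>] L
      unfolding W_def A_def c_def Q_def \<sigma>_def by simp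
    have logW: "- log 2 (W \<rho>) / ?l \<rho> = max (log 2 (exp 1) / ?l \<rho> + (1 / L + 1) * max (log 2 (\<rho>s \<rho>) / ?l \<rho>) 0)
        (- log 2 c / ?l \<rho> + b * (real k + f)) + (- log 2 A / ?l \<rho> + ?d)" if \<rho>: "1 < \<rho>" for \<rho>
    proof -
      have l: "0 < ?l \<rho>" using \<rho> by simp
      let ?s = "1 / (exp 1 * (\<sigma> \<rho> powr (1 / L) * \<sigma> \<rho>))" and ?t = "c * \<rho> powr (- (b * (real k + f)))"
      have s0: "0 < ?s" using \<sigma>[of \<rho>] by (intro divide_pos_pos mult_pos_pos) auto
      have t0: "0 < ?t" using c \<rho> by simp
      have log\<sigma>: "log 2 (\<sigma> \<rho>) = max (log 2 (\<rho>s \<rho>)) 0"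
        using \<rho>s[of \<rho>] \<rho> by (simp add: \<sigma>_def log_max)
      have mx: "max (log 2 (\<rho>s \<rho>) / ?l \<rho>) 0 = max (log 2 (\<rho>s \<rho>)) 0 / ?l \<rho>"
        using l by (simp add: max_divide_distrib_right)
      have "- log 2 ?s = log 2 (exp 1) + (1 / L + 1) * log 2 (\<sigma> \<rho>)"
        using \<sigma>[of \<rho>] by (simp add: log_divide log_mult log_powr algebra_simps)
      then have s: "- log 2 ?s / ?l \<rho> = log 2 (exp 1) / ?l \<rho> + (1 / L + 1) * max (log 2 (\<rho>s \<rho>) / ?l \<rho>) 0"
        unfolding log\<sigma> mx by (simp add: add_divide_distrib)
      have "- log 2 ?t = - log 2 c + b * (real k + f) * ?l \<rho>"
        using c \<rho> by (simp add: log_mult log_powr)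
      then have t: "- log 2 ?t / ?l \<rho> = - log 2 c / ?l \<rho> + b * (real k + f)"
        using l by (simp add: add_divide_distrib diff_divide_distrib)
      have "log 2 (W \<rho>) = log 2 (min ?s ?t) + (log 2 A - ?d * ?l \<rho>)"
      proof -
        have "log 2 (x * (A * \<rho> powr (- d))) = log 2 x + (log 2 A - d * ?l \<rho>)" if "0 < x" for x d :: real
          using that A \<rho> by (simp add: log_mult log_powr)
        from this[of "min ?s ?t" ?d] show ?thesis unfolding W_def using s0 t0 by simp
      qed
      then have "- log 2 (W \<rho>) = max (- log 2 ?s) (- log 2 ?t) + (- log 2 A + ?d * ?l \<rho>)"
        using neg_log_min[OF s0 t0] by linarith
      then have "- log 2 (W \<rho>) / ?l \<rho> = max (- log 2 ?s / ?l \<rho>) (- log 2 ?t / ?l \<rho>) + (- log 2 A / ?l \<rho> + ?d)"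
        using l by (simp add: add_divide_distrib diff_divide_distrib max_divide_distrib_right)
      then show ?thesis unfolding s t .
    qed
    have limW: "((\<lambda>\<rho>. max (log 2 (exp 1) / ?l \<rho> + (1 / L + 1) * max (log 2 (\<rho>s \<rho>) / ?l \<rho>) 0)
        (- log 2 c / ?l \<rho> + b * (real k + f)) + (- log 2 A / ?l \<rho> + ?d))
        \<longlongrightarrow> max (0 + (1 / L + 1) * max \<nu> 0) (0 + b * (real k + f)) + (0 + ?d)) at_top"
    proof -
      have z: "((\<lambda>\<rho>::real. a / log 2 \<rho>) \<longlongrightarrow> 0) at_top" for a :: real
      proof -
        have "((\<lambda>\<rho>::real. (a * ln 2) / ln \<rho>) \<longlongrightarrow> 0) at_top"
          by (rule real_tendsto_divide_at_top[OF tendsto_const ln_at_top])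
        then show ?thesis by (simp add: log_def)
      qed
      show ?thesis by (intro tendsto_intros z lim)
    qed
    have "Limsup at_top (\<lambda>\<rho>::real. ereal (- log 2 (?X \<rho>) / ?l \<rho>))
       \<le> Limsup at_top (\<lambda>\<rho>::real. ereal (max 0 (max (log 2 (exp 1) / ?l \<rho> + (1 / L + 1) * max (log 2 (\<rho>s \<rho>) / ?l \<rho>) 0)
        (- log 2 c / ?l \<rho> + b * (real k + f)) + (- log 2 A / ?l \<rho> + ?d))))"
    proof (rule Limsup_mono, rule eventually_mono[OF eventually_gt_at_top[of 1]])
      fix \<rho> :: real assume \<rho>: "1 < \<rho>"
      have l: "0 < ?l \<rho>" using \<rho> by simp
      \<comment> \<open>If \<open>ED_opt\<close> is infinite, \<open>enn2real\<close> sends it to 0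
        and \<open>log 2 0 = 0\<close>, so the quotient reads 0. Hence the maximum with 0, which
        disappears in the limit because the limiting exponent is nonnegative.\<close>
      have "- log 2 (?X \<rho>) / ?l \<rho> \<le> max 0 (- log 2 (W \<rho>) / ?l \<rho>)"
      proof (cases "ED_opt Mt Mr \<rho> (\<rho>s \<rho>) b = top")
        case True
        have "log 2 (0::real) = 0" by (simp add: log_def)
        then show ?thesis using True by simp
      next
        case False
        then have "W \<rho> \<le> ?X \<rho>"
          using enn2real_mono[OF W[OF \<rho>]] W0[OF \<rho>] by (simp add: less_top)
        then have "- log 2 (?X \<rho>) \<le> - log 2 (W \<rho>)" using W0[OF \<rho>] by simp
        then have "- log 2 (?X \<rho>) / ?l \<rho> \<le> - log 2 (W \<rho>) / ?l \<rho>" using l by (intro divide_right_mono) auto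
        then show ?thesis by linarith
      qed
      then show "ereal (- log 2 (?X \<rho>) / ?l \<rho>) \<le> ereal (max 0 (max (log 2 (exp 1) / ?l \<rho> + (1 / L + 1) * max (log 2 (\<rho>s \<rho>) / ?l \<rho>) 0)
        (- log 2 c / ?l \<rho> + b * (real k + f)) + (- log 2 A / ?l \<rho> + ?d)))"
        unfolding logW[OF \<rho>] ereal_less_eq(3) .
    qed
    also have "\<dots> = ereal (max 0 (max (0 + (1 / L + 1) * max \<nu> 0) (0 + b * (real k + f)) + (0 + ?d)))"
      by (intro lim_imp_Limsup tendsto_ereal tendsto_max tendsto_const limW) simp
    also have "max 0 (max (0 + (1 / L + 1) * max \<nu> 0) (0 + b * (real k + f)) + (0 + ?d))
       = ?d + max ((1 / real L + 1) * \<nu>) (b * (real k + f))"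
    proof -
      \<comment> \<open>A convex combination of the diversities at ranks \<open>k\<close> and
        \<open>k + 1\<close>, which exhibits its sign.\<close>
      have "?d = (real Mt - k) * (real Mr - k) * (1 - f) + f * ((real Mt - k - 1) * (real Mr - k - 1))"
        by (cases "Mt \<le> Mr") (simp_all add: Phi_def Ups_def Mmax_def Mmin_def max_def min_def algebra_simps)
      moreover have "0 \<le> (real Mt - k) * (real Mr - k) * (1 - f) + f * ((real Mt - k - 1) * (real Mr - k - 1))"
        using k f by (intro add_nonneg_nonneg mult_nonneg_nonneg) auto
      moreover have "0 \<le> (1 / real L + 1) * \<nu>" using \<nu> by simp
      ultimately have "0 \<le> ?d" "0 \<le> max ((1 / real L + 1) * \<nu>) (b * (real k + f))" by linarith+
      moreover have "max \<nu> 0 = \<nu>" using \<nu> by simp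
      ultimately show ?thesis by (simp only: add_0_left add.commute[of _ ?d])
    qed
    finally show ?thesis .
  qed
  have "(\<lambda>L. ereal (?d + max ((1 / real L + 1) * \<nu>) (b * (real k + f))))
      \<longlonglongrightarrow> ereal (?d + max ((0 + 1) * \<nu>) (b * (real k + f)))"
    by (intro tendsto_intros lim_1_over_n)
  then have "Limsup at_top (\<lambda>\<rho>::real. ereal (- log 2 (?X \<rho>) / ?l \<rho>))
      \<le> ereal (?d + max ((0 + 1) * \<nu>) (b * (real k + f)))"
    by (rule LIMSEQ_le_const) (use bound in \<open>auto intro!: exI[of _ 1]\<close>)
  then show ?thesis by simp
qed

section \<open>Choosing the rank in each branch of the bound\<close>

definition exponent_at :: "nat \<Rightarrow> nat \<Rightarrow> real \<Rightarrow> real \<Rightarrow> real \<Rightarrow> bool" where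
  "exponent_at Mt Mr b \<nu> \<Delta> \<longleftrightarrow> (\<exists>k f. k < min Mt Mr \<and> 0 \<le> f \<and> f \<le> 1 \<and>
     Phi Mt Mr k - Ups Mt Mr k * f + max \<nu> (b * (real k + f)) \<le> \<Delta>)"

text \<open>An integer rank is taken as the right end \<open>f = 1\<close> of the preceding segment;
  this way full rank, where no segment begins, is included.\<close>

lemma exponent_at_rank:
  assumes "j \<le> min Mt Mr" "1 \<le> j" "Phi Mt Mr j + max \<nu> (b * real j) \<le> \<Delta>"
  shows "exponent_at Mt Mr b \<nu> \<Delta>"
proof -
  have "Phi Mt Mr (j - 1) - Ups Mt Mr (j - 1) * 1 = Phi Mt Mr j"
    using assms(2) by (simp add: Phi_def Ups_def of_nat_diff algebra_simps)
  then show ?thesis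
    unfolding exponent_at_def using assms
    by (intro exI[of _ "j - 1"] exI[of _ 1]) (auto simp: of_nat_diff)
qed

text \<open>The rank \<open>\<nu> / b\<close> makes both arguments of the maximum equal to
  \<open>\<nu>\<close>. If it is at least the full rank, full rank itself has diversity 0 and leaves
  \<open>\<nu>\<close> as the maximum.\<close>

lemma exponent_at_dstar:
  assumes M: "1 \<le> Mt" "1 \<le> Mr" and b: "0 < b" and \<nu>: "0 \<le> \<nu>"
  shows "exponent_at Mt Mr b \<nu> (\<nu> + dstar Mt Mr (\<nu> / b))"
proof (cases "Mmin Mt Mr \<le> \<nu> / b")
  case True
  then have "b * real (min Mt Mr) \<le> \<nu>" using b by (simp add: Mmin_def pos_le_divide_eq mult.commute)
  moreover have "Phi Mt Mr (min Mt Mr) = 0" by (simp add: Phi_def Mmin_def)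
  ultimately show ?thesis
    using M True by (intro exponent_at_rank[of "min Mt Mr"]) (auto simp: dstar_def)
next
  case False
  let ?r = "\<nu> / b"
  define k where "k = nat \<lfloor>?r\<rfloor>"
  have r0: "0 \<le> ?r" using b \<nu> by simp
  have kr: "real k \<le> ?r" "?r \<le> real k + 1" unfolding k_def using r0 by linarith+
  have "real k < real (min Mt Mr)" using False kr(1) unfolding Mmin_def by linarith
  then have "k < min Mt Mr" by (simp only: of_nat_less_iff)
  moreover have "b * (real k + (?r - real k)) = \<nu>" using b by simp
  moreover have "dstar Mt Mr ?r = Phi Mt Mr k - Ups Mt Mr k * (?r - real k)"
    using False by (simp add: dstar_def k_def Let_def)
  ultimately show ?thesis unfolding exponent_at_def using kr
    by (intro exI[of _ k] exI[of _ "?r - real k"]) auto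
qed

lemma k_idx_eq:
  assumes k: "l_idx Mt Mr \<nu> \<le> k" "k \<le> min Mt Mr - 1"
    and b: "2 * real k - 1 + Mmax Mt Mr - Mmin Mt Mr \<le> b" "b < 2 * real k + 1 + Mmax Mt Mr - Mmin Mt Mr"
  shows "k_idx Mt Mr \<nu> b = k"
  unfolding k_idx_def
proof (rule the_equality)
  fix j assume j: "j \<in> {l_idx Mt Mr \<nu>..min Mt Mr - 1} \<and> 2 * real j - 1 + Mmax Mt Mr - Mmin Mt Mr \<le> b
    \<and> b < 2 * real j + 1 + Mmax Mt Mr - Mmin Mt Mr"
  then have "real j < real k + 1" "real k < real j + 1" using b by linarith+
  then show "j = k" by linarith
qed (use assms in auto)

lemma sum_odd: "(\<Sum>i=1..k. 2 * real i - 1 + \<delta>) = real k * (real k + \<delta>)"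
  by (induction k) (auto simp: algebra_simps)

text \<open>The first \<open>k\<close> terms do not exceed \<open>b\<close> and add up to the
  diversity at rank \<open>min Mt Mr - k\<close>; each of the others contributes \<open>b\<close>.
  So the MIMO exponent is the bound evaluated at that rank when \<open>b\<close> times the rank
  dominates \<open>\<nu>\<close>.\<close>

lemma Delta_MIMO_eq:
  assumes k: "k \<le> min Mt Mr"
    and b: "2 * real k - 1 + Mmax Mt Mr - Mmin Mt Mr \<le> b" "b \<le> 2 * real k + 1 + Mmax Mt Mr - Mmin Mt Mr"
  shows "Delta_MIMO Mt Mr b = Phi Mt Mr (min Mt Mr - k) + b * real (min Mt Mr - k)"
proof -
  let ?\<delta> = "Mmax Mt Mr - Mmin Mt Mr"
  have "Delta_MIMO Mt Mr b = (\<Sum>i\<in>{1..k} \<union> {Suc k..min Mt Mr}. min b (2 * real i - 1 + Mmax Mt Mr - Mmin Mt Mr))"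
    unfolding Delta_MIMO_def using k by (intro sum.cong) auto
  also have "\<dots> = (\<Sum>i=1..k. min b (2 * real i - 1 + Mmax Mt Mr - Mmin Mt Mr))
      + (\<Sum>i=Suc k..min Mt Mr. min b (2 * real i - 1 + Mmax Mt Mr - Mmin Mt Mr))"
    by (rule sum.union_disjoint) auto
  also have "(\<Sum>i=1..k. min b (2 * real i - 1 + Mmax Mt Mr - Mmin Mt Mr)) = (\<Sum>i=1..k. 2 * real i - 1 + ?\<delta>)"
  proof (rule sum.cong[OF refl])
    fix i assume "i \<in> {1..k}"
    then have "real i \<le> real k" by simp
    then show "min b (2 * real i - 1 + Mmax Mt Mr - Mmin Mt Mr) = 2 * real i - 1 + ?\<delta>" using b by linarith
  qed
  also have "(\<Sum>i=Suc k..min Mt Mr. min b (2 * real i - 1 + Mmax Mt Mr - Mmin Mt Mr)) = (\<Sum>i=Suc k..min Mt Mr. b)"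
  proof (rule sum.cong[OF refl])
    fix i assume "i \<in> {Suc k..min Mt Mr}"
    then have "real k + 1 \<le> real i" by simp
    then show "min b (2 * real i - 1 + Mmax Mt Mr - Mmin Mt Mr) = b" using b by linarith
  qed
  also have "(\<Sum>i=Suc k..min Mt Mr. b) = b * real (min Mt Mr - k)" by simp
  also have "(\<Sum>i=1..k. 2 * real i - 1 + ?\<delta>) = Phi Mt Mr (min Mt Mr - k)"
    unfolding sum_odd using k by (simp add: Phi_def Mmin_def Mmax_def of_nat_diff algebra_simps)
  finally show ?thesis .
qed

text \<open>Three kinds of rank suffice: \<open>\<nu> / b\<close> wherever the value is given by
  \<open>dstar\<close>, full rank for the values \<open>\<nu>\<close> and
  \<open>b * Mmin Mt Mr\<close>, and \<open>min Mt Mr - k\<close> for the MIMO value. Setting the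
  \<open>dstar\<close> value aside first merges four branches.\<close>

lemma exponent_at_Delta_up:
  assumes M: "1 \<le> Mt" "1 \<le> Mr" and b: "0 < b" and \<nu>: "0 \<le> \<nu>"
  shows "exponent_at Mt Mr b \<nu> (Delta_up Mt Mr b \<nu>)"
proof -
  let ?Ma = "Mmax Mt Mr" and ?Mi = "Mmin Mt Mr"
  let ?l = "real (l_idx Mt Mr \<nu>)" and ?k = "real (k_idx Mt Mr \<nu> b)"
  have Mi: "1 \<le> ?Mi" "?Mi \<le> ?Ma" using M by (auto simp: Mmin_def Mmax_def)
  have ds: "exponent_at Mt Mr b \<nu> (\<nu> + dstar Mt Mr (\<nu> / b))" by (rule exponent_at_dstar[OF M b \<nu>])
  have full: "exponent_at Mt Mr b \<nu> (max \<nu> (b * ?Mi))"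
    using M by (intro exponent_at_rank[of "min Mt Mr"]) (auto simp: Phi_def Mmin_def)
  show ?thesis
  proof (cases "Delta_up Mt Mr b \<nu> = \<nu> + dstar Mt Mr (\<nu> / b)")
    case True
    then show ?thesis using ds by simp
  next
    case False
    then have x: "\<not> ?Ma + ?Mi - 1 \<le> \<nu> / ?Mi" by (auto simp: Delta_up_def Let_def)
    consider "b < \<nu> / ?Mi" | "\<nu> / ?Mi \<le> b" "b < ?Ma - ?Mi + 1" | "\<nu> / ?Mi \<le> b" "?Ma - ?Mi + 1 \<le> b"
      by linarith
    then show ?thesis
    proof cases
      case 1
      then have "Delta_up Mt Mr b \<nu> = \<nu>" using x b by (simp add: Delta_up_def Let_def)
      moreover have "b * ?Mi < \<nu>" using 1 Mi(1) by (simp add: pos_less_divide_eq)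
      ultimately show ?thesis using full by (simp add: max_def)
    next
      case 2
      then have "Delta_up Mt Mr b \<nu> = b * ?Mi" using x b by (simp add: Delta_up_def Let_def)
      moreover have "\<nu> \<le> b * ?Mi" using 2 Mi(1) by (simp add: pos_divide_le_eq)
      ultimately show ?thesis using full by (simp add: max_def split: if_splits)
    next
      case 3
      \<comment> \<open>Since the value differs from the \<open>dstar\<close> formula, the tests of
        those branches must fail; these failures are the three inequalities, and only the MIMO
        branch is left.\<close>
      have lb: "2 * ?l - 1 + ?Ma - ?Mi \<le> b" and kb: "\<nu> / (?Mi - ?k) \<le> b" and bM: "b < ?Ma + ?Mi - 1"
        and D: "Delta_up Mt Mr b \<nu> = Delta_MIMO Mt Mr b"
        using False x 3 b by (auto simp: Delta_up_def Let_def split: if_splits)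
      \<comment> \<open>The solution of
        \<open>2 * k - 1 + \<delta> \<le> b < 2 * k + 1 + \<delta>\<close> with \<delta> the
        difference of the antenna numbers. Exhibiting it is what gives the definite description in
        \<open>k_idx\<close> its value.\<close>
      define k where "k = nat \<lfloor>(b - (?Ma - ?Mi) + 1) / 2\<rfloor>"
      have z0: "1 \<le> (b - (?Ma - ?Mi) + 1) / 2" using 3 by simp
      have k1: "real k \<le> (b - (?Ma - ?Mi) + 1) / 2" "(b - (?Ma - ?Mi) + 1) / 2 < real k + 1"
        unfolding k_def using z0 by linarith+
      have k2: "2 * real k \<le> b - (?Ma - ?Mi) + 1" "b - (?Ma - ?Mi) + 1 < 2 * real k + 2"
        using k1 by (simp_all add: field_simps)
      have kpos: "1 \<le> k" using z0 k1(2) by linarith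
      have "?l < real k + 1" using lb k2(2) by linarith
      then have lk: "l_idx Mt Mr \<nu> \<le> k" by linarith
      have "real k < ?Mi" using bM k2(1) by linarith
      then have "k < min Mt Mr" unfolding Mmin_def of_nat_less_iff .
      then have kM: "k \<le> min Mt Mr - 1" by linarith
      have kk: "k_idx Mt Mr \<nu> b = k" by (rule k_idx_eq[OF lk kM]) (use k2 in linarith)+
      have Mk: "real (min Mt Mr - k) = ?Mi - real k" using kM kpos by (simp add: Mmin_def of_nat_diff)
      \<comment> \<open>The threshold of the MIMO branch says exactly that, at rank
        \<open>min Mt Mr - k\<close>, the maximum is its second argument.\<close>
      have "\<nu> \<le> b * real (min Mt Mr - k)"
        using kb \<open>real k < ?Mi\<close> unfolding kk Mk by (simp add: pos_divide_le_eq)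
      moreover have "Delta_MIMO Mt Mr b = Phi Mt Mr (min Mt Mr - k) + b * real (min Mt Mr - k)"
        by (rule Delta_MIMO_eq) (use kM k2 in linarith)+
      ultimately show ?thesis unfolding D
        using kM kpos \<open>real k < ?Mi\<close> by (intro exponent_at_rank[of "min Mt Mr - k"]) (auto simp: Mmin_def)
    qed
  qed
qed

theorem theorem1:
  fixes Mt Mr :: nat and b \<nu> :: real and \<rho>s :: "real \<Rightarrow> real"
  assumes "Mt \<ge> 1" and "Mr \<ge> 1" and "b > 0" and "\<nu> \<ge> 0"
    and "\<And>\<rho>. \<rho> > 0 \<Longrightarrow> \<rho>s \<rho> > 0"
    and "((\<lambda>\<rho>. log 2 (\<rho>s \<rho>) / log 2 \<rho>) \<longlongrightarrow> \<nu>) at_top"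
  shows "Limsup at_top (\<lambda>\<rho>::real. ereal (- log 2 (enn2real (ED_opt Mt Mr \<rho> (\<rho>s \<rho>) b)) / log 2 \<rho>))
           \<le> ereal (Delta_up Mt Mr b \<nu>)"
proof -
  obtain k f where kf: "k < min Mt Mr" "0 \<le> f" "f \<le> 1"
    "Phi Mt Mr k - Ups Mt Mr k * f + max \<nu> (b * (real k + f)) \<le> Delta_up Mt Mr b \<nu>"
    using exponent_at_Delta_up[OF assms(1-4)] unfolding exponent_at_def by blast
  have "Limsup at_top (\<lambda>\<rho>::real. ereal (- log 2 (enn2real (ED_opt Mt Mr \<rho> (\<rho>s \<rho>) b)) / log 2 \<rho>))
    \<le> ereal (Phi Mt Mr k - Ups Mt Mr k * f + max \<nu> (b * (real k + f)))"
    by (rule exponent_le) (use kf assms in auto)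
  also have "\<dots> \<le> ereal (Delta_up Mt Mr b \<nu>)" using kf(4) by simp
  finally show ?thesis .
qed

end
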